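(* For $u$ a control, let $x(t,0,u)$, $t\ge0$, denote the solution of $$dx(t)=\Big[A x(t)+ Bu(t) + \sum_{k=1}^m N_k x(t) u_k(t)\Big]dt+ \sum_{i=1}^v H_i x(t-)\, dM_i(t),\qquad x(0)=0.$$ Let $P$ be a reachability Gramian, i.e. a symmetric positive definite matrix satisfying $$A^TP^{-1}+P^{-1}A+\sum_{k=1}^m N_k^TP^{-1}N_k+\sum_{i,j=1}^v H_i^TP^{-1}H_jk_{ij}\le-P^{-1}BB^TP^{-1},$$ and let $(p_k)_{k=1,\dots,n}$ be an orthonormal basis of $\mathbb R^n$ consisting of eigenvectors of $P$ with corresponding eigenvalues $(\lambda_k)_{k=1,\dots,n}$. Then for every $T>0$, every control $u$ and every $k\in\{1,\dots,n\}$, $$\sup_{t\in[0,T]}\sqrt{\mathbb E\,\langle x(t,0,u),p_k\rangle_2^2}\;\le\;\lambda_k^{\frac12}\,\|u\|_{L^2_T}\exp\Big(\tfrac12\|u\|_{L^2_T}^2\Big).$$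
   Context: $A,N_k,H_i\in\mathbb R^{n\times n}$ ($k=1,\dots,m$, $i=1,\dots,v$), $B\in\mathbb R^{n\times m}$. $M=(M_1,\dots,M_v)^T$ is an $\mathbb R^v$-valued Lévy process with mean zero and $\mathbb E\|M(t)\|_2^2<\infty$ for all $t\ge0$; its covariance matrix is $K=(k_{ij})_{i,j=1,\dots,v}$, i.e. $\mathbb E[M(t)M^T(t)]=Kt$. Controls $u=(u_1,\dots,u_m)^T$ are deterministic with $\|u\|_{L^2_T}^2:=\int_0^T\|u(t)\|_2^2\,dt<\infty$ for every $T>0$. $x(t-):=\lim_{s\uparrow t}x(s)$; $\langle\cdot,\cdot\rangle_2$ is the Euclidean inner product. Matrix inequalities are in the order of symmetric matrices. Standing assumption (mean square asymptotic stability): all eigenvalues of $A\otimes I+I\otimes A+\sum_{k=1}^m N_k\otimes N_k+\sum_{i,j=1}^v H_i\otimes H_j k_{ij}$ lie in the open left half-plane $\mathbb C_-$. *)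

theory Defs
  imports "HOL-Probability.Probability"
begin

section \<open>Matrices\<close>

definition symmetric_matrix :: "real^'n^'n \<Rightarrow> bool" where
  "symmetric_matrix X \<longleftrightarrow> transpose X = X"

definition psd_matrix :: "real^'n^'n \<Rightarrow> bool" where
  "psd_matrix X \<longleftrightarrow> symmetric_matrix X \<and> (\<forall>v. 0 \<le> v \<bullet> (X *v v))"

definition spd_matrix :: "real^'n^'n \<Rightarrow> bool" where
  "spd_matrix X \<longleftrightarrow> symmetric_matrix X \<and> (\<forall>v. v \<noteq> 0 \<longrightarrow> 0 < v \<bullet> (X *v v))"

definition loewner_le :: "real^'n^'n \<Rightarrow> real^'n^'n \<Rightarrow> bool" where
  "loewner_le X Y \<longleftrightarrow> psd_matrix (Y - X)"

text \<open>The rows and columns of a Kronecker product are indexed by pairs of indices.\<close>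

definition kron :: "real^'n^'n \<Rightarrow> real^'n^'n \<Rightarrow> real^('n \<times> 'n)^('n \<times> 'n)" where
  "kron X Y = (\<chi> r c. X $ fst r $ fst c * Y $ snd r $ snd c)"

definition complex_eigenvalue :: "real^'k^'k \<Rightarrow> complex \<Rightarrow> bool" where
  "complex_eigenvalue X z \<longleftrightarrow> (\<exists>w. w \<noteq> 0 \<and> map_matrix complex_of_real X *v w = z *s w)"

definition mean_square_matrix ::
  "real^'n^'n \<Rightarrow> ('m::finite \<Rightarrow> real^'n^'n) \<Rightarrow> ('v::finite \<Rightarrow> real^'n^'n) \<Rightarrow> real^'v^'v
    \<Rightarrow> real^('n \<times> 'n)^('n \<times> 'n)" where
  "mean_square_matrix A N H K =
     kron A (mat 1) + kron (mat 1) A + (\<Sum>k\<in>UNIV. kron (N k) (N k))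
       + (\<Sum>i\<in>UNIV. \<Sum>j\<in>UNIV. K $ i $ j *\<^sub>R kron (H i) (H j))"

definition mean_square_asymptotically_stable ::
  "real^'n^'n \<Rightarrow> ('m::finite \<Rightarrow> real^'n^'n) \<Rightarrow> ('v::finite \<Rightarrow> real^'n^'n) \<Rightarrow> real^'v^'v \<Rightarrow> bool" where
  "mean_square_asymptotically_stable A N H K \<longleftrightarrow>
     (\<forall>z. complex_eigenvalue (mean_square_matrix A N H K) z \<longrightarrow> Re z < 0)"

definition reachability_gramian ::
  "real^'n^'n \<Rightarrow> real^'m^'n \<Rightarrow> ('m \<Rightarrow> real^'n^'n) \<Rightarrow> ('v::finite \<Rightarrow> real^'n^'n) \<Rightarrow> real^'v^'v
    \<Rightarrow> real^'n^'n \<Rightarrow> bool" where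
  "reachability_gramian A B N H K P \<longleftrightarrow>
     spd_matrix P \<and>
     loewner_le
       (transpose A ** matrix_inv P + matrix_inv P ** A
         + (\<Sum>k\<in>UNIV. transpose (N k) ** matrix_inv P ** N k)
         + (\<Sum>i\<in>UNIV. \<Sum>j\<in>UNIV. K $ i $ j *\<^sub>R (transpose (H i) ** matrix_inv P ** H j)))
       (- (matrix_inv P ** B ** transpose B ** matrix_inv P))"


section \<open>Controls\<close>

definition admissible_control :: "(real \<Rightarrow> 'b::euclidean_space) \<Rightarrow> bool" where
  "admissible_control u \<longleftrightarrow>
     set_borel_measurable lebesgue {0..} u \<and>
     (\<forall>T>0. set_integrable lebesgue {0..T} (\<lambda>t. (norm (u t))\<^sup>2))"

definition L2_norm_upto :: "real \<Rightarrow> (real \<Rightarrow> 'b::euclidean_space) \<Rightarrow> real" where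
  "L2_norm_upto T u = sqrt (LINT t:{0..T}|lebesgue. (norm (u t))\<^sup>2)"


section \<open>Square integrable Levy processes on a filtered probability space\<close>

text \<open>
  Time is \<open>{0..}\<close>; values of filtrations and processes at negative times are irrelevant.
  The usual conditions are not required of the filtration.
\<close>

definition filtered_prob_space :: "'a measure \<Rightarrow> (real \<Rightarrow> 'a measure) \<Rightarrow> bool" where
  "filtered_prob_space M F \<longleftrightarrow>
     prob_space M \<and> filtration (space M) F \<and> (\<forall>t\<ge>0. subalgebra M (F t))"

text \<open>
  A Levy process with respect to the filtration (for the natural filtration, this is the usual
  notion with independent increments). Path regularity is only asked for in the form of
  stochastic continuity; processes with cadlag paths are included.
\<close>

definition levy_process ::
  "'a measure \<Rightarrow> (real \<Rightarrow> 'a measure) \<Rightarrow> (real \<Rightarrow> 'a \<Rightarrow> 'b::euclidean_space) \<Rightarrow> bool" where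
  "levy_process M F L \<longleftrightarrow>
     (\<forall>t\<ge>0. L t \<in> borel_measurable (F t)) \<and>
     (AE \<omega> in M. L 0 \<omega> = 0) \<and>
     (\<forall>s\<ge>0. \<forall>t\<ge>s. prob_space.indep_set M (sets (F s))
        (sets (vimage_algebra (space M) (\<lambda>\<omega>. L t \<omega> - L s \<omega>) borel))) \<and>
     (\<forall>s\<ge>0. \<forall>h\<ge>0. distr M borel (\<lambda>\<omega>. L (s + h) \<omega> - L s \<omega>) = distr M borel (L h)) \<and>
     (\<forall>t\<ge>0. \<forall>e>0.
        ((\<lambda>s. measure M {\<omega> \<in> space M. e \<le> norm (L s \<omega> - L t \<omega>)}) \<longlongrightarrow> 0) (at t within {0..}))"

definition centered_L2_levy_process ::
  "'a measure \<Rightarrow> (real \<Rightarrow> 'a measure) \<Rightarrow> (real \<Rightarrow> 'a \<Rightarrow> real^'v) \<Rightarrow> real^'v^'v \<Rightarrow> bool" where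
  "centered_L2_levy_process M F L K \<longleftrightarrow>
     levy_process M F L \<and>
     (\<forall>t\<ge>0. integrable M (\<lambda>\<omega>. (norm (L t \<omega>))\<^sup>2)) \<and>
     (\<forall>t\<ge>0. (LINT \<omega>|M. L t \<omega>) = 0) \<and>
     (\<forall>t\<ge>0. \<forall>i j. (LINT \<omega>|M. L t \<omega> $ i * L t \<omega> $ j) = K $ i $ j * t)"


section \<open>The Ito integral\<close>

text \<open>
  A list of triples \<open>(a, b, \<xi>)\<close> stands for the simple process that is the sum of the
  processes \<open>\<xi>\<close> times the indicator of \<open>{a<..b}\<close>; the intervals may overlap.
\<close>

type_synonym ('a, 'b) simple_proc = "(real \<times> real \<times> ('a \<Rightarrow> 'b)) list"

definition simple_predictable ::
  "(real \<Rightarrow> 'a measure) \<Rightarrow> ('a, 'b::euclidean_space) simple_proc \<Rightarrow> bool" where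
  "simple_predictable F \<zeta> \<longleftrightarrow>
     (\<forall>(a, b, \<xi>)\<in>set \<zeta>. 0 \<le> a \<and> a \<le> b \<and> \<xi> \<in> borel_measurable (F a) \<and>
        bounded (\<xi> ` space (F a)))"

definition simple_value ::
  "('a, 'b::euclidean_space) simple_proc \<Rightarrow> real \<Rightarrow> 'a \<Rightarrow> 'b" where
  "simple_value \<zeta> s \<omega> = (\<Sum>(a, b, \<xi>)\<leftarrow>\<zeta>. indicator {a<..b} s *\<^sub>R \<xi> \<omega>)"

definition simple_integral_upto ::
  "(real \<Rightarrow> 'a \<Rightarrow> real) \<Rightarrow> ('a, 'b::euclidean_space) simple_proc \<Rightarrow> real \<Rightarrow> 'a \<Rightarrow> 'b" where
  "simple_integral_upto Z \<zeta> t \<omega> =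
     (\<Sum>(a, b, \<xi>)\<leftarrow>\<zeta>. (Z (min b t) \<omega> - Z (min a t) \<omega>) *\<^sub>R \<xi> \<omega>)"

definition predictable_algebra :: "'a measure \<Rightarrow> (real \<Rightarrow> 'a measure) \<Rightarrow> (real \<times> 'a) measure" where
  "predictable_algebra M F =
     sigma ({0<..} \<times> space M) {{a<..b} \<times> E |a b E. 0 \<le> a \<and> a \<le> b \<and> E \<in> sets (F a)}"

text \<open>
  \<open>I\<close> is (a version of) the Ito integral over \<open>{0<..t}\<close> of the predictable process \<open>\<phi>\<close>
  with respect to the real square integrable process \<open>Z\<close>: the \<open>L\<^sup>2\<close> limit of the integrals of
  simple processes that converge to \<open>\<phi>\<close> in \<open>L\<^sup>2\<close> of time and probability. When \<open>Z\<close> is a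
  component of a centred square integrable Levy process, the Ito isometry makes \<open>I\<close> almost surely
  unique and independent of the approximating sequence.
\<close>

definition has_ito_integral ::
  "'a measure \<Rightarrow> (real \<Rightarrow> 'a measure) \<Rightarrow> (real \<Rightarrow> 'a \<Rightarrow> real)
    \<Rightarrow> (real \<Rightarrow> 'a \<Rightarrow> 'b::euclidean_space) \<Rightarrow> real \<Rightarrow> ('a \<Rightarrow> 'b) \<Rightarrow> bool" where
  "has_ito_integral M F Z \<phi> t I \<longleftrightarrow>
     (\<lambda>(s, \<omega>). \<phi> s \<omega>) \<in> borel_measurable (predictable_algebra M F) \<and>
     I \<in> borel_measurable M \<and>
     (\<exists>\<zeta>. (\<forall>k::nat. simple_predictable F (\<zeta> k)) \<and>
        (\<lambda>k. \<integral>\<^sup>+\<omega>. (\<integral>\<^sup>+s\<in>{0<..t}. ennreal ((norm (simple_value (\<zeta> k) s \<omega> - \<phi> s \<omega>))\<^sup>2) \<partial>lborel) \<partial>M)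
          \<longlonglongrightarrow> 0 \<and>
        (\<lambda>k. \<integral>\<^sup>+\<omega>. ennreal ((norm (simple_integral_upto Z (\<zeta> k) t \<omega> - I \<omega>))\<^sup>2) \<partial>M)
          \<longlonglongrightarrow> 0)"


section \<open>The stochastic bilinear system\<close>

definition cadlag :: "(real \<Rightarrow> 'b::euclidean_space) \<Rightarrow> bool" where
  "cadlag f \<longleftrightarrow>
     (\<forall>t\<ge>0. (f \<longlongrightarrow> f t) (at_right t)) \<and> (\<forall>t>0. \<exists>l. (f \<longlongrightarrow> l) (at_left t))"

definition left_limit :: "(real \<Rightarrow> 'b::euclidean_space) \<Rightarrow> real \<Rightarrow> 'b" where
  "left_limit f t = Lim (at_left t) f"

text \<open>
  For each \<open>t\<close> the equation holds almost surely; for cadlag processes this is the same as equality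
  up to indistinguishability.
\<close>

definition bilinear_sde_solution ::
  "'a measure \<Rightarrow> (real \<Rightarrow> 'a measure) \<Rightarrow> (real \<Rightarrow> 'a \<Rightarrow> real^'v)
    \<Rightarrow> real^'n^'n \<Rightarrow> real^'m^'n \<Rightarrow> ('m \<Rightarrow> real^'n^'n) \<Rightarrow> ('v \<Rightarrow> real^'n^'n)
    \<Rightarrow> real^'n \<Rightarrow> (real \<Rightarrow> real^'m) \<Rightarrow> (real \<Rightarrow> 'a \<Rightarrow> real^'n) \<Rightarrow> bool" where
  "bilinear_sde_solution M F L A B N H x0 u x \<longleftrightarrow>
     (\<forall>t\<ge>0. x t \<in> borel_measurable (F t)) \<and>
     (\<forall>\<omega>\<in>space M. cadlag (\<lambda>t. x t \<omega>)) \<and>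
     (AE \<omega> in M. x 0 \<omega> = x0) \<and>
     (\<forall>t\<ge>0. \<exists>I.
        (\<forall>i. has_ito_integral M F (\<lambda>s \<omega>. L s \<omega> $ i)
               (\<lambda>s \<omega>. H i *v left_limit (\<lambda>r. x r \<omega>) s) t (I i)) \<and>
        (AE \<omega> in M. x t \<omega> = x0
           + (LINT s:{0..t}|lebesgue.
                A *v x s \<omega> + B *v u s + (\<Sum>k\<in>UNIV. u s $ k *\<^sub>R (N k *v x s \<omega>)))
           + (\<Sum>i\<in>UNIV. I i \<omega>)))"

end

(*
  Put Q = P^(-1). The solution is x = D + J, where D is the time integral of the drift f and J is a
  square integrable martingale. The expectation of x.Qx can be computed without Ito's formula:
  Fubini gives D.QD = 2 int f.QD ds, the martingale property gives E f(s).QJ(t) = E f(s).QJ(s) for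
  s <= t, and the Ito isometry evaluates E J.QJ. By the inequality for the Gramian and by
  2 u_k N_k x.Qx <= N_k x.Q N_k x + u_k^2 x.Qx, the function V(t) = E x(t).Qx(t) satisfies
  V(t) <= int_0^t |u|^2 (V + 1) ds. Gronwall yields V(t) <= |u|^2 exp(|u|^2) with the L^2 norm of u,
  and (x.p_k)^2 <= lambda_k x.Qx by the Cauchy-Schwarz inequality for P.
*)

theory Submission
  imports Defs
begin

section \<open>Square integrable functions\<close>

text \<open>The obstacle is finiteness of second moments. A solution is only adapted and cadlag, and
  its Ito integrals put \<open>H i *v x\<close> into L^2, which controls \<open>x\<close> itself
  only if the matrices are nonsingular enough. The noise part J, however, is a finite sum of L^2
  limits and so square integrable by construction. A first Gronwall argument, run along each path,
  bounds X by a functional of J and carries square integrability over to X, uniformly on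
  \<open>{0..T}\<close>. Only then are the interchanges of integrals and the second Gronwall
  argument, for V, justified. The martingale property is needed only when tested against functions
  measurable at the earlier time, so neither D nor J has to be shown adapted to a filtration that
  need not be complete. Null sets in time are harmless throughout: the left limit in the noise is
  replaced by the value of the path, since a cadlag path has countably many jumps, and the Lebesgue
  measurable control by a Borel version.\<close>

definition L2 :: "'a measure \<Rightarrow> ('a \<Rightarrow> 'b::euclidean_space) \<Rightarrow> bool" where
  "L2 \<mu> f \<longleftrightarrow> f \<in> borel_measurable \<mu> \<and> integrable \<mu> (\<lambda>x. (norm (f x))\<^sup>2)"

text \<open>Membership in \<open>L2\<close> is part of the definition, because a Bochner integral of
  a non-integrable error would be 0 by default and the limit would say nothing.\<close>

definition L2_tendsto ::
  "'a measure \<Rightarrow> (nat \<Rightarrow> 'a \<Rightarrow> 'b::euclidean_space) \<Rightarrow> ('a \<Rightarrow> 'b) \<Rightarrow> bool" where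
  "L2_tendsto \<mu> f g \<longleftrightarrow> (\<forall>k. L2 \<mu> (f k)) \<and> L2 \<mu> g \<and>
     (\<lambda>k. LINT x|\<mu>. (norm (f k x - g x))\<^sup>2) \<longlonglongrightarrow> 0"

section \<open>Closure properties of square integrable functions, and the Cauchy-Schwarz
  inequality\<close>

lemma norm_add_power2_le:
  fixes a b :: "'b::real_normed_vector"
  shows "(norm (a + b))\<^sup>2 \<le> 2 * (norm a)\<^sup>2 + 2 * (norm b)\<^sup>2"
proof -
  have "(norm (a + b))\<^sup>2 \<le> (norm a + norm b)\<^sup>2"
    by (intro power_mono norm_triangle_ineq) auto
  also have "\<dots> \<le> 2 * (norm a)\<^sup>2 + 2 * (norm b)\<^sup>2"
    using zero_le_power2[of "norm a - norm b"] by (simp add: power2_eq_square algebra_simps)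
  finally show ?thesis .
qed

lemma L2_add:
  assumes "L2 \<mu> f" "L2 \<mu> g"
  shows "L2 \<mu> (\<lambda>x. f x + g x)"
proof -
  have [measurable]: "f \<in> borel_measurable \<mu>" "g \<in> borel_measurable \<mu>"
    using assms by (auto simp: L2_def)
  have "integrable \<mu> (\<lambda>x. 2 * (norm (f x))\<^sup>2 + 2 * (norm (g x))\<^sup>2)"
    using assms by (auto simp: L2_def)
  then have "integrable \<mu> (\<lambda>x. (norm (f x + g x))\<^sup>2)"
    by (rule Bochner_Integration.integrable_bound) (auto simp: norm_add_power2_le)
  then show ?thesis by (simp add: L2_def)
qed

lemma L2_linear:
  assumes "L2 \<mu> f" "bounded_linear h"
  shows "L2 \<mu> (\<lambda>x. h (f x))"
proof -
  have [measurable]: "f \<in> borel_measurable \<mu>" "h \<in> borel_measurable borel"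
    using assms borel_measurable_continuous_onI linear_continuous_on by (auto simp: L2_def)
  obtain K where K: "\<And>x. norm (h x) \<le> norm x * K"
    using bounded_linear.bounded[OF assms(2)] by blast
  have "integrable \<mu> (\<lambda>x. K\<^sup>2 * (norm (f x))\<^sup>2)"
    using assms by (auto simp: L2_def)
  moreover have "(norm (h y))\<^sup>2 \<le> K\<^sup>2 * (norm y)\<^sup>2" for y
    using power_mono[OF K norm_ge_zero, of y 2] by (simp add: power_mult_distrib mult.commute)
  ultimately have "integrable \<mu> (\<lambda>x. (norm (h (f x)))\<^sup>2)"
    by (elim Bochner_Integration.integrable_bound) (auto)
  then show ?thesis by (simp add: L2_def)
qed

lemma L2_diff: "L2 \<mu> f \<Longrightarrow> L2 \<mu> g \<Longrightarrow> L2 \<mu> (\<lambda>x. f x - g x)"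
  using L2_add[of \<mu> f "\<lambda>x. - g x"] by (simp add: L2_def)

lemma L2_zero: "L2 \<mu> (\<lambda>x. 0)"
  by (simp add: L2_def)

lemma L2_sum: "(\<And>i. i \<in> I \<Longrightarrow> L2 \<mu> (f i)) \<Longrightarrow> L2 \<mu> (\<lambda>x. \<Sum>i\<in>I. f i x)"
  by (induction I rule: infinite_finite_induct) (auto intro: L2_add L2_zero)

lemma L2_bounded:
  assumes "finite_measure \<mu>" "f \<in> borel_measurable \<mu>" "\<And>x. x \<in> space \<mu> \<Longrightarrow> norm (f x) \<le> C"
  shows "L2 \<mu> f"
  unfolding L2_def
  using assms by (auto intro!: finite_measure.integrable_const_bound[where B="C\<^sup>2"] AE_I2 power_mono)

lemma L2_cong_AE:
  assumes "L2 \<mu> f" "AE x in \<mu>. f x = g x" "g \<in> borel_measurable \<mu>"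
  shows "L2 \<mu> g"
proof -
  have [measurable]: "f \<in> borel_measurable \<mu>" "g \<in> borel_measurable \<mu>"
    using assms by (auto simp: L2_def)
  have "integrable \<mu> (\<lambda>x. (norm (f x))\<^sup>2)" using assms by (simp add: L2_def)
  also have "?this \<longleftrightarrow> integrable \<mu> (\<lambda>x. (norm (g x))\<^sup>2)"
    using assms(2) by (intro integrable_cong_AE) auto
  finally show ?thesis by (simp add: L2_def)
qed

lemma norm_mult_le_sum_norm2:
  fixes a b :: "'b::real_normed_vector"
  shows "norm a * norm b \<le> (norm a)\<^sup>2 + (norm b)\<^sup>2"
  using sum_squares_bound[of "norm a" "norm b"] mult_nonneg_nonneg[OF norm_ge_zero[of a] norm_ge_zero[of b]]
  by linarith

lemma L2_norm_mult_integrable: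
  assumes "L2 \<mu> f" "L2 \<mu> g"
  shows "integrable \<mu> (\<lambda>x. norm (f x) * norm (g x))"
proof -
  have [measurable]: "f \<in> borel_measurable \<mu>" "g \<in> borel_measurable \<mu>"
    using assms by (auto simp: L2_def)
  have "integrable \<mu> (\<lambda>x. (norm (f x))\<^sup>2 + (norm (g x))\<^sup>2)"
    using assms by (auto simp: L2_def)
  then show ?thesis
  proof (rule Bochner_Integration.integrable_bound, goal_cases)
    case 2
    show ?case
    proof (rule AE_I2)
      fix x
      have "norm (norm (f x) * norm (g x)) = norm (norm (f x)) * norm (norm (g x))" by simp
      also have "\<dots> \<le> (norm (norm (f x)))\<^sup>2 + (norm (norm (g x)))\<^sup>2" by (rule norm_mult_le_sum_norm2)
      finally show "norm (norm (f x) * norm (g x)) \<le> norm ((norm (f x))\<^sup>2 + (norm (g x))\<^sup>2)" by simp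
    qed
  qed simp
qed

lemma L2_inner_integrable:
  assumes "L2 \<mu> f" "L2 \<mu> g"
  shows "integrable \<mu> (\<lambda>x. f x \<bullet> g x)"
proof -
  have [measurable]: "f \<in> borel_measurable \<mu>" "g \<in> borel_measurable \<mu>"
    using assms by (auto simp: L2_def)
  show ?thesis
    by (rule Bochner_Integration.integrable_bound[OF L2_norm_mult_integrable[OF assms]])
       (auto simp: Cauchy_Schwarz_ineq2)
qed

lemma L2_imp_integrable:
  assumes "finite_measure \<mu>" "L2 \<mu> f"
  shows "integrable \<mu> f"
proof -
  interpret finite_measure \<mu> by fact
  have [measurable]: "f \<in> borel_measurable \<mu>" using assms by (auto simp: L2_def)
  have "integrable \<mu> (\<lambda>x. norm (1::real) * norm (f x))"
    by (rule L2_norm_mult_integrable[OF L2_bounded[OF assms(1), of "\<lambda>x. 1" 1] assms(2)]) auto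
  then show ?thesis by (simp add: integrable_norm_iff)
qed

text \<open>Transferred from the inequality for nonnegative integrals; \<open>L2\<close> makes all
  three integrals finite, so it can be read in the reals.\<close>

lemma L2_Cauchy_Schwarz_norm:
  assumes "L2 \<mu> f" "L2 \<mu> g"
  shows "(LINT x|\<mu>. norm (f x) * norm (g x))
    \<le> sqrt (LINT x|\<mu>. (norm (f x))\<^sup>2) * sqrt (LINT x|\<mu>. (norm (g x))\<^sup>2)"
proof -
  have [measurable]: "f \<in> borel_measurable \<mu>" "g \<in> borel_measurable \<mu>"
    using assms by (auto simp: L2_def)
  have i: "integrable \<mu> (\<lambda>x. (norm (f x))\<^sup>2)" "integrable \<mu> (\<lambda>x. (norm (g x))\<^sup>2)"
    using assms by (auto simp: L2_def)
  note fg = L2_norm_mult_integrable[OF assms]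
  have "(\<integral>\<^sup>+x. ennreal (norm (f x)) * ennreal (norm (g x)) \<partial>\<mu>)\<^sup>2
    \<le> (\<integral>\<^sup>+x. (ennreal (norm (f x)))\<^sup>2 \<partial>\<mu>) * (\<integral>\<^sup>+x. (ennreal (norm (g x)))\<^sup>2 \<partial>\<mu>)"
    by (rule Cauchy_Schwarz_nn_integral) auto
  then have "ennreal ((LINT x|\<mu>. norm (f x) * norm (g x))\<^sup>2)
      \<le> ennreal ((LINT x|\<mu>. (norm (f x))\<^sup>2) * (LINT x|\<mu>. (norm (g x))\<^sup>2))"
    by (simp flip: ennreal_mult add: ennreal_power nn_integral_eq_integral fg i)
  then have "(LINT x|\<mu>. norm (f x) * norm (g x))\<^sup>2
      \<le> (LINT x|\<mu>. (norm (f x))\<^sup>2) * (LINT x|\<mu>. (norm (g x))\<^sup>2)"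
    by (subst (asm) ennreal_le_iff) (auto intro!: mult_nonneg_nonneg)
  then show ?thesis by (simp add: real_le_rsqrt real_sqrt_mult[symmetric])
qed

lemma L2_Cauchy_Schwarz:
  assumes "L2 \<mu> f" "L2 \<mu> g"
  shows "\<bar>LINT x|\<mu>. f x \<bullet> g x\<bar>
    \<le> sqrt (LINT x|\<mu>. (norm (f x))\<^sup>2) * sqrt (LINT x|\<mu>. (norm (g x))\<^sup>2)"
proof -
  have "\<bar>LINT x|\<mu>. f x \<bullet> g x\<bar> \<le> (LINT x|\<mu>. \<bar>f x \<bullet> g x\<bar>)"
    by (rule integral_abs_bound)
  also have "\<dots> \<le> (LINT x|\<mu>. norm (f x) * norm (g x))"
    by (intro integral_mono integrable_abs L2_inner_integrable L2_norm_mult_integrable assms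
        Cauchy_Schwarz_ineq2)
  finally show ?thesis using L2_Cauchy_Schwarz_norm[OF assms] by linarith
qed

text \<open>Square integrability of the limit comes for free: some \<open>f k\<close> has squared
  distance below 1 from \<open>g\<close>, so \<open>f k - g\<close> is in \<open>L2\<close>, hence
  \<open>g\<close> is. This is how the convergence of nonnegative integrals in the definition of the
  Ito integral yields square integrable integrands and integrals.\<close>

lemma L2_tendstoI:
  assumes f: "\<And>k. L2 \<mu> (f k)" and [measurable]: "g \<in> borel_measurable \<mu>"
    and lim: "(\<lambda>k. \<integral>\<^sup>+x. ennreal ((norm (f k x - g x))\<^sup>2) \<partial>\<mu>) \<longlonglongrightarrow> 0"
  shows "L2_tendsto \<mu> f g"
proof -
  have fm[measurable]: "f k \<in> borel_measurable \<mu>" for k using f[of k] by (simp add: L2_def)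
  have "eventually (\<lambda>k. (\<integral>\<^sup>+x. ennreal ((norm (f k x - g x))\<^sup>2) \<partial>\<mu>) < 1) sequentially"
    using order_tendstoD(2)[OF lim, of 1] by simp
  then obtain k where k: "(\<integral>\<^sup>+x. ennreal ((norm (f k x - g x))\<^sup>2) \<partial>\<mu>) < 1"
    by (auto simp: eventually_sequentially)
  have "L2 \<mu> (\<lambda>x. f k x - g x)"
    unfolding L2_def
    using k by (auto simp: integrable_iff_bounded intro: less_trans[OF k])
  from L2_diff[OF f[of k] this] have g: "L2 \<mu> g" by simp
  have "integrable \<mu> (\<lambda>x. (norm (f k x - g x))\<^sup>2)" for k
    using L2_diff[OF f[of k] g] by (simp add: L2_def)
  then have "(\<lambda>k. ennreal (LINT x|\<mu>. (norm (f k x - g x))\<^sup>2)) \<longlonglongrightarrow> ennreal 0"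
    using lim by (simp add: nn_integral_eq_integral)
  then have "(\<lambda>k. LINT x|\<mu>. (norm (f k x - g x))\<^sup>2) \<longlonglongrightarrow> 0"
    by (subst (asm) tendsto_ennreal_iff) auto
  then show ?thesis using f g by (simp add: L2_tendsto_def)
qed

text \<open>The difference of the inner products is written through the two errors and the limits
  only, so Cauchy-Schwarz gives a null sequence without a separate bound on the norms of
  \<open>f k\<close> and \<open>g k\<close>.\<close>

lemma L2_tendsto_inner:
  assumes f: "L2_tendsto \<mu> f f'" and g: "L2_tendsto \<mu> g g'"
  shows "(\<lambda>k. LINT x|\<mu>. f k x \<bullet> g k x) \<longlonglongrightarrow> (LINT x|\<mu>. f' x \<bullet> g' x)"
proof -
  have L: "L2 \<mu> (f k)" "L2 \<mu> (g k)" "L2 \<mu> f'" "L2 \<mu> g'" for k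
    using f g by (auto simp: L2_tendsto_def)
  note D = L2_diff[OF L(1) L(3)] L2_diff[OF L(2) L(4)]
  let ?n = "\<lambda>h. sqrt (LINT x|\<mu>. (norm (h x))\<^sup>2)"
  let ?F = "\<lambda>k. ?n (\<lambda>x. f k x - f' x)" and ?G = "\<lambda>k. ?n (\<lambda>x. g k x - g' x)"
  have F: "?F \<longlonglongrightarrow> 0" and G: "?G \<longlonglongrightarrow> 0"
    using f g tendsto_real_sqrt[of "\<lambda>k. LINT x|\<mu>. (norm (f k x - f' x))\<^sup>2" 0 sequentially]
      tendsto_real_sqrt[of "\<lambda>k. LINT x|\<mu>. (norm (g k x - g' x))\<^sup>2" 0 sequentially]
    by (simp_all add: L2_tendsto_def)
  have eq: "(LINT x|\<mu>. f k x \<bullet> g k x) - (LINT x|\<mu>. f' x \<bullet> g' x) =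
      (LINT x|\<mu>. (f k x - f' x) \<bullet> (g k x - g' x)) + (LINT x|\<mu>. (f k x - f' x) \<bullet> g' x)
      + (LINT x|\<mu>. f' x \<bullet> (g k x - g' x))" for k
  proof -
    note I = L2_inner_integrable[OF D(1)[of k] D(2)[of k]] L2_inner_integrable[OF D(1)[of k] L(4)]
      L2_inner_integrable[OF L(3) D(2)[of k]] L2_inner_integrable[OF L(1)[of k] L(2)[of k]]
      L2_inner_integrable[OF L(3) L(4)]
    have "f k x \<bullet> g k x - f' x \<bullet> g' x = (f k x - f' x) \<bullet> (g k x - g' x) + (f k x - f' x) \<bullet> g' x
      + f' x \<bullet> (g k x - g' x)" for x
      by (simp add: inner_diff_left inner_diff_right)
    then show ?thesis
      using I by (simp flip: Bochner_Integration.integral_diff Bochner_Integration.integral_add)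
  qed
  have *: "\<bar>(LINT x|\<mu>. f k x \<bullet> g k x) - (LINT x|\<mu>. f' x \<bullet> g' x)\<bar>
     \<le> ?F k * ?G k + ?F k * ?n g' + ?n f' * ?G k" for k
    unfolding eq
    using L2_Cauchy_Schwarz[OF D(1)[of k] D(2)[of k]] L2_Cauchy_Schwarz[OF D(1)[of k] L(4)]
      L2_Cauchy_Schwarz[OF L(3) D(2)[of k]] by linarith
  have **: "(\<lambda>k. ?F k * ?G k + ?F k * ?n g' + ?n f' * ?G k) \<longlonglongrightarrow> 0 * 0 + 0 * ?n g' + ?n f' * 0"
    by (intro tendsto_intros F G)
  have "(\<lambda>k. (LINT x|\<mu>. f k x \<bullet> g k x) - (LINT x|\<mu>. f' x \<bullet> g' x)) \<longlonglongrightarrow> 0"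
    by (rule Lim_null_comparison[OF always_eventually])
       (use * ** in \<open>simp_all only: mult_zero_left mult_zero_right add_0_left real_norm_def simp_thms\<close>)
  then show ?thesis by (rule LIM_zero_cancel)
qed

lemma L2_tendsto_linear:
  assumes f: "L2_tendsto \<mu> f f'" and h: "bounded_linear h"
  shows "L2_tendsto \<mu> (\<lambda>k x. h (f k x)) (\<lambda>x. h (f' x))"
proof -
  have L: "L2 \<mu> (f k)" "L2 \<mu> f'" for k using f by (auto simp: L2_tendsto_def)
  obtain K where K: "\<And>x. norm (h x) \<le> norm x * K"
    using bounded_linear.bounded[OF h] by blast
  have K2: "(norm (h y))\<^sup>2 \<le> K\<^sup>2 * (norm y)\<^sup>2" for y
    using power_mono[OF K norm_ge_zero, of y 2] by (simp add: power_mult_distrib mult.commute)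
  have i: "integrable \<mu> (\<lambda>x. (norm (f k x - f' x))\<^sup>2)" "integrable \<mu> (\<lambda>x. (norm (h (f k x - f' x)))\<^sup>2)" for k
    using L2_diff[OF L(1)[of k] L(2)] L2_linear[OF L2_diff[OF L(1)[of k] L(2)] h] by (auto simp: L2_def)
  have "(LINT x|\<mu>. (norm (h (f k x - f' x)))\<^sup>2) \<le> K\<^sup>2 * (LINT x|\<mu>. (norm (f k x - f' x))\<^sup>2)" for k
    by (subst integral_mult_right_zero[symmetric], intro integral_mono integrable_mult_right i K2)
  moreover have "(\<lambda>k. K\<^sup>2 * (LINT x|\<mu>. (norm (f k x - f' x))\<^sup>2)) \<longlonglongrightarrow> K\<^sup>2 * 0"
    using f by (intro tendsto_intros) (auto simp: L2_tendsto_def)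
  ultimately have "(\<lambda>k. LINT x|\<mu>. (norm (h (f k x - f' x)))\<^sup>2) \<longlonglongrightarrow> 0"
    by (intro Lim_null_comparison[where g="\<lambda>k. K\<^sup>2 * (LINT x|\<mu>. (norm (f k x - f' x))\<^sup>2)"
          and f="\<lambda>k. LINT x|\<mu>. (norm (h (f k x - f' x)))\<^sup>2", OF always_eventually[OF allI]])
       simp_all
  then show ?thesis
    using L L2_linear[OF L(1) h] L2_linear[OF L(2) h]
    by (simp add: L2_tendsto_def linear_diff[OF bounded_linear.linear[OF h]])
qed

lemma L2_tendsto_const: "L2 \<mu> f \<Longrightarrow> L2_tendsto \<mu> (\<lambda>k. f) f"
  by (simp add: L2_tendsto_def)

section \<open>Integration over initial segments of the half line\<close>

text \<open>A density on the whole line keeps the Borel sigma algebra independent of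
  \<open>t\<close>. The measure is finite, and zero for negative \<open>t\<close>. The point 0 is
  excluded, as in the Ito integral; left limits of paths are available at positive times
  only.\<close>

definition lborel_upto :: "real \<Rightarrow> real measure" where
  "lborel_upto t = density lborel (\<lambda>s. ennreal (indicator {0<..t} s))"

lemma sets_upto[simp, measurable_cong]: "sets (lborel_upto t) = sets borel"
  and space_upto[simp]: "space (lborel_upto t) = UNIV"
  by (auto simp: lborel_upto_def)

lemma emeasure_space_upto: "emeasure (lborel_upto t) (space (lborel_upto t)) = ennreal (max 0 t)"
proof -
  have "emeasure (lborel_upto t) (space (lborel_upto t)) = (\<integral>\<^sup>+s. indicator {0<..t} s \<partial>lborel)"
    unfolding lborel_upto_def by (subst emeasure_density) (auto simp: ennreal_indicator)
  then show ?thesis by (cases "0 \<le> t") (auto simp: max_def)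
qed

lemma finite_measure_upto[simp, intro]: "finite_measure (lborel_upto t)"
  using emeasure_space_upto[of t] by (intro finite_measureI) auto

lemma AE_upto: "(AE s in lborel_upto t. P s) \<longleftrightarrow> (AE s in lborel. 0 < s \<and> s \<le> t \<longrightarrow> P s)"
proof -
  have *: "0 < ennreal (indicator {0<..t} s) \<longleftrightarrow> 0 < s \<and> s \<le> t" for s
    by (auto simp: indicator_def)
  show ?thesis unfolding lborel_upto_def by (subst AE_density) (auto simp only: *, auto)
qed

lemma nn_integral_upto:
  "f \<in> borel_measurable borel \<Longrightarrow> (\<integral>\<^sup>+s. f s \<partial>lborel_upto t) = (\<integral>\<^sup>+s\<in>{0<..t}. f s \<partial>lborel)"
  unfolding lborel_upto_def by (subst nn_integral_density) (auto simp: ennreal_indicator mult.commute)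

lemma integrable_upto:
  fixes f :: "real \<Rightarrow> 'b::{banach, second_countable_topology}"
  assumes "f \<in> borel_measurable borel"
  shows "integrable (lborel_upto t) f \<longleftrightarrow> integrable lborel (\<lambda>s. indicator {0<..t} s *\<^sub>R f s)"
  unfolding lborel_upto_def using assms by (subst integrable_density) auto

lemma integral_upto:
  fixes f :: "real \<Rightarrow> 'b::{banach, second_countable_topology}"
  assumes "f \<in> borel_measurable borel"
  shows "(LINT s|lborel_upto t. f s) = (LINT s|lborel. indicator {0<..t} s *\<^sub>R f s)"
  unfolding lborel_upto_def using assms by (subst integral_density) auto

lemma integrable_upto_mono:
  fixes f :: "real \<Rightarrow> 'b::{banach, second_countable_topology}"
  assumes "integrable (lborel_upto t) f" "s \<le> t"
  shows "integrable (lborel_upto s) f"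
proof -
  have [measurable]: "f \<in> borel_measurable borel"
    using borel_measurable_integrable[OF assms(1)] by simp
  have "integrable lborel (\<lambda>r. indicator {0<..s} r *\<^sub>R indicator {0<..t} r *\<^sub>R f r)"
    using assms(1) by (intro integrable_mult_indicator[of "{0<..s}"]) (simp_all add: integrable_upto)
  also have "(\<lambda>r. indicator {0<..s} r *\<^sub>R indicator {0<..t} r *\<^sub>R f r) = (\<lambda>r. indicator {0<..s} r *\<^sub>R f r)"
    using assms(2) by (auto simp: indicator_def)
  finally show ?thesis by (subst integrable_upto) auto
qed

text \<open>Brings integrals with different upper limits under one measure, so that they can be
  compared or subtracted.\<close>

lemma integral_upto_eq_upto:
  fixes f :: "real \<Rightarrow> 'b::{banach, second_countable_topology}"
  assumes "f \<in> borel_measurable borel" "s \<le> t"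
  shows "(LINT r|lborel_upto s. f r) = (LINT r|lborel_upto t. indicator {..s} r *\<^sub>R f r)"
  using assms by (simp add: integral_upto) (auto intro!: Bochner_Integration.integral_cong simp: indicator_def)

text \<open>The measure itself varies with \<open>x\<close>. Moving the cutoff at \<open>T x\<close>
  into the integrand leaves a fixed measure, for which parametrized integrals are known to be
  measurable.\<close>

lemma borel_measurable_integral_upto[measurable]:
  fixes f :: "'a \<Rightarrow> real \<Rightarrow> 'b::{banach, second_countable_topology}"
  assumes f: "case_prod f \<in> borel_measurable (N \<Otimes>\<^sub>M borel)" and T[measurable]: "T \<in> borel_measurable N"
  shows "(\<lambda>x. LINT s|lborel_upto (T x). f x s) \<in> borel_measurable N"
proof -
  have [measurable]: "(\<lambda>z. f (fst z) (snd z)) \<in> borel_measurable (N \<Otimes>\<^sub>M borel)"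
    using f by (simp add: split_beta')
  have "(LINT s|lborel_upto (T x). f x s) = (LINT s|lborel. (if 0 < s \<and> s \<le> T x then 1 else 0) *\<^sub>R f x s)"
    if "x \<in> space N" for x
  proof -
    have "f x \<in> borel_measurable borel"
      using measurable_Pair2[OF f that] by simp
    then show ?thesis
      by (auto simp: integral_upto indicator_def intro!: Bochner_Integration.integral_cong)
  qed
  moreover have "(\<lambda>x. LINT s|lborel. (if 0 < s \<and> s \<le> T x then 1 else 0) *\<^sub>R f x s) \<in> borel_measurable N"
    by measurable
  ultimately show ?thesis by (subst measurable_cong)
qed

lemma continuous_on_integral_upto:
  fixes f :: "real \<Rightarrow> 'b::euclidean_space"
  assumes "integrable (lborel_upto T) f"
  shows "continuous_on {0..T} (\<lambda>t. LINT s|lborel_upto t. f s)"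
proof -
  have [measurable]: "f \<in> borel_measurable borel"
    using borel_measurable_integrable[OF assms] by simp
  define g where "g s = indicator {0<..T} s *\<^sub>R f s" for s
  have g: "integrable lborel g" using assms by (simp add: integrable_upto g_def[abs_def])
  then have gi: "set_integrable lborel {0..t} g" for t
    unfolding set_integrable_def by (intro integrable_mult_indicator) auto
  have "continuous_on {0..T} (\<lambda>t. integral {0..t} g)"
    by (intro indefinite_integral_continuous_1 set_borel_integral_eq_integral gi)
  moreover have "integral {0..t} g = (LINT s|lborel_upto t. f s)" if "t \<in> {0..T}" for t
  proof -
    have "integral {0..t} g = (LINT s:{0..t}|lborel. g s)"
      using set_borel_integral_eq_integral[OF gi] by simp
    also have "\<dots> = (LINT s|lborel_upto t. f s)"
      unfolding set_lebesgue_integral_def using that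
      by (subst integral_upto) (auto intro!: Bochner_Integration.integral_cong simp: g_def indicator_def)
    finally show ?thesis .
  qed
  ultimately show ?thesis
    using continuous_on_cong[of "{0..T}" "{0..T}" "\<lambda>t. integral {0..t} g" "\<lambda>t. LINT s|lborel_upto t. f s"] by simp
qed

text \<open>The rate \<open>c\<close> is only integrable, so differentiating the right-hand side is
  avoided. A growth estimate is proved on short intervals, where continuity of the integral of
  \<open>c\<close> makes its increment small, and is then extended by bisection.\<close>

lemma gronwall:
  fixes c Y :: "real \<Rightarrow> real"
  assumes c: "integrable (lborel_upto T) c" "\<And>s. 0 \<le> c s"
    and Y[measurable]: "Y \<in> borel_measurable borel"
    and Y0: "\<And>t. t \<in> {0..T} \<Longrightarrow> 0 \<le> Y t" and YB: "\<And>t. t \<in> {0..T} \<Longrightarrow> Y t \<le> B"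
    and le: "\<And>t. t \<in> {0..T} \<Longrightarrow> Y t \<le> a + (LINT s|lborel_upto t. c s * Y s)"
    and a: "0 \<le> a" and t: "t \<in> {0..T}"
  shows "Y t \<le> a * exp (LINT s|lborel_upto t. c s)"
proof -
  have [measurable]: "c \<in> borel_measurable borel"
    using borel_measurable_integrable[OF c(1)] by simp
  have cY: "integrable (lborel_upto T) (\<lambda>s. c s * Y s)"
  proof (rule Bochner_Integration.integrable_bound)
    show "integrable (lborel_upto T) (\<lambda>s. c s * B)" using c by simp
    show "AE s in lborel_upto T. norm (c s * Y s) \<le> norm (c s * B)"
      unfolding AE_upto using c(2) Y0 YB
      by (intro AE_I2) (auto simp: abs_mult intro!: mult_left_mono order_trans[OF _ abs_ge_self])
  qed simp
  \<comment> \<open>\<open>R\<close> is the right-hand side of the hypothesis. It dominates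
    \<open>Y\<close> and, unlike \<open>Y\<close>, is nondecreasing.\<close>
  define R where "R t = a + (LINT s|lborel_upto t. c s * Y s)" for t
  define C where "C t = (LINT s|lborel_upto t. c s)" for t
  have diff: "(LINT r|lborel_upto t. f r) - (LINT r|lborel_upto s. f r) = (LINT r|lborel_upto t. indicator {s<..} r * f r)"
    if "s \<le> t" "t \<le> T" "integrable (lborel_upto T) f" for s t and f :: "real \<Rightarrow> real"
  proof -
    have [measurable]: "f \<in> borel_measurable borel"
      using borel_measurable_integrable[OF that(3)] by simp
    have i: "integrable (lborel_upto t) f" using integrable_upto_mono that by blast
    have "(LINT r|lborel_upto t. f r) - (LINT r|lborel_upto s. f r) = (LINT r|lborel_upto t. f r - indicator {..s} r *\<^sub>R f r)"
      unfolding integral_upto_eq_upto[OF \<open>f \<in> borel_measurable borel\<close> that(1)]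
      by (rule Bochner_Integration.integral_diff[symmetric, OF i]) (intro integrable_mult_indicator i, simp)
    also have "\<dots> = (LINT r|lborel_upto t. indicator {s<..} r * f r)"
      by (intro Bochner_Integration.integral_cong) (auto simp: indicator_def)
    finally show ?thesis .
  qed
  have mono: "R s \<le> R t" if "0 \<le> s" "s \<le> t" "t \<le> T" for s t
  proof -
    have "0 \<le> (LINT r|lborel_upto t. indicator {s<..} r * (c r * Y r))"
      using that c(2) Y0 by (intro integral_nonneg_AE) (auto simp: AE_upto indicator_def)
    then show ?thesis using diff[OF that(2,3) cY] by (simp add: R_def)
  qed
  have R0: "0 \<le> R t" if "0 \<le> t" "t \<le> T" for t
    using order_trans[OF Y0 le] that by (simp add: R_def)
  \<comment> \<open>Since \<open>Y r\<close> is at most \<open>R r\<close>, which is at most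
    \<open>R t\<close>, the factor \<open>R t\<close> leaves the integral. It is the value at the
    right end, which is what the slack \<open>e\<close> below has to pay for.\<close>
  have step: "R t - R s \<le> R t * (C t - C s)" if "0 \<le> s" "s \<le> t" "t \<le> T" for s t
  proof -
    have "(LINT r|lborel_upto t. indicator {s<..} r * (c r * Y r)) \<le> (LINT r|lborel_upto t. R t * (indicator {s<..} r * c r))"
    proof (rule integral_mono_AE)
      have "integrable (lborel_upto t) (\<lambda>r. indicator {s<..} r *\<^sub>R (c r * Y r))"
        by (intro integrable_mult_indicator integrable_upto_mono[OF cY] that) simp
      then show "integrable (lborel_upto t) (\<lambda>r. indicator {s<..} r * (c r * Y r))" by simp
      have "integrable (lborel_upto t) (\<lambda>r. indicator {s<..} r *\<^sub>R c r)"
        by (intro integrable_mult_indicator integrable_upto_mono[OF c(1)] that) simp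
      then show "integrable (lborel_upto t) (\<lambda>r. R t * (indicator {s<..} r * c r))" by simp
      have "c r * Y r \<le> R t * c r" if r: "0 < r" "r \<le> t" for r
      proof -
        have "Y r \<le> R r" using le[of r] r \<open>t \<le> T\<close> by (simp add: R_def)
        also have "\<dots> \<le> R t" using mono r \<open>t \<le> T\<close> by simp
        finally show ?thesis using c(2)[of r] by (simp add: mult.commute[of "R t"] mult_left_mono)
      qed
      then show "AE r in lborel_upto t. indicator {s<..} r * (c r * Y r) \<le> R t * (indicator {s<..} r * c r)"
        unfolding AE_upto by (intro AE_I2) (auto simp: indicator_def)
    qed
    then show ?thesis
      unfolding integral_mult_right_zero diff[OF that(2,3) c(1), symmetric]
        diff[OF that(2,3) cY, symmetric] by (simp add: R_def C_def)
  qed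
  have C0: "C s \<le> C t" if "0 \<le> s" "s \<le> t" "t \<le> T" for s t
  proof -
    have "0 \<le> (LINT r|lborel_upto t. indicator {s<..} r * c r)"
      using c(2) by (intro integral_nonneg_AE) auto
    then show ?thesis using diff[OF that(2,3) c(1)] by (simp add: C_def)
  qed
  have contC: "continuous_on {0..T} C"
    unfolding C_def by (rule continuous_on_integral_upto[OF c(1)])
  have main: "R t \<le> a * exp ((1 + e) * C t)" if e: "e > 0" for e
  proof -
    \<comment> \<open>Exponential growth from \<open>s\<close> to \<open>r\<close>, an assertion
      that can be chained over adjacent intervals. The factor \<open>1 + e\<close> in the exponent
      makes it provable locally.\<close>
    define P where "P s r \<longleftrightarrow> (0 \<le> s \<and> s \<le> r \<and> r \<le> T \<longrightarrow> R r \<le> R s * exp ((1 + e) * (C r - C s)))" for s r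
    have "0 \<le> t" using t by simp
    then have "P 0 t"
    proof (induction rule: Bolzano)
      case (trans x y z)
      show ?case unfolding P_def
      proof
        assume xz: "0 \<le> x \<and> x \<le> z \<and> z \<le> T"
        have "R z \<le> R y * exp ((1 + e) * (C z - C y))"
          using trans xz by (auto simp: P_def)
        also have "\<dots> \<le> (R x * exp ((1 + e) * (C y - C x))) * exp ((1 + e) * (C z - C y))"
          using trans xz by (intro mult_right_mono) (auto simp: P_def)
        also have "\<dots> = R x * exp ((1 + e) * (C z - C x))"
          by (simp add: mult.assoc exp_add[symmetric] algebra_simps)
        finally show "R z \<le> R x * exp ((1 + e) * (C z - C x))" .
      qed
    next
      case (local x)
      then have x: "x \<in> {0..T}" using t by auto
      \<comment> \<open>The largest increment \<open>h\<close> with \<open>(1 + e) * h\<close> at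
        most \<open>e\<close>; for such \<open>h\<close> the product of \<open>1 - h\<close> and
        \<open>1 + (1 + e) * h\<close> is at least 1.\<close>
      define h0 where "h0 = e / (1 + e)"
      have h0: "h0 > 0" using e by (simp add: h0_def)
      obtain d where d: "d > 0" "\<And>y. y \<in> {0..T} \<Longrightarrow> dist y x < d \<Longrightarrow> dist (C y) (C x) < h0 / 2"
        using contC x h0 unfolding continuous_on_iff by (metis half_gt_zero)
      show ?case
      proof (intro exI[of _ d] conjI allI impI d)
        fix s r assume sr: "s \<le> x \<and> x \<le> r \<and> r - s < d"
        show "P s r" unfolding P_def
        proof
          assume 0: "0 \<le> s \<and> s \<le> r \<and> r \<le> T"
          define h where "h = C r - C s"
          have "dist (C s) (C x) < h0 / 2" "dist (C r) (C x) < h0 / 2"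
            using sr 0 x by (intro d(2); simp add: dist_real_def)+
          then have h: "0 \<le> h" "h \<le> h0" using C0[of s r] 0 unfolding h_def dist_real_def by linarith+
          then have "(1 + e) * h \<le> e" using e by (simp add: h0_def pos_le_divide_eq mult.commute)
          then have "h * ((1 + e) * h) \<le> h * e" using h by (intro mult_left_mono)
          then have "1 \<le> (1 - h) * (1 + (1 + e) * h)" by (simp add: algebra_simps)
          also have "\<dots> \<le> (1 - h) * exp ((1 + e) * h)"
          proof (rule mult_left_mono)
            have "h0 \<le> 1" using e by (simp add: h0_def)
            then show "0 \<le> 1 - h" using h by simp
          qed (rule exp_ge_add_one_self)
          finally have "R r * 1 \<le> R r * ((1 - h) * exp ((1 + e) * h))"
            using R0[of r] 0 by (intro mult_left_mono) auto
          also have "\<dots> = (R r - R r * h) * exp ((1 + e) * h)" by (simp add: algebra_simps)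
          also have "\<dots> \<le> R s * exp ((1 + e) * h)"
            using step[of s r] 0 by (intro mult_right_mono) (auto simp: h_def)
          finally show "R r \<le> R s * exp ((1 + e) * (C r - C s))" by (simp add: h_def)
        qed
      qed
    qed
    moreover have "R 0 = a" "C 0 = 0" by (simp_all add: R_def C_def integral_upto)
    ultimately show ?thesis using t by (auto simp: P_def)
  qed
  \<comment> \<open>The slack disappears in the limit of \<open>e\<close> to 0 from the
    right.\<close>
  have "((\<lambda>e. a * exp ((1 + e) * C t)) \<longlongrightarrow> a * exp ((1 + 0) * C t)) (at_right 0)"
    by (intro tendsto_intros)
  then have "R t \<le> a * exp ((1 + 0) * C t)"
    by (rule tendsto_lowerbound) (auto simp: eventually_at_right_less main intro: eventually_mono[OF eventually_at_right_less])
  then show ?thesis using le[OF t] by (simp add: R_def C_def)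
qed

text \<open>The product rule for an indefinite integral. The left side is a double integral over a
  square; cut along the diagonal, it falls into two triangles that contribute equally because
  \<open>h\<close> is symmetric. In each of them the inner integral is an indefinite integral
  again.\<close>

lemma integral_quadratic_indefinite:
  fixes f :: "real \<Rightarrow> 'b::euclidean_space"
  assumes f: "integrable (lborel_upto t) f" and h: "bounded_linear h" and sym: "\<And>v w. v \<bullet> h w = h v \<bullet> w"
  defines "D \<equiv> (\<lambda>s. LINT r|lborel_upto s. f r)"
  shows "D t \<bullet> h (D t) = 2 * (LINT s|lborel_upto t. f s \<bullet> h (D s))"
proof -
  interpret lborel_upto: finite_measure "lborel_upto t" by simp
  interpret P: pair_sigma_finite "lborel_upto t" "lborel_upto t" ..
  interpret h: bounded_linear h by fact
  have [measurable]: "f \<in> borel_measurable borel"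
    using borel_measurable_integrable[OF f] by simp
  have [measurable]: "h \<in> borel_measurable borel"
    by (intro borel_measurable_continuous_onI linear_continuous_on h)
  have hf: "integrable (lborel_upto t) (\<lambda>r. h (f r))" by (rule integrable_bounded_linear[OF h f])
  have G: "integrable (lborel_upto t \<Otimes>\<^sub>M lborel_upto t) (\<lambda>(s, r). f s \<bullet> h (f r))"
  proof (rule P.Fubini_integrable)
    have *: "(LINT r|lborel_upto t. \<bar>f s \<bullet> h (f r)\<bar>) \<le> norm (f s) * (LINT r|lborel_upto t. norm (h (f r)))" for s
      by (subst integral_mult_right_zero[symmetric], intro integral_mono)
         (auto intro!: integrable_abs integrable_inner_right hf integrable_norm Cauchy_Schwarz_ineq2)
    then show "integrable (lborel_upto t) (\<lambda>s. LINT r|lborel_upto t. norm (case (s, r) of (s, r) \<Rightarrow> f s \<bullet> h (f r)))"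
    proof -
      have "norm (LINT r|lborel_upto t. norm (case (s, r) of (s, r) \<Rightarrow> f s \<bullet> h (f r)))
          \<le> norm (norm (f s) * (LINT r|lborel_upto t. norm (h (f r))))" for s
        using *[of s] by (simp add: abs_mult)
      moreover have "integrable (lborel_upto t) (\<lambda>s. norm (f s) * (LINT r|lborel_upto t. norm (h (f r))))" using f by simp
      ultimately show ?thesis
        by (elim Bochner_Integration.integrable_bound) auto
    qed
  qed (auto intro!: AE_I2 integrable_inner_right hf)
  have ind: "integrable (lborel_upto t \<Otimes>\<^sub>M lborel_upto t) (\<lambda>(s, r). of_bool (Q s r) * (f s \<bullet> h (f r)))"
    if [measurable]: "Measurable.pred (borel \<Otimes>\<^sub>M borel) (\<lambda>(s, r). Q s r)" for Q
  proof (rule Bochner_Integration.integrable_bound[OF G])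
    show "(\<lambda>(s, r). of_bool (Q s r) * (f s \<bullet> h (f r))) \<in> borel_measurable (lborel_upto t \<Otimes>\<^sub>M lborel_upto t)"
      using that unfolding split_beta' by measurable
  qed auto
  note i1 = ind[of "\<lambda>s r. r \<le> s"] and i2 = ind[of "\<lambda>s r. s < r"]
  have "D t \<bullet> h (D t) = (LINT s|lborel_upto t. f s) \<bullet> (LINT r|lborel_upto t. h (f r))"
    by (simp add: D_def integral_bounded_linear[OF h f])
  also have "\<dots> = (LINT s|lborel_upto t. LINT r|lborel_upto t. f s \<bullet> h (f r))"
    by (simp add: f hf)
  also have "\<dots> = (LINT (s, r)|(lborel_upto t \<Otimes>\<^sub>M lborel_upto t). f s \<bullet> h (f r))"
    using P.integral_fst'[OF G] by simp
  also have "\<dots> = (LINT (s, r)|(lborel_upto t \<Otimes>\<^sub>M lborel_upto t). of_bool (r \<le> s) * (f s \<bullet> h (f r)) + of_bool (s < r) * (f s \<bullet> h (f r)))"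
    by (intro Bochner_Integration.integral_cong) (auto simp: of_bool_def)
  also have "\<dots> = (LINT (s, r)|(lborel_upto t \<Otimes>\<^sub>M lborel_upto t). of_bool (r \<le> s) * (f s \<bullet> h (f r)))
      + (LINT (s, r)|(lborel_upto t \<Otimes>\<^sub>M lborel_upto t). of_bool (s < r) * (f s \<bullet> h (f r)))"
    using Bochner_Integration.integral_add[OF i1 i2] by (simp add: split_beta')
  also have "(LINT (s, r)|(lborel_upto t \<Otimes>\<^sub>M lborel_upto t). of_bool (s < r) * (f s \<bullet> h (f r)))
     = (LINT r|lborel_upto t. LINT s|lborel_upto t. of_bool (s < r) * (f s \<bullet> h (f r)))"
    using P.integral_snd[OF i2] by simp
  also have "\<dots> = (LINT r|lborel_upto t. LINT s|lborel_upto t. of_bool (s \<le> r) * (f r \<bullet> h (f s)))"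
  proof (rule Bochner_Integration.integral_cong[OF refl])
    fix r
    show "(LINT s|lborel_upto t. of_bool (s < r) * (f s \<bullet> h (f r))) = (LINT s|lborel_upto t. of_bool (s \<le> r) * (f r \<bullet> h (f s)))"
    proof (rule integral_cong_AE)
      have *: "f s \<bullet> h (f r) = f r \<bullet> h (f s)" for s
        using sym[of "f s" "f r"] inner_commute[of "h (f s)" "f r"] by metis
      \<comment> \<open>The strict and the weak inequality differ only at \<open>s = r\<close>, a
        null set.\<close>
      show "AE s in lborel_upto t. of_bool (s < r) * (f s \<bullet> h (f r)) = of_bool (s \<le> r) * (f r \<bullet> h (f s))"
        unfolding AE_upto using AE_lborel_singleton[of r]
      proof eventually_elim
        case (elim s)
        then show ?case using *[of s] by auto
      qed
    qed auto
  qed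
  also have "(LINT (s, r)|(lborel_upto t \<Otimes>\<^sub>M lborel_upto t). of_bool (r \<le> s) * (f s \<bullet> h (f r)))
     = (LINT s|lborel_upto t. LINT r|lborel_upto t. of_bool (r \<le> s) * (f s \<bullet> h (f r)))"
    using P.integral_fst'[OF i1] by simp
  also have "(LINT s|lborel_upto t. LINT r|lborel_upto t. of_bool (r \<le> s) * (f s \<bullet> h (f r))) = (LINT s|lborel_upto t. f s \<bullet> h (D s))"
  proof (rule integral_cong_AE)
    have "(LINT r|lborel_upto t. of_bool (r \<le> s) * (f s \<bullet> h (f r))) = f s \<bullet> h (D s)" if "s \<le> t" for s
    proof -
      have "integrable (lborel_upto t) (\<lambda>r. indicator {..s} r *\<^sub>R h (f r))"
        by (intro integrable_mult_indicator hf) simp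
      then have "f s \<bullet> (LINT r|lborel_upto t. indicator {..s} r *\<^sub>R h (f r)) = (LINT r|lborel_upto t. f s \<bullet> (indicator {..s} r *\<^sub>R h (f r)))"
        by (intro integral_inner_right[symmetric])
      also have "\<dots> = (LINT r|lborel_upto t. of_bool (r \<le> s) * (f s \<bullet> h (f r)))"
        by (intro Bochner_Integration.integral_cong) (auto simp: indicator_def)
      also have "(LINT r|lborel_upto t. indicator {..s} r *\<^sub>R h (f r)) = h (D s)"
        using that f by (subst integral_upto_eq_upto[symmetric])
          (auto simp: D_def integral_bounded_linear[OF h integrable_upto_mono[OF f]])
      finally show ?thesis by simp
    qed
    then show "AE s in lborel_upto t. (LINT r|lborel_upto t. of_bool (r \<le> s) * (f s \<bullet> h (f r))) = f s \<bullet> h (D s)"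
      by (auto simp: AE_upto)
    show "(\<lambda>s. f s \<bullet> h (D s)) \<in> borel_measurable (lborel_upto t)"
      unfolding D_def by measurable
  qed simp
  finally show ?thesis 
    using \<open>(LINT s|lborel_upto t. LINT r|lborel_upto t. of_bool (r \<le> s) * (f s \<bullet> h (f r))) = (LINT s|lborel_upto t. f s \<bullet> h (D s))\<close> by simp
qed

section \<open>Cadlag functions\<close>

text \<open>Every point has a neighbourhood in which the values stay within 1 of the value at the
  point or of the left limit there; bisection passes from this to the whole interval.\<close>

lemma cadlag_bounded:
  assumes f: "cadlag f"
  shows "bounded (f ` {0..t})"
proof (cases "0 \<le> t")
  case True
  \<comment> \<open>The neighbourhoods of 0 reach negative times, where \<open>f\<close> is
    arbitrary; intersecting with \<open>Z\<close> discards them.\<close>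
  define Z :: "real set" where "Z = {0..}"
  have "bounded (f ` ({0..t} \<inter> Z))" using True
  proof (induction rule: Bolzano)
    case (trans a b c)
    have "f ` ({a..c} \<inter> Z) = f ` ({a..b} \<inter> Z) \<union> f ` ({b..c} \<inter> Z)"
      unfolding image_Un[symmetric] using trans by (intro arg_cong[where f="image f"]) auto
    then show ?case using trans by (simp only: bounded_Un)
  next
    case (local x)
    have "(f \<longlongrightarrow> f x) (at_right x)" using f local by (simp add: cadlag_def)
    from tendstoD[OF this, of 1] obtain d1 where d1: "d1 > 0" "\<And>y. x < y \<Longrightarrow> y < x + d1 \<Longrightarrow> dist (f y) (f x) < 1"
      by (auto simp: eventually_at_right_field) (metis add.commute diff_add_cancel diff_gt_0_iff_gt)
    \<comment> \<open>At 0 there are no earlier times to control, so any \<open>l\<close> will do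
      there.\<close>
    have "\<exists>l d2. d2 > 0 \<and> (\<forall>y. 0 \<le> y \<and> x - d2 < y \<and> y < x \<longrightarrow> dist (f y) l < 1)"
    proof (cases "x = 0")
      case True then show ?thesis by (intro exI[of _ 0] exI[of _ 1]) auto
    next
      case False
      then have "0 < x" using local by simp
      then obtain l where "(f \<longlongrightarrow> l) (at_left x)" using f unfolding cadlag_def by blast
      from tendstoD[OF this, of 1] obtain b where "b < x" "\<And>y. b < y \<Longrightarrow> y < x \<Longrightarrow> dist (f y) l < 1"
        by (auto simp: eventually_at_left_field)
      then show ?thesis by (intro exI[of _ l] exI[of _ "x - b"]) auto
    qed
    then obtain l d2 where d2: "d2 > 0" "\<And>y. 0 \<le> y \<Longrightarrow> x - d2 < y \<Longrightarrow> y < x \<Longrightarrow> dist (f y) l < 1"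
      by blast
    show ?case
    proof (intro exI[of _ "min d1 d2"] conjI allI impI)
      fix a b assume ab: "a \<le> x \<and> x \<le> b \<and> b - a < min d1 d2"
      have "f ` ({a..b} \<inter> Z) \<subseteq> ball (f x) 1 \<union> ball l 1"
      proof safe
        fix y assume y: "y \<in> {a..b}" "y \<in> Z" "f y \<notin> ball l 1"
        then show "f y \<in> ball (f x) 1"
          using d1(2)[of y] d2(2)[of y] ab by (cases y x rule: linorder_cases) (auto simp: dist_commute Z_def)
      qed
      then show "bounded (f ` ({a..b} \<inter> Z))"
        by (rule bounded_subset[rotated]) (simp add: bounded_Un)
    qed (use d1 d2 in auto)
  qed
  moreover have "{0..t} \<inter> Z = {0..t}" by (auto simp: Z_def)
  ultimately show ?thesis by simp
qed auto

lemma cadlag_left_limit: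
  assumes "cadlag f" "t > 0"
  shows "(f \<longlongrightarrow> left_limit f t) (at_left t)"
proof -
  obtain l where l: "(f \<longlongrightarrow> l) (at_left t)" using assms by (auto simp: cadlag_def)
  then have "left_limit f t = l" unfolding left_limit_def by (intro tendsto_Lim) auto
  with l show ?thesis by simp
qed

text \<open>Each point has a gap on its right; a rational chosen in the gap determines the point,
  because a larger point of \<open>S\<close> lies beyond that rational.\<close>

lemma countable_right_isolated:
  fixes S :: "real set"
  assumes "\<And>s. s \<in> S \<Longrightarrow> \<exists>q>s. {s<..<q} \<inter> S = {}"
  shows "countable S"
proof -
  have "\<exists>q. s < real_of_rat q \<and> {s<..<real_of_rat q} \<inter> S = {}" if s: "s \<in> S" for s
  proof -
    from assms[OF s] obtain q where q: "q > s" "{s<..<q} \<inter> S = {}" by blast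
    from of_rat_dense[OF q(1)] obtain r where "s < real_of_rat r" "real_of_rat r < q" by blast
    with q(2) have "{s<..<real_of_rat r} \<inter> S = {}" by fastforce
    with \<open>s < real_of_rat r\<close> show ?thesis by blast
  qed
  then obtain q where q: "\<And>s. s \<in> S \<Longrightarrow> s < real_of_rat (q s)" "\<And>s. s \<in> S \<Longrightarrow> {s<..<real_of_rat (q s)} \<inter> S = {}"
    by metis
  have "q s \<noteq> q s'" if "s \<in> S" "s' \<in> S" "s < s'" for s s'
    using q(2)[OF that(1)] q(1)[OF that(2)] that by (metis IntI empty_iff greaterThanLessThan_iff)
  then have "inj_on q S" by (intro inj_onI) (metis linorder_less_linear)
  then show ?thesis by (rule countableI')
qed

text \<open>Jumps above a fixed size are isolated from the right: just after \<open>s\<close> the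
  values, and therefore also the left limits, are close to \<open>f s\<close>. The union over the
  sizes \<open>1 / (n + 1)\<close> contains all jumps.\<close>

lemma cadlag_countable_jumps:
  assumes f: "cadlag f"
  shows "countable {s. 0 < s \<and> left_limit f s \<noteq> f s}"
proof -
  define S where "S n = {s. 0 < s \<and> dist (left_limit f s) (f s) > 1 / real (Suc n)}" for n
  have "countable (S n)" for n
  proof (rule countable_right_isolated)
    fix s assume s: "s \<in> S n"
    \<comment> \<open>Half the jump size: comparing both sides of a jump with \<open>f s\<close>
      costs \<open>d\<close> twice.\<close>
    define d where "d = 1 / (2 * real (Suc n))"
    have "(f \<longlongrightarrow> f s) (at_right s)" using f s by (simp add: cadlag_def S_def)
    from tendstoD[OF this, of d] obtain q where q: "s < q" "\<And>y. s < y \<Longrightarrow> y < q \<Longrightarrow> dist (f y) (f s) < d"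
      by (auto simp: eventually_at_right_field d_def)
    have "r \<notin> S n" if r: "s < r" "r < q" for r
    proof -
      have r0: "0 < r" using r s by (simp add: S_def)
      have "((\<lambda>y. dist (f y) (f s)) \<longlongrightarrow> dist (left_limit f r) (f s)) (at_left r)"
        by (intro tendsto_intros cadlag_left_limit f r0)
      moreover have "eventually (\<lambda>y. dist (f y) (f s) \<le> d) (at_left r)"
        unfolding eventually_at_left_field using q r
        by (intro exI[of _ s]) (auto intro: less_imp_le)
      ultimately have "dist (left_limit f r) (f s) \<le> d"
        by (intro tendsto_upperbound[of _ _ "at_left r"]) auto
      moreover have "dist (f r) (f s) < d" using q r by simp
      ultimately have "dist (left_limit f r) (f r) < 2 * d"
        using dist_triangle2[of "left_limit f r" "f r" "f s"] by linarith
      then show ?thesis by (simp add: S_def d_def field_simps)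
    qed
    then show "\<exists>q>s. {s<..<q} \<inter> S n = {}" using q(1) by (intro exI[of _ q]) auto
  qed
  moreover have "{s. 0 < s \<and> left_limit f s \<noteq> f s} \<subseteq> (\<Union>n. S n)"
  proof
    fix s assume s: "s \<in> {s. 0 < s \<and> left_limit f s \<noteq> f s}"
    then have "0 < dist (left_limit f s) (f s)" by simp
    then obtain n where "inverse (real (Suc n)) < dist (left_limit f s) (f s)"
      using reals_Archimedean by blast
    then show "s \<in> (\<Union>n. S n)" using s by (auto simp: S_def inverse_eq_divide)
  qed
  ultimately show ?thesis by (meson countable_UN countable_subset countableI_type)
qed

text \<open>Permits replacing the left limit in the noise integrand by the value of the
  path.\<close>

lemma cadlag_left_limit_AE:
  assumes "cadlag f"
  shows "AE s in lborel. 0 < s \<longrightarrow> left_limit f s = f s"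
  by (rule AE_I'[OF countable_imp_null_set_lborel[OF cadlag_countable_jumps[OF assms]]]) auto

text \<open>Time is approximated from the right by grid points. For a fixed grid only countably many
  times occur, so the approximating function is jointly measurable, and right continuity identifies
  the limit.\<close>

lemma right_continuous_joint_measurable:
  fixes g :: "real \<Rightarrow> 'a \<Rightarrow> 'b::{metric_space}"
  assumes [measurable]: "\<And>t. g t \<in> borel_measurable M"
    and cont: "\<And>\<omega> t. \<omega> \<in> space M \<Longrightarrow> ((\<lambda>s. g s \<omega>) \<longlongrightarrow> g t \<omega>) (at_right t)"
  shows "(\<lambda>(t, \<omega>). g t \<omega>) \<in> borel_measurable (borel \<Otimes>\<^sub>M M)"
proof -
  \<comment> \<open>Adding 1 after rounding down puts the grid point strictly to the right of
    \<open>t\<close>, even if \<open>t\<close> is itself on the grid; a limit along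
    \<open>at_right t\<close> needs this.\<close>
  define a where "a n t = (real_of_int \<lfloor>real (Suc n) * t\<rfloor> + 1) / real (Suc n)" for n t
  have a: "t < a n t" "a n t \<le> t + 1 / real (Suc n)" for n t
  proof -
    have "real (Suc n) * t < real_of_int \<lfloor>real (Suc n) * t\<rfloor> + 1" by linarith
    then show "t < a n t" by (simp add: a_def field_simps)
    have "real_of_int \<lfloor>real (Suc n) * t\<rfloor> \<le> real (Suc n) * t" by linarith
    then have "a n t \<le> (real (Suc n) * t + 1) / real (Suc n)"
      unfolding a_def by (intro divide_right_mono) auto
    also have "\<dots> = t + 1 / real (Suc n)" by (simp add: add_divide_distrib)
    finally show "a n t \<le> t + 1 / real (Suc n)" .
  qed
  have lim: "filterlim (\<lambda>n. a n t) (at_right t) sequentially" for t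
    unfolding filterlim_at
  proof
    have "(\<lambda>n. t + 1 / real (Suc n)) \<longlonglongrightarrow> t + 0"
      by (intro tendsto_add tendsto_const LIMSEQ_Suc[OF lim_1_over_n])
    then show "(\<lambda>n. a n t) \<longlonglongrightarrow> t"
      using a(1)[of t, THEN less_imp_le] a(2)[of _ t]
      by - (rule tendsto_sandwich[of "\<lambda>n. t" "\<lambda>n. a n t" _ "\<lambda>n. t + 1 / real (Suc n)"],
        simp_all del: of_nat_Suc)
    show "\<forall>\<^sub>F n in sequentially. a n t \<in> {t<..} \<and> a n t \<noteq> t"
      using a(1)[of t] by (intro always_eventually allI) (simp add: less_imp_neq[THEN not_sym])
  qed
  show ?thesis
  proof (rule borel_measurable_LIMSEQ_metric)
    fix n
    have "(\<lambda>x. g ((real_of_int \<lfloor>real (Suc n) * fst x\<rfloor> + 1) / real (Suc n)) (snd x)) \<in> borel_measurable (borel \<Otimes>\<^sub>M M)"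
      by (rule measurable_compose_countable[where f="\<lambda>i x. g ((real_of_int i + 1) / real (Suc n)) (snd x)"]) measurable
    then show "(\<lambda>(t, \<omega>). g (a n t) \<omega>) \<in> borel_measurable (borel \<Otimes>\<^sub>M M)"
      by (simp add: a_def split_beta')
  next
    fix z :: "real \<times> 'a" assume "z \<in> space (borel \<Otimes>\<^sub>M M)"
    then obtain t \<omega> where "z = (t, \<omega>)" "\<omega> \<in> space M" by (auto simp: space_pair_measure)
    then show "(\<lambda>n. case z of (t, \<omega>) \<Rightarrow> g (a n t) \<omega>) \<longlonglongrightarrow> (case z of (t, \<omega>) \<Rightarrow> g t \<omega>)"
      using filterlim_compose[OF cont lim] by simp
  qed
qed

section \<open>Integration against a square integrable Levy process\<close>

locale levy_driver =
  fixes M :: "'a measure" and F :: "real \<Rightarrow> 'a measure"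
    and L :: "real \<Rightarrow> 'a \<Rightarrow> real^'v" and K :: "real^'v^'v"
  assumes filtered: "filtered_prob_space M F"
    and levy: "centered_L2_levy_process M F L K"
begin

sublocale prob_space M
  using filtered by (simp add: filtered_prob_space_def)

lemma space_F: "space (F t) = space M"
  using filtered filtration.space_F by (auto simp: filtered_prob_space_def)

lemma measurable_F_mono: "X \<in> measurable (F s) N \<Longrightarrow> s \<le> t \<Longrightarrow> X \<in> measurable (F t) N"
  using filtered filtration.sets_F_mono[of "space M" F s t]
  by (auto simp: filtered_prob_space_def measurable_def space_F)

lemma measurable_F_M: "X \<in> measurable (F t) N \<Longrightarrow> 0 \<le> t \<Longrightarrow> X \<in> measurable M N"
  using filtered measurable_from_subalg[of M "F t" X N] by (auto simp: filtered_prob_space_def)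

lemma L_measurable_F: "0 \<le> t \<Longrightarrow> L t \<in> borel_measurable (F t)"
  using levy by (simp add: centered_L2_levy_process_def levy_process_def)

lemma L_measurable: "0 \<le> t \<Longrightarrow> L t \<in> borel_measurable M"
  using L_measurable_F measurable_F_M by blast

section \<open>Independence and second moments of the increments of the components\<close>

definition inc :: "'v \<Rightarrow> real \<Rightarrow> real \<Rightarrow> 'a \<Rightarrow> real" where
  "inc i s t \<omega> = L t \<omega> $ i - L s \<omega> $ i"

lemma inc_measurable_F: "0 \<le> s \<Longrightarrow> s \<le> t \<Longrightarrow> inc i s t \<in> borel_measurable (F t)"
  unfolding inc_def[abs_def]
  using L_measurable_F[of t] measurable_F_mono[OF L_measurable_F[of s], of t]
  by (intro borel_measurable_diff measurable_compose[OF _ borel_measurable_continuous_onI[of "\<lambda>v. v $ i"]])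
     (auto intro: continuous_intros)

lemma inc_measurable: "0 \<le> s \<Longrightarrow> s \<le> t \<Longrightarrow> inc i s t \<in> borel_measurable M"
  using inc_measurable_F measurable_F_M by (meson order_trans)

text \<open>Independence of two sigma algebras passes to the smaller ones generated by
  \<open>X\<close> and by the function of the increment. Allowing a function of the whole vector
  increment covers products of two components.\<close>

lemma increment_indep:
  assumes st: "0 \<le> s" "s \<le> t" and X: "X \<in> borel_measurable (F s)"
    and h[measurable]: "h \<in> borel_measurable borel"
  shows "indep_var borel X borel (\<lambda>\<omega>. h (L t \<omega> - L s \<omega>))"
proof -
  have [measurable]: "L t \<in> borel_measurable M" "L s \<in> borel_measurable M"
    using L_measurable st by auto
  have indep: "indep_set (sets (F s)) (sets (vimage_algebra (space M) (\<lambda>\<omega>. L t \<omega> - L s \<omega>) borel))"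
    using levy[unfolded centered_L2_levy_process_def levy_process_def, THEN conjunct1, THEN conjunct2,
        THEN conjunct2, THEN conjunct1] st by simp
  show ?thesis unfolding indep_var_eq
  proof (intro conjI)
    show "random_variable borel X" using X st measurable_F_M by blast
    show "random_variable borel (\<lambda>\<omega>. h (L t \<omega> - L s \<omega>))" by measurable
    have "sigma_sets (space M) {X -` A \<inter> space M |A. A \<in> sets borel} \<subseteq> sets (F s)"
    proof -
      have "{X -` A \<inter> space M |A. A \<in> sets borel} \<subseteq> sets (F s)"
        using measurable_sets[OF X] by (auto simp: space_F)
      then show ?thesis using sets.sigma_sets_subset[of _ "F s"] unfolding space_F by blast
    qed
    moreover have "sigma_sets (space M) {(\<lambda>\<omega>. h (L t \<omega> - L s \<omega>)) -` A \<inter> space M |A. A \<in> sets borel}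
        \<subseteq> sets (vimage_algebra (space M) (\<lambda>\<omega>. L t \<omega> - L s \<omega>) borel)" (is "_ \<subseteq> sets ?V")
    proof -
      have "(\<lambda>\<omega>. L t \<omega> - L s \<omega>) \<in> measurable ?V borel"
        by (intro measurable_vimage_algebra1) auto
      then have "(\<lambda>\<omega>. h (L t \<omega> - L s \<omega>)) \<in> measurable ?V borel"
        using h measurable_compose by blast
      from measurable_sets[OF this] have "{(\<lambda>\<omega>. h (L t \<omega> - L s \<omega>)) -` A \<inter> space M |A. A \<in> sets borel} \<subseteq> sets ?V"
        by auto
      then show ?thesis using sets.sigma_sets_subset[of _ ?V] by simp
    qed
    ultimately show "indep_set (sigma_sets (space M) {X -` A \<inter> space M |A. A \<in> sets borel})
        (sigma_sets (space M) {(\<lambda>\<omega>. h (L t \<omega> - L s \<omega>)) -` A \<inter> space M |A. A \<in> sets borel})"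
      using indep unfolding indep_sets2_eq by blast
  qed
qed

lemma increment_distr:
  fixes h :: "real^'v \<Rightarrow> real"
  assumes st: "0 \<le> s" "s \<le> t" and [measurable]: "h \<in> borel_measurable borel"
  shows "integrable M (\<lambda>\<omega>. h (L t \<omega> - L s \<omega>)) \<longleftrightarrow> integrable M (\<lambda>\<omega>. h (L (t - s) \<omega>))"
    and "expectation (\<lambda>\<omega>. h (L t \<omega> - L s \<omega>)) = expectation (\<lambda>\<omega>. h (L (t - s) \<omega>))"
proof -
  have [measurable]: "L t \<in> borel_measurable M" "L s \<in> borel_measurable M" "L (t - s) \<in> borel_measurable M"
    using L_measurable st by auto
  have eq: "distr M borel (\<lambda>\<omega>. L t \<omega> - L s \<omega>) = distr M borel (L (t - s))"
    using levy[unfolded centered_L2_levy_process_def levy_process_def, THEN conjunct1, THEN conjunct2,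
        THEN conjunct2, THEN conjunct2, THEN conjunct1, rule_format, of s "t - s"] st by simp
  show "integrable M (\<lambda>\<omega>. h (L t \<omega> - L s \<omega>)) \<longleftrightarrow> integrable M (\<lambda>\<omega>. h (L (t - s) \<omega>))"
    using integrable_distr_eq[of "\<lambda>\<omega>. L t \<omega> - L s \<omega>" M borel h] integrable_distr_eq[of "L (t - s)" M borel h] eq
    by simp
  show "expectation (\<lambda>\<omega>. h (L t \<omega> - L s \<omega>)) = expectation (\<lambda>\<omega>. h (L (t - s) \<omega>))"
    using integral_distr[of "\<lambda>\<omega>. L t \<omega> - L s \<omega>" M borel h] integral_distr[of "L (t - s)" M borel h] eq
    by simp
qed

lemma L_L2: "0 \<le> t \<Longrightarrow> L2 M (L t)"
  using levy L_measurable by (simp add: L2_def centered_L2_levy_process_def)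

lemma inc_L2:
  assumes "0 \<le> s" "s \<le> t" shows "L2 M (inc i s t)"
  unfolding inc_def[abs_def] using assms
  by (intro L2_diff L2_linear[OF L_L2 bounded_linear_vec_nth]) auto

lemma inc_integrable: "0 \<le> s \<Longrightarrow> s \<le> t \<Longrightarrow> integrable M (inc i s t)"
  using L2_imp_integrable[OF _ inc_L2] finite_measure_axioms by blast

lemma inc_mult_integrable: "0 \<le> s \<Longrightarrow> s \<le> t \<Longrightarrow> 0 \<le> s' \<Longrightarrow> s' \<le> t' \<Longrightarrow> integrable M (\<lambda>\<omega>. inc i s t \<omega> * inc j s' t' \<omega>)"
  using L2_inner_integrable[OF inc_L2[of s t i] inc_L2[of s' t' j]] by (simp add: mult.commute)

lemma inc_expectation:
  assumes "0 \<le> s" "s \<le> t" shows "expectation (inc i s t) = 0"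
proof -
  have "expectation (inc i s t) = expectation (\<lambda>\<omega>. (L t \<omega> - L s \<omega>) $ i)"
    by (simp add: inc_def[abs_def])
  also have "\<dots> = expectation (\<lambda>\<omega>. L (t - s) \<omega> $ i)"
    using increment_distr(2)[OF assms, of "\<lambda>x. x $ i"] by simp
  also have "\<dots> = expectation (L (t - s)) $ i"
    using assms by (intro integral_bounded_linear[OF bounded_linear_vec_nth]
      L2_imp_integrable finite_measure_axioms L_L2) simp
  also have "\<dots> = 0"
    using levy assms by (simp add: centered_L2_levy_process_def)
  finally show ?thesis .
qed

lemma inc_covariance:
  assumes "0 \<le> s" "s \<le> t" shows "expectation (\<lambda>\<omega>. inc i s t \<omega> * inc j s t \<omega>) = K $ i $ j * (t - s)"
proof -
  have "expectation (\<lambda>\<omega>. inc i s t \<omega> * inc j s t \<omega>) = expectation (\<lambda>\<omega>. (L t \<omega> - L s \<omega>) $ i * (L t \<omega> - L s \<omega>) $ j)"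
    by (simp add: inc_def[abs_def])
  also have "\<dots> = expectation (\<lambda>\<omega>. L (t - s) \<omega> $ i * L (t - s) \<omega> $ j)"
    using increment_distr(2)[OF assms, of "\<lambda>x. x $ i * x $ j"] by simp
  also have "\<dots> = K $ i $ j * (t - s)"
    using levy assms by (simp add: centered_L2_levy_process_def)
  finally show ?thesis .
qed

text \<open>Both entries equal the expectation of the same product of components at time 1.\<close>

lemma K_sym: "K $ i $ j = K $ j $ i"
  using inc_covariance[of 0 1 i j] inc_covariance[of 0 1 j i] by (simp add: mult.commute)

lemma K_diag_nonneg: "0 \<le> K $ i $ i"
proof -
  have "0 \<le> expectation (\<lambda>\<omega>. inc i 0 1 \<omega> * inc i 0 1 \<omega>)" by simp
  then show ?thesis by (subst (asm) inc_covariance) auto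
qed

lemma expectation_mult_inc:
  assumes "0 \<le> s" "s \<le> t" "X \<in> borel_measurable (F s)" "integrable M X"
  shows "integrable M (\<lambda>\<omega>. X \<omega> * inc i s t \<omega>)" "expectation (\<lambda>\<omega>. X \<omega> * inc i s t \<omega>) = 0"
proof -
  have "indep_var borel X borel (\<lambda>\<omega>. (L t \<omega> - L s \<omega>) $ i)"
    by (intro increment_indep assms) auto
  then have "indep_var borel X borel (inc i s t)" by (simp add: inc_def[abs_def])
  from indep_var_integrable[OF this] indep_var_lebesgue_integral[OF this]
  show "integrable M (\<lambda>\<omega>. X \<omega> * inc i s t \<omega>)" "expectation (\<lambda>\<omega>. X \<omega> * inc i s t \<omega>) = 0"
    using assms inc_integrable inc_expectation by auto
qed

lemma expectation_mult_inc_inc: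
  assumes "0 \<le> s" "s \<le> t" "X \<in> borel_measurable (F s)" "integrable M X"
  shows "integrable M (\<lambda>\<omega>. X \<omega> * (inc i s t \<omega> * inc j s t \<omega>))"
    "expectation (\<lambda>\<omega>. X \<omega> * (inc i s t \<omega> * inc j s t \<omega>)) = expectation X * (K $ i $ j * (t - s))"
proof -
  have "indep_var borel X borel (\<lambda>\<omega>. (L t \<omega> - L s \<omega>) $ i * (L t \<omega> - L s \<omega>) $ j)"
    by (rule increment_indep[OF assms(1-3), of "\<lambda>x. x $ i * x $ j"]) auto
  then have *: "indep_var borel X borel (\<lambda>\<omega>. inc i s t \<omega> * inc j s t \<omega>)" by (simp add: inc_def[abs_def])
  show "integrable M (\<lambda>\<omega>. X \<omega> * (inc i s t \<omega> * inc j s t \<omega>))"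
    "expectation (\<lambda>\<omega>. X \<omega> * (inc i s t \<omega> * inc j s t \<omega>)) = expectation X * (K $ i $ j * (t - s))"
    using indep_var_integrable[OF *] indep_var_lebesgue_integral[OF *] assms inc_mult_integrable inc_covariance
    by auto
qed

lemma bounded_mult_inc_integrable:
  assumes "0 \<le> s" "s \<le> t" "w \<in> borel_measurable M" "\<And>\<omega>. \<omega> \<in> space M \<Longrightarrow> \<bar>w \<omega>\<bar> \<le> C"
  shows "integrable M (\<lambda>\<omega>. w \<omega> * inc i s t \<omega>)"
  using L2_inner_integrable[OF L2_bounded[OF finite_measure_axioms assms(3), of C] inc_L2[OF assms(1,2), of i]] assms(4)
  by simp

text \<open>The longer increment is cut where the shorter one ends. The remainder is independent of
  everything before and has mean zero, so only the common part contributes.\<close>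

lemma expectation_inc_same_start:
  assumes s: "0 \<le> s" "s \<le> t" "s \<le> t'" and w: "w \<in> borel_measurable (F s)"
    and bd: "\<And>\<omega>. \<omega> \<in> space M \<Longrightarrow> \<bar>w \<omega>\<bar> \<le> C"
  shows "integrable M (\<lambda>\<omega>. w \<omega> * (inc i s t \<omega> * inc j s t' \<omega>)) \<and>
    expectation (\<lambda>\<omega>. w \<omega> * (inc i s t \<omega> * inc j s t' \<omega>)) = expectation w * (K $ i $ j * (min t t' - s))"
proof -
  have wM: "w \<in> borel_measurable M" using measurable_F_M w s by blast
  have iw: "integrable M w" using bd wM by (intro integrable_const_bound[where B=C] AE_I2) auto
  have *: "integrable M (\<lambda>\<omega>. w \<omega> * (inc i s t \<omega> * inc j s t' \<omega>)) \<and>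
    expectation (\<lambda>\<omega>. w \<omega> * (inc i s t \<omega> * inc j s t' \<omega>)) = expectation w * (K $ i $ j * (t - s))"
    if tt: "s \<le> t" "t \<le> t'" for i j t t'
  proof -
    have eq: "w \<omega> * (inc i s t \<omega> * inc j s t' \<omega>) =
       w \<omega> * (inc i s t \<omega> * inc j s t \<omega>) + (w \<omega> * inc i s t \<omega>) * inc j t t' \<omega>" for \<omega>
      by (simp add: inc_def algebra_simps)
    have "(\<lambda>\<omega>. w \<omega> * inc i s t \<omega>) \<in> borel_measurable (F t)"
      using measurable_F_mono[OF w] inc_measurable_F[of s t] tt s by (intro borel_measurable_times) auto
    moreover have "integrable M (\<lambda>\<omega>. w \<omega> * inc i s t \<omega>)"
      using bounded_mult_inc_integrable[OF _ _ wM bd] tt s by simp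
    ultimately have "integrable M (\<lambda>\<omega>. (w \<omega> * inc i s t \<omega>) * inc j t t' \<omega>)"
        "expectation (\<lambda>\<omega>. (w \<omega> * inc i s t \<omega>) * inc j t t' \<omega>) = 0"
      using expectation_mult_inc[of t t' "\<lambda>\<omega>. w \<omega> * inc i s t \<omega>" j] tt s by auto
    then show ?thesis
      unfolding eq using expectation_mult_inc_inc[OF s(1) tt(1) w iw, of i j] by simp
  qed
  show ?thesis
  proof (cases "t \<le> t'")
    case True
    then show ?thesis using *[of t t' i j] s by simp
  next
    case False
    then show ?thesis using *[of t' t j i] s K_sym[of i j] by (simp add: mult.commute[of "inc i s t _"])
  qed
qed

text \<open>The part of the first increment before \<open>c\<close> is known at time
  \<open>c\<close>, hence orthogonal to the second increment, also after weighting by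
  \<open>w\<close>. What remains has the common start \<open>c\<close>, and the length of the
  overlap appears.\<close>

lemma expectation_inc_le:
  assumes s: "0 \<le> a" "a \<le> b" "a \<le> c" "c \<le> d" and w: "w \<in> borel_measurable (F c)"
    and bd: "\<And>\<omega>. \<omega> \<in> space M \<Longrightarrow> \<bar>w \<omega>\<bar> \<le> C"
  shows "integrable M (\<lambda>\<omega>. w \<omega> * (inc i a b \<omega> * inc j c d \<omega>)) \<and>
    expectation (\<lambda>\<omega>. w \<omega> * (inc i a b \<omega> * inc j c d \<omega>)) = expectation w * (K $ i $ j * max 0 (min b d - c))"
proof -
  have c0: "0 \<le> c" using s by simp
  have wM: "w \<in> borel_measurable M" using measurable_F_M w c0 by blast
  have *: "integrable M (\<lambda>\<omega>. (w \<omega> * inc i a b' \<omega>) * inc j c d \<omega>)"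
     "expectation (\<lambda>\<omega>. (w \<omega> * inc i a b' \<omega>) * inc j c d \<omega>) = 0" if "a \<le> b'" "b' \<le> c" for b'
  proof -
    have "(\<lambda>\<omega>. w \<omega> * inc i a b' \<omega>) \<in> borel_measurable (F c)"
      using w measurable_F_mono[OF inc_measurable_F[of a b']] that s by (intro borel_measurable_times) auto
    moreover have "integrable M (\<lambda>\<omega>. w \<omega> * inc i a b' \<omega>)"
      using bounded_mult_inc_integrable[OF _ _ wM bd] that s by simp
    ultimately show "integrable M (\<lambda>\<omega>. (w \<omega> * inc i a b' \<omega>) * inc j c d \<omega>)"
     "expectation (\<lambda>\<omega>. (w \<omega> * inc i a b' \<omega>) * inc j c d \<omega>) = 0"
      using expectation_mult_inc[of c d "\<lambda>\<omega>. w \<omega> * inc i a b' \<omega>" j] s by auto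
  qed
  show ?thesis
  proof (cases "b \<le> c")
    case True
    then show ?thesis using *[of b] s by (simp add: mult.assoc)
  next
    case False
    have eq: "w \<omega> * (inc i a b \<omega> * inc j c d \<omega>) =
       w \<omega> * (inc i c b \<omega> * inc j c d \<omega>) + (w \<omega> * inc i a c \<omega>) * inc j c d \<omega>" for \<omega>
      by (simp add: inc_def algebra_simps)
    have "integrable M (\<lambda>\<omega>. w \<omega> * (inc i c b \<omega> * inc j c d \<omega>)) \<and>
      expectation (\<lambda>\<omega>. w \<omega> * (inc i c b \<omega> * inc j c d \<omega>)) = expectation w * (K $ i $ j * (min b d - c))"
      using expectation_inc_same_start[OF c0 _ s(4) w bd] False by simp
    then show ?thesis unfolding eq using *[of c] s False by simp
  qed
qed

lemma expectation_inc_inc: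
  assumes s: "0 \<le> a" "a \<le> b" "0 \<le> c" "c \<le> d" and w: "w \<in> borel_measurable (F (max a c))"
    and bd: "\<And>\<omega>. \<omega> \<in> space M \<Longrightarrow> \<bar>w \<omega>\<bar> \<le> C"
  shows "expectation (\<lambda>\<omega>. w \<omega> * (inc i a b \<omega> * inc j c d \<omega>)) =
    expectation w * (K $ i $ j * max 0 (min b d - max a c))"
proof (cases "a \<le> c")
  case True
  then show ?thesis using expectation_inc_le[OF s(1,2) True s(4) _ bd, where i=i and j=j] w by (simp add: max_def)
next
  case False
  then show ?thesis
    using expectation_inc_le[OF s(3,4) _ s(2) _ bd, where i=j and j=i] w K_sym[of i j]
    by (simp add: max_def mult.commute[of "inc j c d _"] min.commute)
qed


subsection \<open>Simple integrands\<close>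

definition sint :: "'v \<Rightarrow> real \<Rightarrow> ('a, 'b::euclidean_space) simple_proc \<Rightarrow> 'a \<Rightarrow> 'b" where
  "sint i t \<zeta> = simple_integral_upto (\<lambda>s \<omega>. L s \<omega> $ i) \<zeta> t"

text \<open>The sample point comes first in the pair, to match the order of factors in
  \<open>prod_upto\<close>.\<close>

definition sval :: "('a, 'b::euclidean_space) simple_proc \<Rightarrow> 'a \<times> real \<Rightarrow> 'b" where
  "sval \<zeta> z = simple_value \<zeta> (snd z) (fst z)"

lemma sint_Nil: "sint i t [] = (\<lambda>\<omega>. 0)"
  and sint_Cons: "sint i t (e # \<zeta>) = (\<lambda>\<omega>. sint i t [e] \<omega> + sint i t \<zeta> \<omega>)"
  and sint_single: "sint i t [(a, b, \<xi>)] \<omega> = inc i (min a t) (min b t) \<omega> *\<^sub>R \<xi> \<omega>"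
  by (auto simp: sint_def simple_integral_upto_def inc_def fun_eq_iff)

lemma sval_Nil: "sval [] = (\<lambda>z. 0)"
  and sval_Cons: "sval (e # \<zeta>) = (\<lambda>z. sval [e] z + sval \<zeta> z)"
  and sval_single: "sval [(a, b, \<xi>)] z = indicator {a<..b} (snd z) *\<^sub>R \<xi> (fst z)"
  by (auto simp: sval_def simple_value_def fun_eq_iff)

lemma simple_predictable_ConsD:
  assumes "simple_predictable F (e # \<zeta>)"
  shows "simple_predictable F [e]" "simple_predictable F \<zeta>"
  using assms by (auto simp: simple_predictable_def)

lemma simple_predictable_singleE:
  assumes "simple_predictable F [(a, b, \<xi>)]"
  obtains C where "0 \<le> a" "a \<le> b" "\<xi> \<in> borel_measurable (F a)" "\<xi> \<in> borel_measurable M"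
    "\<And>\<omega>. \<omega> \<in> space M \<Longrightarrow> norm (\<xi> \<omega>) \<le> C"
proof -
  have *: "0 \<le> a" "a \<le> b" "\<xi> \<in> borel_measurable (F a)" "bounded (\<xi> ` space M)"
    using assms by (auto simp: simple_predictable_def space_F)
  then obtain C where "\<forall>x\<in>\<xi> ` space M. norm x \<le> C" unfolding bounded_iff by blast
  then show ?thesis using * measurable_F_M[OF *(3,1)] by (intro that[of C]) auto
qed

lemma sint_L2:
  assumes "simple_predictable F \<zeta>" "0 \<le> t"
  shows "L2 M (sint i t \<zeta>)"
  using assms(1)
proof (induction \<zeta>)
  case (Cons e \<zeta>)
  obtain a b \<xi> where e: "e = (a, b, \<xi>)" by (cases e)
  obtain C where C: "0 \<le> a" "a \<le> b" "\<xi> \<in> borel_measurable (F a)" "\<xi> \<in> borel_measurable M"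
    "\<And>\<omega>. \<omega> \<in> space M \<Longrightarrow> norm (\<xi> \<omega>) \<le> C"
    using simple_predictable_ConsD(1)[OF Cons.prems] simple_predictable_singleE unfolding e by metis
  define p q where "p = min a t" and "q = min b t"
  have pq: "0 \<le> p" "p \<le> q" using C assms(2) by (auto simp: p_def q_def)
  have [measurable]: "inc i p q \<in> borel_measurable M" "\<xi> \<in> borel_measurable M"
    using inc_measurable[OF pq] C by auto
  have "integrable M (\<lambda>\<omega>. C\<^sup>2 * (norm (inc i p q \<omega>))\<^sup>2)"
    using inc_L2[OF pq, of i] by (auto simp: L2_def)
  then have "integrable M (\<lambda>\<omega>. (norm (inc i p q \<omega> *\<^sub>R \<xi> \<omega>))\<^sup>2)"
  proof (rule Bochner_Integration.integrable_bound)
    show "AE \<omega> in M. norm ((norm (inc i p q \<omega> *\<^sub>R \<xi> \<omega>))\<^sup>2) \<le> norm (C\<^sup>2 * (norm (inc i p q \<omega>))\<^sup>2)"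
    proof (rule AE_I2)
      fix \<omega> assume "\<omega> \<in> space M"
      then have "(norm (\<xi> \<omega>))\<^sup>2 \<le> C\<^sup>2" using C by (intro power_mono) auto
      then show "norm ((norm (inc i p q \<omega> *\<^sub>R \<xi> \<omega>))\<^sup>2) \<le> norm (C\<^sup>2 * (norm (inc i p q \<omega>))\<^sup>2)"
        by (simp add: power_mult_distrib abs_mult mult.commute[of "C\<^sup>2"] mult_left_mono)
    qed
  qed simp
  then have "L2 M (\<lambda>\<omega>. inc i p q \<omega> *\<^sub>R \<xi> \<omega>)" by (simp add: L2_def)
  then have "L2 M (sint i t [e])" by (simp add: e sint_single[abs_def] p_def q_def)
  then show ?case
    using Cons.IH simple_predictable_ConsD[OF Cons.prems] by (subst sint_Cons) (auto intro!: L2_add)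
qed (simp add: sint_Nil L2_zero)

abbreviation prod_upto :: "real \<Rightarrow> ('a \<times> real) measure" where "prod_upto t \<equiv> M \<Otimes>\<^sub>M lborel_upto t"

lemma finite_measure_prod_upto: "finite_measure (prod_upto t)"
  by (intro finite_measure_pair_measure finite_measure_axioms finite_measure_upto)

lemma sval_L2:
  assumes "simple_predictable F \<zeta>"
  shows "L2 (prod_upto t) (sval \<zeta>)"
  using assms(1)
proof (induction \<zeta>)
  case (Cons e \<zeta>)
  obtain a b \<xi> where e: "e = (a, b, \<xi>)" by (cases e)
  obtain C where C: "0 \<le> a" "a \<le> b" "\<xi> \<in> borel_measurable (F a)" "\<xi> \<in> borel_measurable M"
    "\<And>\<omega>. \<omega> \<in> space M \<Longrightarrow> norm (\<xi> \<omega>) \<le> C"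
    using simple_predictable_ConsD(1)[OF Cons.prems] simple_predictable_singleE unfolding e by metis
  note [measurable] = C(4)
  have "L2 (prod_upto t) (\<lambda>z. indicator {a<..b} (snd z) *\<^sub>R \<xi> (fst z))"
  proof (rule L2_bounded[OF finite_measure_prod_upto])
    show "norm (indicator {a<..b} (snd z) *\<^sub>R \<xi> (fst z)) \<le> C" if "z \<in> space (prod_upto t)" for z
      using C(5)[of "fst z"] order_trans[OF norm_ge_zero C(5)[of "fst z"]] that
      by (auto simp: space_pair_measure indicator_def)
  qed measurable
  then have "L2 (prod_upto t) (sval [e])" by (simp add: e sval_single[abs_def])
  then show ?case
    using Cons.IH simple_predictable_ConsD[OF Cons.prems] by (subst sval_Cons) (auto intro!: L2_add)
qed (simp add: sval_Nil L2_zero)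

text \<open>Both intervals start at nonnegative times, so the cutoff to \<open>{0<..t}\<close> only
  shortens the right end. This mirrors the truncation by \<open>min\<close> in the simple
  integral.\<close>

lemma measure_upto_Int:
  assumes "0 \<le> a" "0 \<le> c" "0 \<le> t"
  shows "(LINT s|lborel_upto t. indicator {a<..b} s * indicator {c<..d} s)
    = max 0 (min (min b d) t - max a c)"
proof -
  have "(LINT s|lborel_upto t. indicator {a<..b} s * indicator {c<..d} s :: real)
     = (LINT s|lborel. indicator {max a c<..min (min b d) t} s)"
  proof (subst integral_upto)
    have "indicator {0<..t} s *\<^sub>R (indicator {a<..b} s * indicator {c<..d} s :: real)
      = indicator {max a c<..min (min b d) t} s" for s
      using assms by (auto simp: indicator_def)
    then show "(LINT s|lborel. indicator {0<..t} s *\<^sub>R (indicator {a<..b} s * indicator {c<..d} s :: real))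
      = (LINT s|lborel. indicator {max a c<..min (min b d) t} s)"
      by presburger
  qed simp
  also have "\<dots> = max 0 (min (min b d) t - max a c)"
    by (cases "max a c \<le> min (min b d) t") auto
  finally show ?thesis .
qed

text \<open>Both sides are the expectation of \<open>w\<close> times the covariance entry times the
  length of the overlap of the two intervals before \<open>t\<close>. The operator \<open>h\<close>
  and the two indices are there because the energy needs a quadratic form of a sum over
  components.\<close>

lemma simple_isometry_single:
  fixes \<xi> \<eta> :: "'a \<Rightarrow> 'b::euclidean_space"
  assumes "simple_predictable F [(a, b, \<xi>)]" "simple_predictable F [(c, d, \<eta>)]"
    and t: "0 \<le> t" and h: "bounded_linear h"
  shows "expectation (\<lambda>\<omega>. sint i t [(a, b, \<xi>)] \<omega> \<bullet> h (sint j t [(c, d, \<eta>)] \<omega>))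
    = K $ i $ j * (LINT z|prod_upto t. sval [(a, b, \<xi>)] z \<bullet> h (sval [(c, d, \<eta>)] z))"
proof -
  interpret h: bounded_linear h by fact
  interpret lborel_upto: finite_measure "lborel_upto t" by simp
  interpret P: pair_sigma_finite M "lborel_upto t" ..
  obtain C where C: "0 \<le> a" "a \<le> b" "\<xi> \<in> borel_measurable (F a)" "\<xi> \<in> borel_measurable M"
    "\<And>\<omega>. \<omega> \<in> space M \<Longrightarrow> norm (\<xi> \<omega>) \<le> C"
    using simple_predictable_singleE[OF assms(1)] by metis
  obtain E where E: "0 \<le> c" "c \<le> d" "\<eta> \<in> borel_measurable (F c)" "\<eta> \<in> borel_measurable M"
    "\<And>\<omega>. \<omega> \<in> space M \<Longrightarrow> norm (\<eta> \<omega>) \<le> E"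
    using simple_predictable_singleE[OF assms(2)] by metis
  have hm[measurable]: "h \<in> borel_measurable borel"
    by (intro borel_measurable_continuous_onI linear_continuous_on h)
  define w where "w \<omega> = \<xi> \<omega> \<bullet> h (\<eta> \<omega>)" for \<omega>
  have wF: "w \<in> borel_measurable (F (max a c))"
    unfolding w_def[abs_def]
    by (intro borel_measurable_inner measurable_compose[OF _ hm] measurable_F_mono[OF C(3)] measurable_F_mono[OF E(3)]) auto
  obtain k where k: "\<And>x. norm (h x) \<le> norm x * k" "0 \<le> k" using h.nonneg_bounded by blast
  have wB: "\<bar>w \<omega>\<bar> \<le> C * (E * k)" if "\<omega> \<in> space M" for \<omega>
  proof -
    have "\<bar>w \<omega>\<bar> \<le> norm (\<xi> \<omega>) * norm (h (\<eta> \<omega>))" unfolding w_def by (rule Cauchy_Schwarz_ineq2)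
    also have "\<dots> \<le> C * (E * k)"
      using C(5)[OF that] E(5)[OF that] k(1)[of "\<eta> \<omega>"] k(2) order_trans[OF norm_ge_zero C(5)[OF that]]
      by (intro mult_mono) (auto intro: order_trans[OF _ mult_right_mono])
    finally show ?thesis .
  qed
  let ?l = "max 0 (min (min b d) t - max a c)"
  have "expectation (\<lambda>\<omega>. sint i t [(a, b, \<xi>)] \<omega> \<bullet> h (sint j t [(c, d, \<eta>)] \<omega>))
    = expectation (\<lambda>\<omega>. w \<omega> * (inc i (min a t) (min b t) \<omega> * inc j (min c t) (min d t) \<omega>))"
    by (intro Bochner_Integration.integral_cong) (auto simp: sint_single h.scaleR w_def)
  also have "\<dots> = expectation w * (K $ i $ j * ?l)"
  \<comment> \<open>If one of the intervals starts after \<open>t\<close>, then \<open>w\<close>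
    need not be known at the truncated starting times, but the corresponding increment
    vanishes.\<close>
  proof (cases "max a c \<le> t")
    case True
    then show ?thesis
      using expectation_inc_inc[OF C(1) _ E(1) _ wF wB, where b="min b t" and d="min d t" and i=i and j=j] C E
      by (simp add: min.commute min.left_commute min.assoc)
  next
    case False
    then have "inc i (min a t) (min b t) \<omega> * inc j (min c t) (min d t) \<omega> = 0" for \<omega>
      using C E by (auto simp: inc_def min_def)
    then have "(\<lambda>\<omega>. w \<omega> * (inc i (min a t) (min b t) \<omega> * inc j (min c t) (min d t) \<omega>)) = (\<lambda>\<omega>. 0)"
      by (auto simp: fun_eq_iff)
    moreover have "?l = 0" using False by (auto simp: max_def min_def)
    ultimately show ?thesis by (simp only:) simp
  qed
  also have "\<dots> = K $ i $ j * (LINT \<omega>|M. LINT s|lborel_upto t. w \<omega> * (indicator {a<..b} s * indicator {c<..d} s))"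
    using measure_upto_Int[OF C(1) E(1) t] by simp
  also have "(LINT \<omega>|M. LINT s|lborel_upto t. w \<omega> * (indicator {a<..b} s * indicator {c<..d} s)) =
      (LINT \<omega>|M. LINT s|lborel_upto t. sval [(a, b, \<xi>)] (\<omega>, s) \<bullet> h (sval [(c, d, \<eta>)] (\<omega>, s)))"
    by (intro Bochner_Integration.integral_cong) (auto simp: sval_single h.scaleR w_def)
  also have "\<dots> = (LINT z|prod_upto t. sval [(a, b, \<xi>)] z \<bullet> h (sval [(c, d, \<eta>)] z))"
    by (rule P.integral_fst'[OF L2_inner_integrable[OF sval_L2 L2_linear[OF sval_L2 h]], OF assms(1,2)])
  finally show ?thesis .
qed

text \<open>Both sides are additive in each list. As the single case admits arbitrary overlaps, no
  common refinement of the intervals is required.\<close>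

lemma simple_isometry:
  fixes \<zeta> \<eta> :: "('a, 'b::euclidean_space) simple_proc"
  assumes z: "simple_predictable F \<zeta>" "simple_predictable F \<eta>"
    and t: "0 \<le> t" and h: "bounded_linear h"
  shows "expectation (\<lambda>\<omega>. sint i t \<zeta> \<omega> \<bullet> h (sint j t \<eta> \<omega>))
    = K $ i $ j * (LINT z|prod_upto t. sval \<zeta> z \<bullet> h (sval \<eta> z))"
proof -
  interpret h: bounded_linear h by fact
  note L = L2_inner_integrable[OF sint_L2 L2_linear[OF sint_L2 h]] L2_inner_integrable[OF sval_L2 L2_linear[OF sval_L2 h]]
  have single: "expectation (\<lambda>\<omega>. sint i t [e] \<omega> \<bullet> h (sint j t \<eta> \<omega>))
    = K $ i $ j * (LINT z|prod_upto t. sval [e] z \<bullet> h (sval \<eta> z))" if e: "simple_predictable F [e]" for e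
    using z(2)
  proof (induction \<eta>)
    case (Cons f \<eta>)
    then have p: "simple_predictable F [f]" "simple_predictable F \<eta>"
      using simple_predictable_ConsD by blast+
    have eq: "expectation (\<lambda>\<omega>. sint i t [e] \<omega> \<bullet> h (sint j t [f] \<omega>))
      = K $ i $ j * (LINT z|prod_upto t. sval [e] z \<bullet> h (sval [f] z))"
      by (cases e, cases f) (use simple_isometry_single[OF _ _ t h] e p in auto)
    show ?case
      unfolding sint_Cons[of _ _ f \<eta>] sval_Cons[of f \<eta>] h.add inner_add_right
      using Cons.IH[OF p(2)] eq L(1)[OF e t p(1) t] L(1)[OF e t p(2) t] L(2)[OF e p(1)] L(2)[OF e p(2)]
      by (simp add: distrib_left)
  qed (simp add: sint_Nil sval_Nil h.zero)
  show ?thesis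
    using z(1)
  proof (induction \<zeta>)
    case (Cons f \<zeta>)
    then have p: "simple_predictable F [f]" "simple_predictable F \<zeta>"
      using simple_predictable_ConsD by blast+
    show ?case
      unfolding sint_Cons[of _ _ f \<zeta>] sval_Cons[of f \<zeta>] inner_add_left
      using Cons.IH[OF p(2)] single[OF p(1)] L(1)[OF p(1) t z(2) t] L(1)[OF p(2) t z(2) t] L(2)[OF p(1) z(2)] L(2)[OF p(2) z(2)]
      by (simp add: distrib_left)
  qed (simp add: sint_Nil sval_Nil)
qed

text \<open>For one summand, the integrals up to \<open>t\<close> and up to \<open>s\<close> differ
  by \<open>\<xi>\<close> times the increment over the part of the interval in
  \<open>{s<..t}\<close>. At its start the weight \<open>G\<close> times \<open>\<xi>\<close> is
  already known, and the increment has mean zero.\<close>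

lemma simple_martingale:
  fixes \<zeta> :: "('a, 'b::euclidean_space) simple_proc"
  assumes z: "simple_predictable F \<zeta>" and st: "0 \<le> s" "s \<le> t"
    and G: "G \<in> borel_measurable (F s)" "L2 M G"
  shows "expectation (\<lambda>\<omega>. G \<omega> \<bullet> sint i t \<zeta> \<omega>) = expectation (\<lambda>\<omega>. G \<omega> \<bullet> sint i s \<zeta> \<omega>)"
  using z
proof (induction \<zeta>)
  case (Cons e \<zeta>)
  then have p: "simple_predictable F [e]" "simple_predictable F \<zeta>"
    using simple_predictable_ConsD by blast+
  obtain a b \<xi> where e: "e = (a, b, \<xi>)" by (cases e)
  obtain C where C: "0 \<le> a" "a \<le> b" "\<xi> \<in> borel_measurable (F a)" "\<xi> \<in> borel_measurable M"
    "\<And>\<omega>. \<omega> \<in> space M \<Longrightarrow> norm (\<xi> \<omega>) \<le> C"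
    using simple_predictable_singleE p(1) unfolding e by metis
  have t: "0 \<le> t" using st by simp
  note I = L2_inner_integrable[OF G(2) sint_L2[OF p(1) t]] L2_inner_integrable[OF G(2) sint_L2[OF p(2) t]]
    L2_inner_integrable[OF G(2) sint_L2[OF p(1) st(1)]] L2_inner_integrable[OF G(2) sint_L2[OF p(2) st(1)]]
  \<comment> \<open>The endpoints of that part. The left one is used as \<open>min t l\<close>, so
    that the increment degenerates to zero when the interval starts after \<open>t\<close>.\<close>
  define l r where "l = max a s" and "r = min t (max b s)"
  have "expectation (\<lambda>\<omega>. G \<omega> \<bullet> sint i t [e] \<omega>) - expectation (\<lambda>\<omega>. G \<omega> \<bullet> sint i s [e] \<omega>)
    = expectation (\<lambda>\<omega>. G \<omega> \<bullet> sint i t [e] \<omega> - G \<omega> \<bullet> sint i s [e] \<omega>)"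
    using I by simp
  also have "\<dots> = expectation (\<lambda>\<omega>. (G \<omega> \<bullet> \<xi> \<omega>) * inc i (min t l) r \<omega>)"
  proof (intro Bochner_Integration.integral_cong refl)
    fix \<omega>
    have "inc i (min a t) (min b t) \<omega> - inc i (min a s) (min b s) \<omega> = inc i (min t l) r \<omega>"
      using C st by (auto simp: inc_def l_def r_def min_def max_def)
    then show "G \<omega> \<bullet> sint i t [e] \<omega> - G \<omega> \<bullet> sint i s [e] \<omega> = (G \<omega> \<bullet> \<xi> \<omega>) * inc i (min t l) r \<omega>"
      by (simp add: e sint_single algebra_simps flip: left_diff_distrib)
  qed
  also have "\<dots> = 0"
  proof (cases "l \<le> t")
    case True
    have m: "(\<lambda>\<omega>. G \<omega> \<bullet> \<xi> \<omega>) \<in> borel_measurable (F l)"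
      by (intro borel_measurable_inner measurable_F_mono[OF C(3)] measurable_F_mono[OF G(1)]) (auto simp: l_def)
    have "0 \<le> l" "l \<le> r" using C st True by (auto simp: l_def r_def)
    then have "expectation (\<lambda>\<omega>. (G \<omega> \<bullet> \<xi> \<omega>) * inc i l r \<omega>) = 0"
      by (rule expectation_mult_inc(2)[OF _ _ m L2_inner_integrable[OF G(2) L2_bounded[OF finite_measure_axioms C(4,5)]]])
    then show ?thesis using True by (simp add: min_def)
  next
    case False
    then have "min t l = t" "r = t" using C st by (auto simp: l_def r_def)
    then show ?thesis by (simp add: inc_def)
  qed
  finally have "expectation (\<lambda>\<omega>. G \<omega> \<bullet> sint i t [e] \<omega>) = expectation (\<lambda>\<omega>. G \<omega> \<bullet> sint i s [e] \<omega>)" by simp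
  then show ?case
    unfolding sint_Cons[of _ _ e \<zeta>] inner_add_right using I Cons.IH[OF p(2)] by simp
qed (simp add: sint_Nil)


subsection \<open>Square integrable integrands\<close>

text \<open>The integrand enters only through its L^2 distance to simple processes on the product
  space, so it may be modified on a null set. This is what allows the value of a path in place of
  its left limit.\<close>

definition ito :: "'v \<Rightarrow> ('a \<times> real \<Rightarrow> 'b::euclidean_space) \<Rightarrow> real \<Rightarrow> ('a \<Rightarrow> 'b) \<Rightarrow> bool" where
  "ito i \<phi> t I \<longleftrightarrow> (\<exists>\<zeta>. (\<forall>k. simple_predictable F (\<zeta> k)) \<and>
     L2_tendsto (prod_upto t) (\<lambda>k. sval (\<zeta> k)) \<phi> \<and> L2_tendsto M (\<lambda>k. sint i t (\<zeta> k)) I)"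

lemma ito_L2: "ito i \<phi> t I \<Longrightarrow> L2 (prod_upto t) \<phi>" "ito i \<phi> t I \<Longrightarrow> L2 M I"
  by (auto simp: ito_def L2_tendsto_def)

text \<open>\<open>\<phi>\<close> is the predictable integrand and \<open>\<psi>\<close> a product
  measurable one that agrees with it almost everywhere along every path. Tonelli's theorem, applied
  with \<open>\<psi>\<close>, turns the iterated integral of the definition into one over the
  product.\<close>

lemma has_ito_integral_imp_ito:
  fixes \<phi> \<psi> :: "real \<Rightarrow> 'a \<Rightarrow> 'b::euclidean_space"
  assumes I: "has_ito_integral M F (\<lambda>s \<omega>. L s \<omega> $ i) \<phi> t I" and t: "0 \<le> t"
    and m[measurable]: "(\<lambda>z. \<psi> (snd z) (fst z)) \<in> borel_measurable (M \<Otimes>\<^sub>M borel)"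
    and eq: "\<And>\<omega>. \<omega> \<in> space M \<Longrightarrow> AE s in lborel_upto t. \<phi> s \<omega> = \<psi> s \<omega>"
  shows "ito i (\<lambda>z. \<psi> (snd z) (fst z)) t I"
proof -
  interpret lborel_upto: finite_measure "lborel_upto t" by simp
  obtain \<zeta> where z: "\<And>k::nat. simple_predictable F (\<zeta> k)"
    and l1: "(\<lambda>k. \<integral>\<^sup>+\<omega>. (\<integral>\<^sup>+s\<in>{0<..t}. ennreal ((norm (simple_value (\<zeta> k) s \<omega> - \<phi> s \<omega>))\<^sup>2) \<partial>lborel) \<partial>M) \<longlonglongrightarrow> 0"
    and l2: "(\<lambda>k. \<integral>\<^sup>+\<omega>. ennreal ((norm (simple_integral_upto (\<lambda>s \<omega>. L s \<omega> $ i) (\<zeta> k) t \<omega> - I \<omega>))\<^sup>2) \<partial>M) \<longlonglongrightarrow> 0"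
    and Im: "I \<in> borel_measurable M"
    using I unfolding has_ito_integral_def by blast
  have "L2_tendsto M (\<lambda>k. sint i t (\<zeta> k)) I"
    using l2 by (intro L2_tendstoI sint_L2 z t Im) (simp add: sint_def)
  moreover have "L2_tendsto (prod_upto t) (\<lambda>k. sval (\<zeta> k)) (\<lambda>z. \<psi> (snd z) (fst z))"
  proof (intro L2_tendstoI sval_L2 z)
    show [measurable]: "(\<lambda>z. \<psi> (snd z) (fst z)) \<in> borel_measurable (prod_upto t)" by measurable
    have "(\<integral>\<^sup>+z. ennreal ((norm (sval (\<zeta> k) z - \<psi> (snd z) (fst z)))\<^sup>2) \<partial>prod_upto t) =
        (\<integral>\<^sup>+\<omega>. (\<integral>\<^sup>+s\<in>{0<..t}. ennreal ((norm (simple_value (\<zeta> k) s \<omega> - \<phi> s \<omega>))\<^sup>2) \<partial>lborel) \<partial>M)" for k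
    proof -
      have m1[measurable]: "sval (\<zeta> k) \<in> borel_measurable (M \<Otimes>\<^sub>M borel)"
        using sval_L2[OF z, of t k] by (simp add: L2_def cong: measurable_cong_sets)
      have "(\<integral>\<^sup>+z. ennreal ((norm (sval (\<zeta> k) z - \<psi> (snd z) (fst z)))\<^sup>2) \<partial>prod_upto t)
         = (\<integral>\<^sup>+\<omega>. (\<integral>\<^sup>+s. ennreal ((norm (sval (\<zeta> k) (\<omega>, s) - \<psi> s \<omega>))\<^sup>2) \<partial>lborel_upto t) \<partial>M)"
        by (subst lborel_upto.nn_integral_fst[symmetric]) auto
      also have "\<dots> = (\<integral>\<^sup>+\<omega>. (\<integral>\<^sup>+s\<in>{0<..t}. ennreal ((norm (simple_value (\<zeta> k) s \<omega> - \<phi> s \<omega>))\<^sup>2) \<partial>lborel) \<partial>M)"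
      proof (intro nn_integral_cong)
        fix \<omega> assume w: "\<omega> \<in> space M"
        have "(\<lambda>s. sval (\<zeta> k) (\<omega>, s)) \<in> borel_measurable borel" "(\<lambda>s. \<psi> s \<omega>) \<in> borel_measurable borel"
          using measurable_Pair2[OF m1 w] measurable_Pair2[OF m w] by auto
        then have "(\<integral>\<^sup>+s. ennreal ((norm (sval (\<zeta> k) (\<omega>, s) - \<psi> s \<omega>))\<^sup>2) \<partial>lborel_upto t)
          = (\<integral>\<^sup>+s\<in>{0<..t}. ennreal ((norm (sval (\<zeta> k) (\<omega>, s) - \<psi> s \<omega>))\<^sup>2) \<partial>lborel)"
          by (intro nn_integral_upto) simp
        also have "\<dots> = (\<integral>\<^sup>+s\<in>{0<..t}. ennreal ((norm (simple_value (\<zeta> k) s \<omega> - \<phi> s \<omega>))\<^sup>2) \<partial>lborel)"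
          using eq[OF w] by (intro nn_integral_cong_AE) (auto simp: AE_upto sval_def indicator_def elim!: eventually_mono)
        finally show "(\<integral>\<^sup>+s. ennreal ((norm (sval (\<zeta> k) (\<omega>, s) - \<psi> s \<omega>))\<^sup>2) \<partial>lborel_upto t) = \<dots>" .
      qed
      finally show ?thesis .
    qed
    then show "(\<lambda>k. \<integral>\<^sup>+z. ennreal ((norm (sval (\<zeta> k) z - \<psi> (snd z) (fst z)))\<^sup>2) \<partial>prod_upto t) \<longlonglongrightarrow> 0"
      using l1 by simp
  qed
  ultimately show ?thesis using z by (auto simp: ito_def)
qed

lemma ito_isometry:
  fixes \<phi> \<psi> :: "'a \<times> real \<Rightarrow> 'b::euclidean_space"
  assumes I: "ito i \<phi> t I" and J: "ito j \<psi> t J" and t: "0 \<le> t" and h: "bounded_linear h"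
  shows "expectation (\<lambda>\<omega>. I \<omega> \<bullet> h (J \<omega>)) = K $ i $ j * (LINT z|prod_upto t. \<phi> z \<bullet> h (\<psi> z))"
proof -
  obtain \<zeta> where z: "\<And>k. simple_predictable F (\<zeta> k)"
    and z1: "L2_tendsto (prod_upto t) (\<lambda>k. sval (\<zeta> k)) \<phi>" "L2_tendsto M (\<lambda>k. sint i t (\<zeta> k)) I"
    using I by (auto simp: ito_def)
  obtain \<eta> where e: "\<And>k. simple_predictable F (\<eta> k)"
    and e1: "L2_tendsto (prod_upto t) (\<lambda>k. sval (\<eta> k)) \<psi>" "L2_tendsto M (\<lambda>k. sint j t (\<eta> k)) J"
    using J by (auto simp: ito_def)
  have "(\<lambda>k. expectation (\<lambda>\<omega>. sint i t (\<zeta> k) \<omega> \<bullet> h (sint j t (\<eta> k) \<omega>))) \<longlonglongrightarrow> expectation (\<lambda>\<omega>. I \<omega> \<bullet> h (J \<omega>))"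
    by (rule L2_tendsto_inner[OF z1(2) L2_tendsto_linear[OF e1(2) h]])
  moreover have "(\<lambda>k. K $ i $ j * (LINT z|prod_upto t. sval (\<zeta> k) z \<bullet> h (sval (\<eta> k) z)))
      \<longlonglongrightarrow> K $ i $ j * (LINT z|prod_upto t. \<phi> z \<bullet> h (\<psi> z))"
    by (intro tendsto_mult_left L2_tendsto_inner[OF z1(1) L2_tendsto_linear[OF e1(1) h]])
  ultimately show ?thesis
    unfolding simple_isometry[OF z e t h] by (rule LIMSEQ_unique)
qed

section \<open>Shorter horizons and the martingale property\<close>

lemma prod_upto_mono:
  assumes "L2 (prod_upto t) f" "s \<le> t"
  shows "L2 (prod_upto s) f" "(LINT z|prod_upto s. (norm (f z))\<^sup>2) \<le> (LINT z|prod_upto t. (norm (f z))\<^sup>2)"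
proof -
  interpret s: finite_measure "lborel_upto s" by simp
  interpret t: finite_measure "lborel_upto t" by simp
  have fm[measurable]: "f \<in> borel_measurable (M \<Otimes>\<^sub>M borel)"
    using assms(1) by (simp add: L2_def cong: measurable_cong_sets)
  have i: "integrable (prod_upto t) (\<lambda>z. (norm (f z))\<^sup>2)" using assms by (simp add: L2_def)
  have le: "(\<integral>\<^sup>+z. ennreal ((norm (f z))\<^sup>2) \<partial>prod_upto s) \<le> (\<integral>\<^sup>+z. ennreal ((norm (f z))\<^sup>2) \<partial>prod_upto t)"
    unfolding s.nn_integral_fst[of "\<lambda>z. ennreal ((norm (f z))\<^sup>2)" M, simplified, symmetric]
      t.nn_integral_fst[of "\<lambda>z. ennreal ((norm (f z))\<^sup>2)" M, simplified, symmetric]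
  proof (rule nn_integral_mono)
    fix \<omega> assume w: "\<omega> \<in> space M"
    have "(\<lambda>s. f (\<omega>, s)) \<in> borel_measurable borel" using measurable_Pair2[OF fm w] .
    then show "(\<integral>\<^sup>+r. ennreal ((norm (f (\<omega>, r)))\<^sup>2) \<partial>lborel_upto s) \<le> (\<integral>\<^sup>+r. ennreal ((norm (f (\<omega>, r)))\<^sup>2) \<partial>lborel_upto t)"
      using assms(2) by (auto simp: nn_integral_upto indicator_def intro!: nn_integral_mono)
  qed
  have "(\<integral>\<^sup>+z. ennreal ((norm (f z))\<^sup>2) \<partial>prod_upto t) < \<infinity>"
    using i by (simp add: integrable_iff_bounded)
  then have i': "integrable (prod_upto s) (\<lambda>z. (norm (f z))\<^sup>2)"
    using le by (auto simp: integrable_iff_bounded)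
  then show "L2 (prod_upto s) f" by (auto simp: L2_def)
  show "(LINT z|prod_upto s. (norm (f z))\<^sup>2) \<le> (LINT z|prod_upto t. (norm (f z))\<^sup>2)"
    using le by (simp add: nn_integral_eq_integral i i')
qed

lemma L2_tendsto_prod_upto_mono:
  assumes "L2_tendsto (prod_upto t) f g" "s \<le> t"
  shows "L2_tendsto (prod_upto s) f g"
proof -
  have L: "L2 (prod_upto t) (f k)" "L2 (prod_upto t) g" for k using assms by (auto simp: L2_tendsto_def)
  have "(\<lambda>k. LINT z|prod_upto s. (norm (f k z - g z))\<^sup>2) \<longlonglongrightarrow> 0"
  proof (rule tendsto_sandwich[OF _ _ tendsto_const])
    show "(\<lambda>k. LINT z|prod_upto t. (norm (f k z - g z))\<^sup>2) \<longlonglongrightarrow> 0"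
      using assms by (simp add: L2_tendsto_def)
    show "\<forall>\<^sub>F k in sequentially. (LINT z|prod_upto s. (norm (f k z - g z))\<^sup>2) \<le> (LINT z|prod_upto t. (norm (f k z - g z))\<^sup>2)"
      by (intro always_eventually allI prod_upto_mono(2) L2_diff L assms)
  qed simp
  then show ?thesis using prod_upto_mono(1)[OF _ assms(2)] L by (auto simp: L2_tendsto_def)
qed

text \<open>The two integrals come with unrelated approximations. The one for the later time may be
  stopped at \<open>s\<close>, by the martingale property of simple integrals; there the isometry
  shows that both approximations have the same L^2 limit, since both integrands tend to
  \<open>\<phi>\<close>.\<close>

lemma ito_martingale:
  assumes I: "ito i \<phi> t I" and J: "ito i \<phi> s J" and st: "0 \<le> s" "s \<le> t"
    and G: "G \<in> borel_measurable (F s)" "L2 M G"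
  shows "expectation (\<lambda>\<omega>. G \<omega> \<bullet> I \<omega>) = expectation (\<lambda>\<omega>. G \<omega> \<bullet> J \<omega>)"
proof -
  obtain \<zeta> where z: "\<And>k. simple_predictable F (\<zeta> k)"
    and z0: "L2_tendsto (prod_upto t) (\<lambda>k. sval (\<zeta> k)) \<phi>" and z2: "L2_tendsto M (\<lambda>k. sint i t (\<zeta> k)) I"
    using I by (auto simp: ito_def)
  have z1: "L2_tendsto (prod_upto s) (\<lambda>k. sval (\<zeta> k)) \<phi>" by (rule L2_tendsto_prod_upto_mono[OF z0 st(2)])
  obtain \<eta> where e: "\<And>k. simple_predictable F (\<eta> k)"
    and e1: "L2_tendsto (prod_upto s) (\<lambda>k. sval (\<eta> k)) \<phi>" and e2: "L2_tendsto M (\<lambda>k. sint i s (\<eta> k)) J"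
    using J by (auto simp: ito_def)
  define X Y where "X k = sint i s (\<zeta> k)" and "Y k = sint i s (\<eta> k)" for k
  have L: "L2 M (X k)" "L2 M (Y k)" for k
    unfolding X_def Y_def by (intro sint_L2 z e st)+
  define a where "a k = expectation (\<lambda>\<omega>. (norm (X k \<omega> - Y k \<omega>))\<^sup>2)" for k
  have iso: "expectation (\<lambda>\<omega>. X k \<omega> \<bullet> X k \<omega>) = K $ i $ i * (LINT z|prod_upto s. sval (\<zeta> k) z \<bullet> sval (\<zeta> k) z)"
    "expectation (\<lambda>\<omega>. X k \<omega> \<bullet> Y k \<omega>) = K $ i $ i * (LINT z|prod_upto s. sval (\<zeta> k) z \<bullet> sval (\<eta> k) z)"
    "expectation (\<lambda>\<omega>. Y k \<omega> \<bullet> Y k \<omega>) = K $ i $ i * (LINT z|prod_upto s. sval (\<eta> k) z \<bullet> sval (\<eta> k) z)" for k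
    unfolding X_def Y_def by (intro simple_isometry[where h="\<lambda>x. x"] z e st bounded_linear_ident)+
  have "a k = expectation (\<lambda>\<omega>. X k \<omega> \<bullet> X k \<omega> - 2 * (X k \<omega> \<bullet> Y k \<omega>) + Y k \<omega> \<bullet> Y k \<omega>)" for k
    unfolding a_def by (intro Bochner_Integration.integral_cong)
      (auto simp: power2_norm_eq_inner inner_diff inner_commute)
  also have "\<dots> k = expectation (\<lambda>\<omega>. X k \<omega> \<bullet> X k \<omega>) - 2 * expectation (\<lambda>\<omega>. X k \<omega> \<bullet> Y k \<omega>) + expectation (\<lambda>\<omega>. Y k \<omega> \<bullet> Y k \<omega>)" for k
    using L2_inner_integrable[OF L(1)[of k] L(1)[of k]] L2_inner_integrable[OF L(1)[of k] L(2)[of k]]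
      L2_inner_integrable[OF L(2)[of k] L(2)[of k]] by simp
  finally have a_eq: "a = (\<lambda>k. K $ i $ i * (LINT z|prod_upto s. sval (\<zeta> k) z \<bullet> sval (\<zeta> k) z)
      - 2 * (K $ i $ i * (LINT z|prod_upto s. sval (\<zeta> k) z \<bullet> sval (\<eta> k) z))
      + K $ i $ i * (LINT z|prod_upto s. sval (\<eta> k) z \<bullet> sval (\<eta> k) z))"
    by (auto simp: iso fun_eq_iff)
  \<comment> \<open>The three second moments have the same limit, and their coefficients 1, -2 and 1
    cancel.\<close>
  have "a \<longlonglongrightarrow> K $ i $ i * (LINT z|prod_upto s. \<phi> z \<bullet> \<phi> z) - 2 * (K $ i $ i * (LINT z|prod_upto s. \<phi> z \<bullet> \<phi> z))
      + K $ i $ i * (LINT z|prod_upto s. \<phi> z \<bullet> \<phi> z)"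
    unfolding a_eq by (intro tendsto_add tendsto_diff tendsto_mult_left L2_tendsto_inner z1 e1)
  then have a0: "a \<longlonglongrightarrow> 0" by simp
  let ?g = "sqrt (expectation (\<lambda>\<omega>. (norm (G \<omega>))\<^sup>2))"
  have "(\<lambda>k. expectation (\<lambda>\<omega>. G \<omega> \<bullet> (X k \<omega> - Y k \<omega>))) \<longlonglongrightarrow> 0"
  proof (rule Lim_null_comparison[OF always_eventually])
    show "\<forall>k. norm (expectation (\<lambda>\<omega>. G \<omega> \<bullet> (X k \<omega> - Y k \<omega>))) \<le> ?g * sqrt (a k)"
      unfolding real_norm_def a_def by (intro allI L2_Cauchy_Schwarz L2_diff L G)
    have "(\<lambda>k. ?g * sqrt (a k)) \<longlonglongrightarrow> ?g * sqrt 0" by (intro tendsto_intros a0)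
    then show "(\<lambda>k. ?g * sqrt (a k)) \<longlonglongrightarrow> 0" by simp
  qed
  moreover have "(\<lambda>k. expectation (\<lambda>\<omega>. G \<omega> \<bullet> Y k \<omega>)) \<longlonglongrightarrow> expectation (\<lambda>\<omega>. G \<omega> \<bullet> J \<omega>)"
    unfolding Y_def by (intro L2_tendsto_inner L2_tendsto_const G e2)
  ultimately have "(\<lambda>k. expectation (\<lambda>\<omega>. G \<omega> \<bullet> (X k \<omega> - Y k \<omega>)) + expectation (\<lambda>\<omega>. G \<omega> \<bullet> Y k \<omega>))
      \<longlonglongrightarrow> 0 + expectation (\<lambda>\<omega>. G \<omega> \<bullet> J \<omega>)"
    by (rule tendsto_add)
  also have "(\<lambda>k. expectation (\<lambda>\<omega>. G \<omega> \<bullet> (X k \<omega> - Y k \<omega>)) + expectation (\<lambda>\<omega>. G \<omega> \<bullet> Y k \<omega>))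
     = (\<lambda>k. expectation (\<lambda>\<omega>. G \<omega> \<bullet> sint i t (\<zeta> k) \<omega>))"
  proof
    fix k
    show "expectation (\<lambda>\<omega>. G \<omega> \<bullet> (X k \<omega> - Y k \<omega>)) + expectation (\<lambda>\<omega>. G \<omega> \<bullet> Y k \<omega>)
      = expectation (\<lambda>\<omega>. G \<omega> \<bullet> sint i t (\<zeta> k) \<omega>)"
      unfolding simple_martingale[OF z st G] inner_diff_right
      using L2_inner_integrable[OF G(2) L(1)[of k]] L2_inner_integrable[OF G(2) L(2)[of k]]
      by (simp add: X_def)
  qed
  finally have "(\<lambda>k. expectation (\<lambda>\<omega>. G \<omega> \<bullet> sint i t (\<zeta> k) \<omega>)) \<longlonglongrightarrow> expectation (\<lambda>\<omega>. G \<omega> \<bullet> J \<omega>)" by simp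
  moreover have "(\<lambda>k. expectation (\<lambda>\<omega>. G \<omega> \<bullet> sint i t (\<zeta> k) \<omega>)) \<longlonglongrightarrow> expectation (\<lambda>\<omega>. G \<omega> \<bullet> I \<omega>)"
    by (intro L2_tendsto_inner L2_tendsto_const G z2)
  ultimately show ?thesis using LIMSEQ_unique by blast
qed

end

section \<open>Processes driven by a drift and a linear noise term\<close>

text \<open>Isolates what the energy identity uses of the bilinear system. The drift grows at most
  linearly in the state, with a rate \<open>c\<close> that is merely integrable in time; for the
  bilinear system it is a multiple of one plus the norm of the control.\<close>

locale linear_noise_process = levy_driver M F L K
  for M :: "'a measure" and F :: "real \<Rightarrow> 'a measure"
    and L :: "real \<Rightarrow> 'a \<Rightarrow> real^'v" and K :: "real^'v^'v" +
  fixes X f :: "real \<Rightarrow> 'a \<Rightarrow> 'b::euclidean_space" and c :: "real \<Rightarrow> real" and h :: "'v \<Rightarrow> 'b \<Rightarrow> 'b"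
  assumes X_joint: "(\<lambda>z. X (snd z) (fst z)) \<in> borel_measurable (M \<Otimes>\<^sub>M borel)"
    and f_joint: "(\<lambda>z. f (snd z) (fst z)) \<in> borel_measurable (M \<Otimes>\<^sub>M borel)"
    and f_adapted: "\<And>s. 0 \<le> s \<Longrightarrow> f s \<in> borel_measurable (F s)"
    and X_bounded: "\<And>\<omega> t. \<omega> \<in> space M \<Longrightarrow> bounded ((\<lambda>s. X s \<omega>) ` {0..t})"
    and c: "\<And>t. integrable (lborel_upto t) c" "\<And>s. 0 \<le> c s"
    and f_bound: "\<And>s \<omega>. norm (f s \<omega>) \<le> c s * (norm (X s \<omega>) + 1)"
    and h: "\<And>i. bounded_linear (h i)"
    and sde: "\<And>t. 0 \<le> t \<Longrightarrow> \<exists>I. (\<forall>i. ito i (\<lambda>z. h i (X (snd z) (fst z))) t (I i)) \<and>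
      (AE \<omega> in M. X t \<omega> = (LINT s|lborel_upto t. f s \<omega>) + (\<Sum>i\<in>UNIV. I i \<omega>))"
begin

lemma c_measurable[measurable]: "c \<in> borel_measurable borel"
  using borel_measurable_integrable[OF c(1)] by simp

lemma X_measurable[measurable (raw)]:
  "g \<in> borel_measurable N \<Longrightarrow> k \<in> measurable N M \<Longrightarrow> (\<lambda>w. X (g w) (k w)) \<in> borel_measurable N"
  using measurable_compose[OF measurable_Pair[of k N M g borel] X_joint] by simp

lemma f_measurable[measurable (raw)]:
  "g \<in> borel_measurable N \<Longrightarrow> k \<in> measurable N M \<Longrightarrow> (\<lambda>w. f (g w) (k w)) \<in> borel_measurable N"
  using measurable_compose[OF measurable_Pair[of k N M g borel] f_joint] by simp

section \<open>Decomposition into a drift part and a martingale part\<close>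

definition D :: "real \<Rightarrow> 'a \<Rightarrow> 'b" where
  "D t \<omega> = (LINT s|lborel_upto t. f s \<omega>)"

text \<open>Defined as a difference and not as the sum of Ito integrals: those are chosen for each
  time separately and up to null sets, whereas this version is jointly measurable in time and sample
  point.\<close>

definition J :: "real \<Rightarrow> 'a \<Rightarrow> 'b" where
  "J t \<omega> = X t \<omega> - D t \<omega>"

lemma D_measurable[measurable (raw)]:
  assumes [measurable]: "g \<in> borel_measurable N" "k \<in> measurable N M"
  shows "(\<lambda>w. D (g w) (k w)) \<in> borel_measurable N"
  unfolding D_def by measurable

lemma J_measurable[measurable (raw)]:
  assumes [measurable]: "g \<in> borel_measurable N" "k \<in> measurable N M"
  shows "(\<lambda>w. J (g w) (k w)) \<in> borel_measurable N"
  unfolding J_def by measurable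

section \<open>Pathwise integrability and bounds for the drift part\<close>

lemma path_bound:
  assumes "\<omega> \<in> space M"
  obtains b where "0 \<le> b" "\<And>s. s \<in> {0..t} \<Longrightarrow> norm (X s \<omega>) \<le> b"
proof -
  obtain b where "\<forall>y\<in>(\<lambda>s. X s \<omega>) ` {0..t}. norm y \<le> b" using X_bounded[OF assms] unfolding bounded_iff by blast
  then show ?thesis by (intro that[of "max 0 b"]) (auto intro: max.coboundedI2)
qed

lemma cX_integrable:
  assumes w[measurable]: "\<omega> \<in> space M"
  shows "integrable (lborel_upto t) (\<lambda>s. c s * norm (X s \<omega>))"
proof -
  obtain b where b: "0 \<le> b" "\<And>s. s \<in> {0..t} \<Longrightarrow> norm (X s \<omega>) \<le> b" using path_bound[OF w] by blast
  show ?thesis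
  proof (rule Bochner_Integration.integrable_bound)
    show "integrable (lborel_upto t) (\<lambda>s. c s * b)" using c by simp
    show "AE s in lborel_upto t. norm (c s * norm (X s \<omega>)) \<le> norm (c s * b)"
      unfolding AE_upto using b c(2) by (intro AE_I2) (auto simp: abs_mult intro!: mult_left_mono)
  qed measurable
qed

lemma f_integrable:
  assumes w[measurable]: "\<omega> \<in> space M"
  shows "integrable (lborel_upto t) (\<lambda>s. f s \<omega>)"
proof (rule Bochner_Integration.integrable_bound)
  show "integrable (lborel_upto t) (\<lambda>s. c s * norm (X s \<omega>) + c s)"
    using cX_integrable[OF w] c by simp
  show "AE s in lborel_upto t. norm (f s \<omega>) \<le> norm (c s * norm (X s \<omega>) + c s)"
    using f_bound c(2) by (intro AE_I2) (auto simp: distrib_left intro: order_trans[OF _ abs_ge_self])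
qed measurable

lemma norm_D_le:
  assumes w: "\<omega> \<in> space M" and "t \<le> T"
  shows "norm (D t \<omega>) \<le> (LINT s|lborel_upto t. c s * norm (X s \<omega>)) + (LINT s|lborel_upto T. c s)"
proof -
  have "norm (D t \<omega>) \<le> (LINT s|lborel_upto t. norm (f s \<omega>))" unfolding D_def by (rule integral_norm_bound)
  also have "\<dots> \<le> (LINT s|lborel_upto t. c s * norm (X s \<omega>) + c s)"
    using cX_integrable[OF w] f_integrable[OF w] c f_bound
    by (intro integral_mono integrable_norm) (auto simp: distrib_left)
  also have "\<dots> = (LINT s|lborel_upto t. c s * norm (X s \<omega>)) + (LINT s|lborel_upto t. c s)"
    using cX_integrable[OF w] c by simp
  also have "(LINT s|lborel_upto t. c s) \<le> (LINT s|lborel_upto T. c s)"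
    unfolding integral_upto_eq_upto[OF c_measurable \<open>t \<le> T\<close>] using c
    by (intro integral_mono integrable_mult_indicator) (auto simp: indicator_def)
  finally show ?thesis by simp
qed

lemma D_bounded_path:
  assumes w: "\<omega> \<in> space M"
  obtains b where "\<And>s. s \<in> {0..t} \<Longrightarrow> norm (D s \<omega>) \<le> b"
proof
  fix s assume s: "s \<in> {0..t}"
  have wm[measurable]: "\<omega> \<in> space M" by (rule w)
  have "(LINT s|lborel_upto s. c s * norm (X s \<omega>)) \<le> (LINT s|lborel_upto t. c s * norm (X s \<omega>))"
    using s integral_upto_eq_upto[of "\<lambda>s. c s * norm (X s \<omega>)" s t] cX_integrable[OF w, of t] c(2)
      integrable_mult_indicator[of "{..s}" "lborel_upto t" "\<lambda>s. c s * norm (X s \<omega>)"]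
    by simp (intro integral_mono, auto simp: indicator_def)
  then show "norm (D s \<omega>) \<le> (LINT s|lborel_upto t. c s * norm (X s \<omega>)) + (LINT s|lborel_upto t. c s)"
    using norm_D_le[OF w, of s t] s by simp
qed

lemma J_eq:
  assumes "0 \<le> t"
  obtains I where "\<And>i. ito i (\<lambda>z. h i (X (snd z) (fst z))) t (I i)" "AE \<omega> in M. J t \<omega> = (\<Sum>i\<in>UNIV. I i \<omega>)"
proof -
  obtain I where I: "\<And>i. ito i (\<lambda>z. h i (X (snd z) (fst z))) t (I i)"
    "AE \<omega> in M. X t \<omega> = (LINT s|lborel_upto t. f s \<omega>) + (\<Sum>i\<in>UNIV. I i \<omega>)"
    using sde[OF assms] by blast
  from I(2) have "AE \<omega> in M. J t \<omega> = (\<Sum>i\<in>UNIV. I i \<omega>)"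
    by eventually_elim (simp add: J_def D_def)
  with I(1) show ?thesis by (rule that)
qed

lemma J_L2:
  assumes "0 \<le> t" shows "L2 M (J t)"
proof -
  obtain I where I: "\<And>i. ito i (\<lambda>z. h i (X (snd z) (fst z))) t (I i)" "AE \<omega> in M. J t \<omega> = (\<Sum>i\<in>UNIV. I i \<omega>)"
    using J_eq[OF assms] by blast
  show ?thesis
    by (rule L2_cong_AE[OF L2_sum[of UNIV M I]]) (use I ito_L2(2)[OF I(1)] in \<open>auto elim!: eventually_mono\<close>)
qed

lemma hX_L2: "0 \<le> t \<Longrightarrow> L2 (prod_upto t) (\<lambda>z. h i (X (snd z) (fst z)))"
  using J_eq[of t] ito_L2(1) by metis

lemma J_isometry:
  assumes t: "0 \<le> t" and q: "bounded_linear q"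
  shows "expectation (\<lambda>\<omega>. J t \<omega> \<bullet> q (J t \<omega>)) =
    (\<Sum>i\<in>UNIV. \<Sum>j\<in>UNIV. K $ i $ j * (LINT z|prod_upto t. h i (X (snd z) (fst z)) \<bullet> q (h j (X (snd z) (fst z)))))"
proof -
  interpret q: bounded_linear q by fact
  obtain I where I: "\<And>i. ito i (\<lambda>z. h i (X (snd z) (fst z))) t (I i)" and J: "AE \<omega> in M. J t \<omega> = (\<Sum>i\<in>UNIV. I i \<omega>)"
    using J_eq[OF t] by blast
  note L = ito_L2(2)[OF I]
  have [measurable]: "q \<in> borel_measurable borel" "I i \<in> borel_measurable M" for i
    using L[of i] by (auto intro!: borel_measurable_continuous_onI linear_continuous_on q simp: L2_def)
  have "expectation (\<lambda>\<omega>. J t \<omega> \<bullet> q (J t \<omega>)) = expectation (\<lambda>\<omega>. \<Sum>i\<in>UNIV. \<Sum>j\<in>UNIV. I i \<omega> \<bullet> q (I j \<omega>))"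
  proof (rule integral_cong_AE)
    show "AE \<omega> in M. J t \<omega> \<bullet> q (J t \<omega>) = (\<Sum>i\<in>UNIV. \<Sum>j\<in>UNIV. I i \<omega> \<bullet> q (I j \<omega>))"
      using J
    proof eventually_elim
      case (elim \<omega>)
      show ?case unfolding elim q.sum inner_sum_left by (simp add: inner_sum_right)
    qed
  qed measurable
  also have "\<dots> = (\<Sum>i\<in>UNIV. \<Sum>j\<in>UNIV. expectation (\<lambda>\<omega>. I i \<omega> \<bullet> q (I j \<omega>)))"
    using L2_inner_integrable[OF L L2_linear[OF L q]] by simp
  finally show ?thesis by (simp add: ito_isometry[OF I I t q])
qed

lemma J_martingale:
  assumes st: "0 \<le> s" "s \<le> t" and G: "G \<in> borel_measurable (F s)" "L2 M G"
  shows "expectation (\<lambda>\<omega>. G \<omega> \<bullet> J t \<omega>) = expectation (\<lambda>\<omega>. G \<omega> \<bullet> J s \<omega>)"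
proof -
  have *: "\<exists>I. (\<forall>i. ito i (\<lambda>z. h i (X (snd z) (fst z))) t (I i)) \<and>
    expectation (\<lambda>\<omega>. G \<omega> \<bullet> J t \<omega>) = (\<Sum>i\<in>UNIV. expectation (\<lambda>\<omega>. G \<omega> \<bullet> I i \<omega>))" if t: "0 \<le> t" for t
  proof -
    obtain I where I: "\<And>i. ito i (\<lambda>z. h i (X (snd z) (fst z))) t (I i)" and J: "AE \<omega> in M. J t \<omega> = (\<Sum>i\<in>UNIV. I i \<omega>)"
      using J_eq[OF t] by blast
    note L = ito_L2(2)[OF I]
    have [measurable]: "I i \<in> borel_measurable M" "G \<in> borel_measurable M" for i
      using L[of i] G by (auto simp: L2_def)
    have "expectation (\<lambda>\<omega>. G \<omega> \<bullet> J t \<omega>) = expectation (\<lambda>\<omega>. \<Sum>i\<in>UNIV. G \<omega> \<bullet> I i \<omega>)"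
    proof (rule integral_cong_AE)
      show "AE \<omega> in M. G \<omega> \<bullet> J t \<omega> = (\<Sum>i\<in>UNIV. G \<omega> \<bullet> I i \<omega>)"
        using J by eventually_elim (simp add: inner_sum_right)
    qed measurable
    also have "\<dots> = (\<Sum>i\<in>UNIV. expectation (\<lambda>\<omega>. G \<omega> \<bullet> I i \<omega>))"
      using L2_inner_integrable[OF G(2) L] by simp
    finally show ?thesis using I by blast
  qed
  obtain I where I: "\<And>i. ito i (\<lambda>z. h i (X (snd z) (fst z))) t (I i)"
    "expectation (\<lambda>\<omega>. G \<omega> \<bullet> J t \<omega>) = (\<Sum>i\<in>UNIV. expectation (\<lambda>\<omega>. G \<omega> \<bullet> I i \<omega>))"
    using *[of t] st by auto
  obtain I' where I': "\<And>i. ito i (\<lambda>z. h i (X (snd z) (fst z))) s (I' i)"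
    "expectation (\<lambda>\<omega>. G \<omega> \<bullet> J s \<omega>) = (\<Sum>i\<in>UNIV. expectation (\<lambda>\<omega>. G \<omega> \<bullet> I' i \<omega>))"
    using *[of s] st by auto
  show ?thesis unfolding I I' using ito_martingale[OF I(1) I'(1) st G] by simp
qed

text \<open>By the isometry the second moment of each component integral is an integral up to
  \<open>t\<close> of a nonnegative function, so the value at \<open>T\<close> is a uniform bound.
  The cardinality factor comes from squaring a sum over the components.\<close>

lemma J_second_moment_bound: "\<exists>C\<ge>0. \<forall>t\<in>{0..T}. expectation (\<lambda>\<omega>. (norm (J t \<omega>))\<^sup>2) \<le> C"
proof (cases "0 \<le> T")
  case True
  let ?n = "\<lambda>t i. LINT z|prod_upto t. (norm (h i (X (snd z) (fst z))))\<^sup>2"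
  let ?C = "(\<Sum>i\<in>UNIV. K $ i $ i * ?n T i) * real CARD('v)"
  have "expectation (\<lambda>\<omega>. (norm (J t \<omega>))\<^sup>2) \<le> ?C" if t: "t \<in> {0..T}" for t
  proof -
    have t0: "0 \<le> t" using t by simp
    obtain I where I: "\<And>i. ito i (\<lambda>z. h i (X (snd z) (fst z))) t (I i)" and J: "AE \<omega> in M. J t \<omega> = (\<Sum>i\<in>UNIV. I i \<omega>)"
      using J_eq[OF t0] by blast
    note L = ito_L2(2)[OF I]
    have int: "integrable M (\<lambda>\<omega>. (norm (I i \<omega>))\<^sup>2)" for i using L[of i] by (simp add: L2_def)
    have "expectation (\<lambda>\<omega>. (norm (J t \<omega>))\<^sup>2) \<le> expectation (\<lambda>\<omega>. (\<Sum>i\<in>UNIV. (norm (I i \<omega>))\<^sup>2) * real CARD('v))"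
    proof (rule integral_mono_AE)
      show "integrable M (\<lambda>\<omega>. (norm (J t \<omega>))\<^sup>2)" using J_L2[OF t0] by (simp add: L2_def)
      show "integrable M (\<lambda>\<omega>. (\<Sum>i\<in>UNIV. (norm (I i \<omega>))\<^sup>2) * real CARD('v))" using int by simp
      show "AE \<omega> in M. (norm (J t \<omega>))\<^sup>2 \<le> (\<Sum>i\<in>UNIV. (norm (I i \<omega>))\<^sup>2) * real CARD('v)"
        using J
      proof eventually_elim
        case (elim \<omega>)
        have "(norm (J t \<omega>))\<^sup>2 \<le> (\<Sum>i\<in>UNIV. norm (I i \<omega>))\<^sup>2"
          unfolding elim by (intro power_mono norm_sum) auto
        also have "\<dots> \<le> (\<Sum>i\<in>UNIV. (norm (I i \<omega>))\<^sup>2) * real CARD('v)"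
          by (rule sum_squared_le_sum_of_squares)
        finally show ?case .
      qed
    qed
    also have "\<dots> = (\<Sum>i\<in>UNIV. K $ i $ i * ?n t i) * real CARD('v)"
      using int ito_isometry[OF I I t0 bounded_linear_ident] by (simp add: power2_norm_eq_inner)
    also have "\<dots> \<le> ?C"
      using t by (intro mult_right_mono sum_mono mult_left_mono prod_upto_mono(2) hX_L2 K_diag_nonneg) auto
    finally show ?thesis .
  qed
  moreover have "0 \<le> ?C" by (intro mult_nonneg_nonneg sum_nonneg K_diag_nonneg) auto
  ultimately show ?thesis by blast
qed (simp, blast)

text \<open>Pathwise, Gronwall's inequality bounds \<open>X\<close> by a square integrable functional of \<open>J\<close>.\<close>

lemma path_estimate:
  fixes T :: real
  defines "c1 \<equiv> LINT s|lborel_upto T. c s"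
  assumes w: "\<omega> \<in> space M" and t: "t \<in> {0..T}"
  shows "integrable (lborel_upto T) (\<lambda>s. c s * (norm (J s \<omega>) + c1)\<^sup>2)" (is ?int)
    and "(norm (X t \<omega>))\<^sup>2 \<le> 2 * (norm (J t \<omega>) + c1)\<^sup>2
      + 2 * (exp c1)\<^sup>2 * (c1 * (LINT s|lborel_upto T. c s * (norm (J s \<omega>) + c1)\<^sup>2))" (is ?le)
proof -
  have wm[measurable]: "\<omega> \<in> space M" by (rule w)
  have c1: "0 \<le> c1" unfolding c1_def using c by simp
  define g where "g s = norm (J s \<omega>) + c1" for s
  have g_measurable[measurable]: "g \<in> borel_measurable borel" unfolding g_def[abs_def] by measurable
  \<comment> \<open>Gronwall is applied to \<open>y\<close> and not to the norm of \<open>X\<close>: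
    from norm \<open>X\<close> at most \<open>g + y\<close> it yields \<open>y T\<close> at most
    \<open>a * exp c1\<close>, and the final bound keeps \<open>g\<close> at the single time
    \<open>t\<close>.\<close>
  define y where "y t = (LINT s|lborel_upto t. c s * norm (X s \<omega>))" for t
  have y_measurable[measurable]: "y \<in> borel_measurable borel" unfolding y_def[abs_def] by measurable
  \<comment> \<open>The bounds \<open>b\<close> and \<open>b'\<close> depend on the path. They
    secure integrability but do not enter the estimate.\<close>
  obtain b where b: "0 \<le> b" "\<And>s. s \<in> {0..T} \<Longrightarrow> norm (X s \<omega>) \<le> b" using path_bound[OF w] by blast
  obtain b' where b': "\<And>s. s \<in> {0..T} \<Longrightarrow> norm (D s \<omega>) \<le> b'" using D_bounded_path[OF w] by blast
  have gB: "g s \<le> b + b' + c1" if "s \<in> {0..T}" for s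
    using norm_triangle_ineq4[of "X s \<omega>" "D s \<omega>"] b(2)[OF that] b'[OF that] by (simp add: g_def J_def)
  have g0: "0 \<le> g s" for s using c1 by (simp add: g_def)
  have cg: "integrable (lborel_upto T) (\<lambda>s. c s * g s)"
  proof (rule Bochner_Integration.integrable_bound)
    show "integrable (lborel_upto T) (\<lambda>s. c s * (b + b' + c1))" using c by simp
    show "AE s in lborel_upto T. norm (c s * g s) \<le> norm (c s * (b + b' + c1))"
      unfolding AE_upto using gB g0 c(2)
      by (intro AE_I2) (auto simp: abs_mult intro!: mult_left_mono order_trans[OF _ abs_ge_self])
  qed measurable
  have cg2: "integrable (lborel_upto T) (\<lambda>s. c s * (g s)\<^sup>2)"
  proof (rule Bochner_Integration.integrable_bound)
    show "integrable (lborel_upto T) (\<lambda>s. c s * (b + b' + c1)\<^sup>2)" using c by simp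
    show "AE s in lborel_upto T. norm (c s * (g s)\<^sup>2) \<le> norm (c s * (b + b' + c1)\<^sup>2)"
      unfolding AE_upto using gB g0 c(2)
      by (intro AE_I2) (auto simp: abs_mult intro!: mult_left_mono power_mono)
  qed measurable
  then show ?int by (simp add: g_def)
  have mono: "(LINT s|lborel_upto r. k s) \<le> (LINT s|lborel_upto T. k s)"
    if "r \<le> T" "\<And>s. 0 \<le> k s" "integrable (lborel_upto T) k" for r and k :: "real \<Rightarrow> real"
  proof -
    have "k \<in> borel_measurable borel" using borel_measurable_integrable[OF that(3)] by simp
    from integral_upto_eq_upto[OF this that(1)] have "(LINT s|lborel_upto r. k s) = (LINT s|lborel_upto T. indicator {..r} s *\<^sub>R k s)" .
    also have "\<dots> \<le> (LINT s|lborel_upto T. k s)"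
      using that by (intro integral_mono integrable_mult_indicator) (auto simp: indicator_def)
    finally show ?thesis .
  qed
  have Xg: "norm (X s \<omega>) \<le> g s + y s" if "s \<in> {0..T}" for s
  proof -
    have "norm (X s \<omega>) \<le> norm (J s \<omega>) + norm (D s \<omega>)"
      using norm_triangle_ineq[of "J s \<omega>" "D s \<omega>"] by (simp add: J_def)
    then show ?thesis using norm_D_le[OF w, of s T] that by (simp add: g_def y_def c1_def)
  qed
  have y0: "0 \<le> y s" for s unfolding y_def using c by simp
  have yB: "y s \<le> y T" if "s \<in> {0..T}" for s
    unfolding y_def using that c(2) by (intro mono cX_integrable w) auto
  have cy: "integrable (lborel_upto T) (\<lambda>s. c s * y s)"
  proof (rule Bochner_Integration.integrable_bound)
    show "integrable (lborel_upto T) (\<lambda>s. c s * y T)" using c by simp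
    show "AE s in lborel_upto T. norm (c s * y s) \<le> norm (c s * y T)"
      unfolding AE_upto using yB y0 c(2) by (intro AE_I2) (auto simp: abs_mult intro!: mult_left_mono)
  qed measurable
  define a where "a = (LINT s|lborel_upto T. c s * g s)"
  have a0: "0 \<le> a" unfolding a_def using c g0 by simp
  have yle: "y s \<le> a + (LINT r|lborel_upto s. c r * y r)" if s: "s \<in> {0..T}" for s
  proof -
    have "y s \<le> (LINT r|lborel_upto s. c r * g r + c r * y r)"
      unfolding y_def[of s]
    proof (rule integral_mono_AE)
      show "integrable (lborel_upto s) (\<lambda>r. c r * g r + c r * y r)"
        using s by (intro Bochner_Integration.integrable_add integrable_upto_mono[OF cg] integrable_upto_mono[OF cy]) auto
      have "c r * norm (X r \<omega>) \<le> c r * g r + c r * y r" if "0 < r" "r \<le> s" for r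
        using mult_left_mono[OF Xg[of r] c(2)[of r]] that s by (simp add: distrib_left)
      then show "AE r in lborel_upto s. c r * norm (X r \<omega>) \<le> c r * g r + c r * y r"
        by (simp add: AE_upto)
    qed (rule cX_integrable[OF w])
    also have "\<dots> = (LINT r|lborel_upto s. c r * g r) + (LINT r|lborel_upto s. c r * y r)"
      using s by (intro Bochner_Integration.integral_add integrable_upto_mono[OF cg] integrable_upto_mono[OF cy]) auto
    also have "(LINT r|lborel_upto s. c r * g r) \<le> a"
      unfolding a_def using s g0 c(2) by (intro mono cg) auto
    finally show ?thesis by simp
  qed
  have "T \<in> {0..T}" using t by simp
  from gronwall[OF c(1) c(2) y_measurable y0 yB yle a0 this]
  have yT: "y T \<le> a * exp c1" by (simp add: c1_def)
  \<comment> \<open>Cauchy-Schwarz with weight \<open>c\<close>, splitting \<open>c * g\<close> as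
    \<open>sqrt c\<close> times \<open>sqrt c * g\<close>. The result is linear in \<open>c\<close>,
    so integrability of \<open>c\<close> suffices, and quadratic in \<open>g\<close>, so its
    expectation is controlled by second moments of \<open>J\<close>.\<close>
  have a2: "a\<^sup>2 \<le> c1 * (LINT s|lborel_upto T. c s * (g s)\<^sup>2)"
  proof -
    have L: "L2 (lborel_upto T) (\<lambda>s. sqrt (c s))" "L2 (lborel_upto T) (\<lambda>s. sqrt (c s) * g s)"
      using c cg2 by (auto simp: L2_def power_mult_distrib)
    have le: "\<bar>LINT s|lborel_upto T. sqrt (c s) \<bullet> (sqrt (c s) * g s)\<bar>
      \<le> sqrt (LINT s|lborel_upto T. (norm (sqrt (c s)))\<^sup>2) * sqrt (LINT s|lborel_upto T. (norm (sqrt (c s) * g s))\<^sup>2)"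
      by (rule L2_Cauchy_Schwarz[OF L])
    have "sqrt (c s) \<bullet> (sqrt (c s) * g s) = c s * g s" for s
      using c(2)[of s] by (simp flip: mult.assoc)
    then have "(LINT s|lborel_upto T. sqrt (c s) \<bullet> (sqrt (c s) * g s)) = a"
      unfolding a_def by (rule Bochner_Integration.integral_cong[OF refl])
    moreover have "(LINT s|lborel_upto T. (norm (sqrt (c s)))\<^sup>2) = c1"
      "(LINT s|lborel_upto T. (norm (sqrt (c s) * g s))\<^sup>2) = (LINT s|lborel_upto T. c s * (g s)\<^sup>2)"
      using c(2) by (simp_all add: c1_def power_mult_distrib)
    ultimately have *: "\<bar>a\<bar> \<le> sqrt (c1 * (LINT s|lborel_upto T. c s * (g s)\<^sup>2))"
      using le by (simp only: real_sqrt_mult)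
    show ?thesis
    proof -
      have "0 \<le> c1 * (LINT s|lborel_upto T. c s * (g s)\<^sup>2)"
        using c1 c(2) by (intro mult_nonneg_nonneg Bochner_Integration.integral_nonneg) auto
      then show ?thesis using power_mono[OF *, of 2] by (simp only: power2_abs abs_ge_zero real_sqrt_pow2)
    qed
  qed
  have "norm (X t \<omega>) \<le> g t + a * exp c1" using Xg[OF t] yB[OF t] yT by simp
  then have "(norm (X t \<omega>))\<^sup>2 \<le> (norm (g t + a * exp c1))\<^sup>2"
    using g0[of t] a0 by (intro power_mono) auto
  also have "\<dots> \<le> 2 * (g t)\<^sup>2 + 2 * (a * exp c1)\<^sup>2"
    using norm_add_power2_le[of "g t" "a * exp c1"] by simp
  also have "2 * (a * exp c1)\<^sup>2 \<le> 2 * (exp c1)\<^sup>2 * (c1 * (LINT s|lborel_upto T. c s * (g s)\<^sup>2))"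
    using mult_left_mono[OF a2, of "2 * (exp c1)\<^sup>2"] by (simp add: power_mult_distrib mult_ac)
  finally show ?le by (simp add: g_def)
qed

text \<open>Tonelli with time as the outer variable: an integrable bound on the first absolute
  moment at each time is enough.\<close>

lemma integrable_prod_uptoI:
  fixes W :: "real \<Rightarrow> 'a \<Rightarrow> real"
  assumes W: "(\<lambda>z. W (snd z) (fst z)) \<in> borel_measurable (M \<Otimes>\<^sub>M borel)"
    and d: "integrable (lborel_upto t) d"
    and le: "\<And>s. 0 < s \<Longrightarrow> s \<le> t \<Longrightarrow> integrable M (W s)" "\<And>s. 0 < s \<Longrightarrow> s \<le> t \<Longrightarrow> expectation (\<lambda>\<omega>. \<bar>W s \<omega>\<bar>) \<le> d s"
  shows "integrable (prod_upto t) (\<lambda>z. W (snd z) (fst z))"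
proof -
  interpret lborel_upto: finite_measure "lborel_upto t" by simp
  interpret P: pair_sigma_finite M "lborel_upto t" ..
  have [measurable]: "(\<lambda>z. W (snd z) (fst z)) \<in> borel_measurable (prod_upto t)"
    using W by (simp cong: measurable_cong_sets)
  have "(\<integral>\<^sup>+z. ennreal (norm (W (snd z) (fst z))) \<partial>prod_upto t) = (\<integral>\<^sup>+s. \<integral>\<^sup>+\<omega>. ennreal \<bar>W s \<omega>\<bar> \<partial>M \<partial>lborel_upto t)"
    by (subst P.nn_integral_snd[symmetric]) auto
  also have "\<dots> \<le> (\<integral>\<^sup>+s. ennreal (norm (d s)) \<partial>lborel_upto t)"
  proof (rule nn_integral_mono_AE)
    have "(\<integral>\<^sup>+\<omega>. ennreal \<bar>W s \<omega>\<bar> \<partial>M) \<le> ennreal (norm (d s))" if "0 < s" "s \<le> t" for s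
    proof -
      have "(\<integral>\<^sup>+\<omega>. ennreal \<bar>W s \<omega>\<bar> \<partial>M) = ennreal (expectation (\<lambda>\<omega>. \<bar>W s \<omega>\<bar>))"
        using le(1)[OF that] by (intro nn_integral_eq_integral) auto
      then show ?thesis using le(2)[OF that] by (auto intro!: ennreal_leI)
    qed
    then show "AE s in lborel_upto t. (\<integral>\<^sup>+\<omega>. ennreal \<bar>W s \<omega>\<bar> \<partial>M) \<le> ennreal (norm (d s))"
      by (simp add: AE_upto)
  qed
  also have "\<dots> < \<infinity>" using d by (simp add: integrable_iff_bounded)
  finally show ?thesis by (simp add: integrable_iff_bounded)
qed

text \<open>The expectation of the pathwise estimate. Its right-hand side contains \<open>J\<close>
  only at time \<open>t\<close> and in a weighted time integral, and both have expectations bounded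
  by the uniform second moment of \<open>J\<close>.\<close>

lemma second_moment_bound:
  "\<exists>C\<ge>0. \<forall>t\<in>{0..T}. L2 M (X t) \<and> expectation (\<lambda>\<omega>. (norm (X t \<omega>))\<^sup>2) \<le> C"
proof -
  interpret lborel_upto: finite_measure "lborel_upto T" by simp
  interpret P: pair_sigma_finite M "lborel_upto T" ..
  obtain C where C: "0 \<le> C" "\<And>t. t \<in> {0..T} \<Longrightarrow> expectation (\<lambda>\<omega>. (norm (J t \<omega>))\<^sup>2) \<le> C"
    using J_second_moment_bound by blast
  define c1 where "c1 = (LINT s|lborel_upto T. c s)"
  have c1: "0 \<le> c1" unfolding c1_def using c by simp
  define G where "G = 2 * C + 2 * c1\<^sup>2"
  have G: "integrable M (\<lambda>\<omega>. (norm (J t \<omega>) + c1)\<^sup>2)" "expectation (\<lambda>\<omega>. (norm (J t \<omega>) + c1)\<^sup>2) \<le> G"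
    if t: "t \<in> {0..T}" for t
  proof -
    have t0: "0 \<le> t" using t by simp
    have i: "integrable M (\<lambda>\<omega>. 2 * (norm (J t \<omega>))\<^sup>2 + 2 * c1\<^sup>2)" using J_L2[OF t0] by (simp add: L2_def)
    have le: "(norm (J t \<omega>) + c1)\<^sup>2 \<le> 2 * (norm (J t \<omega>))\<^sup>2 + 2 * c1\<^sup>2" for \<omega>
      using norm_add_power2_le[of "norm (J t \<omega>)" c1] by simp
    show ii: "integrable M (\<lambda>\<omega>. (norm (J t \<omega>) + c1)\<^sup>2)"
      by (rule Bochner_Integration.integrable_bound[OF i]) (auto intro!: AE_I2 le)
    have "expectation (\<lambda>\<omega>. (norm (J t \<omega>) + c1)\<^sup>2) \<le> expectation (\<lambda>\<omega>. 2 * (norm (J t \<omega>))\<^sup>2 + 2 * c1\<^sup>2)"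
      by (intro integral_mono ii i le)
    also have "\<dots> = 2 * expectation (\<lambda>\<omega>. (norm (J t \<omega>))\<^sup>2) + 2 * c1\<^sup>2"
      using J_L2[OF t0] by (simp add: L2_def prob_space)
    finally show "expectation (\<lambda>\<omega>. (norm (J t \<omega>) + c1)\<^sup>2) \<le> G" using C(2)[OF t] by (simp add: G_def)
  qed
  have int: "integrable (prod_upto T) (\<lambda>z. c (snd z) * (norm (J (snd z) (fst z)) + c1)\<^sup>2)"
  proof (rule integrable_prod_uptoI[where d="\<lambda>s. c s * G"])
    show "expectation (\<lambda>\<omega>. \<bar>c s * (norm (J s \<omega>) + c1)\<^sup>2\<bar>) \<le> c s * G" if "0 < s" "s \<le> T" for s
      using G(2)[of s] that c(2)[of s] by (simp add: abs_mult mult_left_mono)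
  qed (use c G(1) in auto)
  define R where "R \<omega> = (LINT s|lborel_upto T. c s * (norm (J s \<omega>) + c1)\<^sup>2)" for \<omega>
  have R: "integrable M R"
    unfolding R_def[abs_def] using P.integrable_fst'[OF int] by simp
  let ?B = "\<lambda>t \<omega>. 2 * (norm (J t \<omega>) + c1)\<^sup>2 + 2 * (exp c1)\<^sup>2 * (c1 * R \<omega>)"
  let ?C = "2 * G + 2 * (exp c1)\<^sup>2 * (c1 * expectation R)"
  have "L2 M (X t) \<and> expectation (\<lambda>\<omega>. (norm (X t \<omega>))\<^sup>2) \<le> ?C" if t: "t \<in> {0..T}" for t
  proof -
    have B: "integrable M (?B t)" using G(1)[OF t] R by simp
    have le: "(norm (X t \<omega>))\<^sup>2 \<le> ?B t \<omega>" if "\<omega> \<in> space M" for \<omega>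
      using path_estimate(2)[OF that t] by (simp add: R_def c1_def)
    have i: "integrable M (\<lambda>\<omega>. (norm (X t \<omega>))\<^sup>2)"
      by (rule Bochner_Integration.integrable_bound[OF B])
        (use le in \<open>auto intro!: AE_I2 intro: order_trans[OF _ abs_ge_self]\<close>)
    have "expectation (\<lambda>\<omega>. (norm (X t \<omega>))\<^sup>2) \<le> expectation (?B t)"
      by (intro integral_mono i B le)
    also have "\<dots> = 2 * expectation (\<lambda>\<omega>. (norm (J t \<omega>) + c1)\<^sup>2) + 2 * (exp c1)\<^sup>2 * (c1 * expectation R)"
      using G(1)[OF t] R by simp
    also have "\<dots> \<le> ?C" using G(2)[OF t] by simp
    finally show ?thesis using i by (simp add: L2_def)
  qed
  moreover have "0 \<le> ?C" using c1 C c by (simp add: G_def R_def)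
  ultimately show ?thesis by blast
qed

section \<open>Integrability of the energy terms and the energy identity\<close>

lemma X_L2: "0 \<le> t \<Longrightarrow> L2 M (X t)"
  using second_moment_bound[of t] by auto

lemma D_L2: "0 \<le> t \<Longrightarrow> L2 M (D t)"
  using L2_diff[OF X_L2 J_L2, of t t] by (simp add: J_def)

lemma f_L2:
  assumes "0 \<le> s" shows "L2 M (f s)"
  unfolding L2_def
proof
  have i: "integrable M (\<lambda>\<omega>. (c s)\<^sup>2 * (2 * (norm (X s \<omega>))\<^sup>2 + 2))"
    using X_L2[OF assms] by (simp add: L2_def)
  have "(norm (f s \<omega>))\<^sup>2 \<le> (c s)\<^sup>2 * (2 * (norm (X s \<omega>))\<^sup>2 + 2)" for \<omega>
  proof -
    have "(norm (f s \<omega>))\<^sup>2 \<le> (c s * (norm (X s \<omega>) + 1))\<^sup>2" by (intro power_mono f_bound) simp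
    also have "\<dots> \<le> (c s)\<^sup>2 * (2 * (norm (X s \<omega>))\<^sup>2 + 2)"
      using norm_add_power2_le[of "norm (X s \<omega>)" 1] by (simp add: power_mult_distrib mult_left_mono)
    finally show ?thesis .
  qed
  then show "integrable M (\<lambda>\<omega>. (norm (f s \<omega>))\<^sup>2)"
    by (intro Bochner_Integration.integrable_bound[OF i]) auto
qed measurable

text \<open>The product is bounded by \<open>c\<close> times squared norms of \<open>X\<close> and
  \<open>Y\<close>, linear in \<open>c\<close>. Squaring the drift over the product space would call
  for a square integrable \<open>c\<close>.\<close>

lemma f_inner_integrable:
  assumes Y: "(\<lambda>z. Y (snd z) (fst z)) \<in> borel_measurable (M \<Otimes>\<^sub>M borel)"
    and L: "\<And>s. 0 < s \<Longrightarrow> s \<le> t \<Longrightarrow> L2 M (Y s)"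
    and C: "\<And>s. 0 < s \<Longrightarrow> s \<le> t \<Longrightarrow> expectation (\<lambda>\<omega>. (norm (Y s \<omega>))\<^sup>2) \<le> C"
  shows "integrable (prod_upto t) (\<lambda>z. f (snd z) (fst z) \<bullet> Y (snd z) (fst z))"
proof -
  note [measurable] = Y
  obtain C' where C': "\<And>s. s \<in> {0..t} \<Longrightarrow> expectation (\<lambda>\<omega>. (norm (X s \<omega>))\<^sup>2) \<le> C'"
    using second_moment_bound by blast
  show ?thesis
  proof (rule integrable_prod_uptoI[where d="\<lambda>s. c s * (2 * C' + 2 + C)" and W="\<lambda>s \<omega>. f s \<omega> \<bullet> Y s \<omega>"])
    show "(\<lambda>z. f (snd z) (fst z) \<bullet> Y (snd z) (fst z)) \<in> borel_measurable (M \<Otimes>\<^sub>M borel)" by measurable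
    show "integrable (lborel_upto t) (\<lambda>s. c s * (2 * C' + 2 + C))" using c by simp
    fix s assume s: "0 < s" "s \<le> t"
    have s0: "0 \<le> s" using s by simp
    show i: "integrable M (\<lambda>\<omega>. f s \<omega> \<bullet> Y s \<omega>)" by (intro L2_inner_integrable f_L2 L s s0)
    have Xi: "integrable M (\<lambda>\<omega>. (norm (X s \<omega>))\<^sup>2)" "integrable M (\<lambda>\<omega>. (norm (Y s \<omega>))\<^sup>2)"
      using X_L2[OF s0] L[OF s] by (auto simp: L2_def)
    have "\<bar>f s \<omega> \<bullet> Y s \<omega>\<bar> \<le> c s * (2 * (norm (X s \<omega>))\<^sup>2 + 2 + (norm (Y s \<omega>))\<^sup>2)" for \<omega>
    proof -
      have "\<bar>f s \<omega> \<bullet> Y s \<omega>\<bar> \<le> norm (f s \<omega>) * norm (Y s \<omega>)" by (rule Cauchy_Schwarz_ineq2)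
      also have "\<dots> \<le> (c s * (norm (X s \<omega>) + 1)) * norm (Y s \<omega>)" by (intro mult_right_mono f_bound) simp
      also have "\<dots> = c s * (norm (norm (X s \<omega>) + 1) * norm (Y s \<omega>))" by simp
      also have "\<dots> \<le> c s * ((norm (norm (X s \<omega>) + 1))\<^sup>2 + (norm (Y s \<omega>))\<^sup>2)"
        using norm_mult_le_sum_norm2[of "norm (X s \<omega>) + 1" "norm (Y s \<omega>)"] c(2) by (intro mult_left_mono) auto
      also have "\<dots> \<le> c s * (2 * (norm (X s \<omega>))\<^sup>2 + 2 + (norm (Y s \<omega>))\<^sup>2)"
        using norm_add_power2_le[of "norm (X s \<omega>)" 1] c(2) by (intro mult_left_mono) auto
      finally show ?thesis .
    qed
    then have "expectation (\<lambda>\<omega>. \<bar>f s \<omega> \<bullet> Y s \<omega>\<bar>) \<le> expectation (\<lambda>\<omega>. c s * (2 * (norm (X s \<omega>))\<^sup>2 + 2 + (norm (Y s \<omega>))\<^sup>2))"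
      using i Xi by (intro integral_mono integrable_abs) auto
    also have "\<dots> = c s * (2 * expectation (\<lambda>\<omega>. (norm (X s \<omega>))\<^sup>2) + 2 + expectation (\<lambda>\<omega>. (norm (Y s \<omega>))\<^sup>2))"
      using Xi by (simp add: prob_space)
    also have "\<dots> \<le> c s * (2 * C' + 2 + C)"
      using C'[of s] C[OF s] s c(2) by (intro mult_left_mono) auto
    finally show "expectation (\<lambda>\<omega>. \<bar>f s \<omega> \<bullet> Y s \<omega>\<bar>) \<le> c s * (2 * C' + 2 + C)" .
  qed
qed

text \<open>Ito's formula for the quadratic form of \<open>q\<close>, in expectation. Since \<open>X = D + J\<close> with a
  martingale \<open>J\<close>, it only needs Fubini's theorem for \<open>D\<close> and the isometry for \<open>J\<close>.\<close>

lemma energy_identity: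
  assumes t: "0 \<le> t" and q: "bounded_linear q" and sym: "\<And>v w. v \<bullet> q w = q v \<bullet> w"
  shows "integrable (prod_upto t) (\<lambda>z. f (snd z) (fst z) \<bullet> q (X (snd z) (fst z)))"
    and "expectation (\<lambda>\<omega>. X t \<omega> \<bullet> q (X t \<omega>)) = 2 * (LINT z|prod_upto t. f (snd z) (fst z) \<bullet> q (X (snd z) (fst z)))
      + (\<Sum>i\<in>UNIV. \<Sum>j\<in>UNIV. K $ i $ j * (LINT z|prod_upto t. h i (X (snd z) (fst z)) \<bullet> q (h j (X (snd z) (fst z)))))"
proof -
  interpret q: bounded_linear q by fact
  interpret lborel_upto: finite_measure "lborel_upto t" by simp
  interpret P: pair_sigma_finite M "lborel_upto t" ..
  have qm[measurable]: "q \<in> borel_measurable borel"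
    by (intro borel_measurable_continuous_onI linear_continuous_on q)
  obtain k where k: "\<And>v. norm (q v) \<le> norm v * k" using q.bounded by blast
  have q2: "L2 M (\<lambda>\<omega>. q (Y \<omega>)) \<and> expectation (\<lambda>\<omega>. (norm (q (Y \<omega>)))\<^sup>2) \<le> k\<^sup>2 * C"
    if Y: "L2 M Y" "expectation (\<lambda>\<omega>. (norm (Y \<omega>))\<^sup>2) \<le> C" for Y C
  proof
    show L: "L2 M (\<lambda>\<omega>. q (Y \<omega>))" by (rule L2_linear[OF Y(1) q])
    have "(norm (q v))\<^sup>2 \<le> k\<^sup>2 * (norm v)\<^sup>2" for v
      using power_mono[OF k norm_ge_zero, of v 2] by (simp add: power_mult_distrib mult.commute)
    then have "expectation (\<lambda>\<omega>. (norm (q (Y \<omega>)))\<^sup>2) \<le> expectation (\<lambda>\<omega>. k\<^sup>2 * (norm (Y \<omega>))\<^sup>2)"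
      using L Y(1) by (intro integral_mono) (auto simp: L2_def)
    also have "\<dots> \<le> k\<^sup>2 * C" using Y(2) by (simp add: mult_left_mono)
    finally show "expectation (\<lambda>\<omega>. (norm (q (Y \<omega>)))\<^sup>2) \<le> k\<^sup>2 * C" .
  qed
  obtain C1 where C1: "\<And>s. s \<in> {0..t} \<Longrightarrow> expectation (\<lambda>\<omega>. (norm (X s \<omega>))\<^sup>2) \<le> C1"
    using second_moment_bound by blast
  obtain C2 where C2: "\<And>s. s \<in> {0..t} \<Longrightarrow> expectation (\<lambda>\<omega>. (norm (J s \<omega>))\<^sup>2) \<le> C2"
    using J_second_moment_bound by blast
  have intX: "integrable (prod_upto t) (\<lambda>z. f (snd z) (fst z) \<bullet> q (X (snd z) (fst z)))"
    using q2[OF X_L2 C1] by (intro f_inner_integrable[where Y="\<lambda>s \<omega>. q (X s \<omega>)" and C="k\<^sup>2 * C1"]) auto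
  have intJ: "integrable (prod_upto t) (\<lambda>z. f (snd z) (fst z) \<bullet> q (J (snd z) (fst z)))"
    using q2[OF J_L2 C2] by (intro f_inner_integrable[where Y="\<lambda>s \<omega>. q (J s \<omega>)" and C="k\<^sup>2 * C2"]) auto
  \<comment> \<open>With \<open>J\<close> frozen at the final time: this is the integrand for Fubini
    before the martingale property moves \<open>J\<close> back to time \<open>s\<close>.\<close>
  have intJt: "integrable (prod_upto t) (\<lambda>z. f (snd z) (fst z) \<bullet> q (J t (fst z)))"
    using q2[OF J_L2[OF t] C2[of t]] t
    by (intro f_inner_integrable[where Y="\<lambda>s \<omega>. q (J t \<omega>)" and C="k\<^sup>2 * C2"]) auto
  have fD: "f s \<omega> \<bullet> q (D s \<omega>) = f s \<omega> \<bullet> q (X s \<omega>) - f s \<omega> \<bullet> q (J s \<omega>)" for s \<omega>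
    by (simp add: J_def q.diff inner_diff_right)
  have intD: "integrable (prod_upto t) (\<lambda>z. f (snd z) (fst z) \<bullet> q (D (snd z) (fst z)))"
    unfolding fD by (intro Bochner_Integration.integrable_diff intX intJ)
  show "integrable (prod_upto t) (\<lambda>z. f (snd z) (fst z) \<bullet> q (X (snd z) (fst z)))" by fact
  have DD: "expectation (\<lambda>\<omega>. D t \<omega> \<bullet> q (D t \<omega>)) = 2 * (LINT z|prod_upto t. f (snd z) (fst z) \<bullet> q (D (snd z) (fst z)))"
  proof -
    have "expectation (\<lambda>\<omega>. D t \<omega> \<bullet> q (D t \<omega>)) = expectation (\<lambda>\<omega>. 2 * (LINT s|lborel_upto t. f s \<omega> \<bullet> q (D s \<omega>)))"
      unfolding D_def by (intro Bochner_Integration.integral_cong refl integral_quadratic_indefinite f_integrable q sym)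
    also have "\<dots> = 2 * (LINT z|prod_upto t. f (snd z) (fst z) \<bullet> q (D (snd z) (fst z)))"
      using P.integral_fst'[OF intD] by simp
    finally show ?thesis .
  qed
  have DJ: "expectation (\<lambda>\<omega>. D t \<omega> \<bullet> q (J t \<omega>)) = (LINT z|prod_upto t. f (snd z) (fst z) \<bullet> q (J (snd z) (fst z)))"
  proof -
    have "expectation (\<lambda>\<omega>. D t \<omega> \<bullet> q (J t \<omega>)) = expectation (\<lambda>\<omega>. LINT s|lborel_upto t. f s \<omega> \<bullet> q (J t \<omega>))"
      unfolding D_def by (intro Bochner_Integration.integral_cong refl integral_inner_left[symmetric] f_integrable)
    also have "\<dots> = (LINT z|prod_upto t. f (snd z) (fst z) \<bullet> q (J t (fst z)))"
      using P.integral_fst'[OF intJt] by simp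
    also have "\<dots> = (LINT s|lborel_upto t. expectation (\<lambda>\<omega>. f s \<omega> \<bullet> q (J t \<omega>)))"
      using P.integral_snd[of "\<lambda>\<omega> s. f s \<omega> \<bullet> q (J t \<omega>)"] intJt by (simp add: split_beta')
    also have "\<dots> = (LINT s|lborel_upto t. expectation (\<lambda>\<omega>. f s \<omega> \<bullet> q (J s \<omega>)))"
    proof (rule integral_cong_AE)
      \<comment> \<open>Symmetry moves \<open>q\<close> onto the drift, so that the test function
        \<open>q (f s)\<close> is measurable at time \<open>s\<close>.\<close>
      have "expectation (\<lambda>\<omega>. f s \<omega> \<bullet> q (J t \<omega>)) = expectation (\<lambda>\<omega>. f s \<omega> \<bullet> q (J s \<omega>))" if s: "0 < s" "s \<le> t" for s
        unfolding sym using s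
        by (intro J_martingale measurable_compose[OF f_adapted qm] L2_linear[OF f_L2 q]) auto
      then show "AE s in lborel_upto t. expectation (\<lambda>\<omega>. f s \<omega> \<bullet> q (J t \<omega>)) = expectation (\<lambda>\<omega>. f s \<omega> \<bullet> q (J s \<omega>))"
        by (simp add: AE_upto)
    qed measurable
    also have "\<dots> = (LINT z|prod_upto t. f (snd z) (fst z) \<bullet> q (J (snd z) (fst z)))"
      using P.integral_snd[of "\<lambda>\<omega> s. f s \<omega> \<bullet> q (J s \<omega>)"] intJ by (simp add: split_beta')
    finally show ?thesis .
  qed
  \<comment> \<open>The two mixed terms coincide by symmetry. The resulting factor 2 matches the one
    in \<open>DD\<close>, so that \<open>D\<close> and \<open>J\<close> recombine to
    \<open>X\<close> inside the time integral.\<close>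
  have eq: "X t \<omega> \<bullet> q (X t \<omega>) = D t \<omega> \<bullet> q (D t \<omega>) + 2 * (D t \<omega> \<bullet> q (J t \<omega>)) + J t \<omega> \<bullet> q (J t \<omega>)" for \<omega>
  proof -
    have "X t \<omega> = D t \<omega> + J t \<omega>" by (simp add: J_def)
    moreover have "J t \<omega> \<bullet> q (D t \<omega>) = D t \<omega> \<bullet> q (J t \<omega>)"
      using sym[of "J t \<omega>" "D t \<omega>"] by (simp only: inner_commute)
    ultimately show ?thesis by (simp add: q.add inner_add_left inner_add_right)
  qed
  note I = L2_inner_integrable[OF D_L2[OF t] L2_linear[OF D_L2[OF t] q]]
    L2_inner_integrable[OF D_L2[OF t] L2_linear[OF J_L2[OF t] q]]
    L2_inner_integrable[OF J_L2[OF t] L2_linear[OF J_L2[OF t] q]]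
  have "expectation (\<lambda>\<omega>. X t \<omega> \<bullet> q (X t \<omega>)) = expectation (\<lambda>\<omega>. D t \<omega> \<bullet> q (D t \<omega>))
      + 2 * expectation (\<lambda>\<omega>. D t \<omega> \<bullet> q (J t \<omega>)) + expectation (\<lambda>\<omega>. J t \<omega> \<bullet> q (J t \<omega>))"
    unfolding eq using I by simp
  also have "\<dots> = 2 * ((LINT z|prod_upto t. f (snd z) (fst z) \<bullet> q (D (snd z) (fst z))) + (LINT z|prod_upto t. f (snd z) (fst z) \<bullet> q (J (snd z) (fst z))))
      + (\<Sum>i\<in>UNIV. \<Sum>j\<in>UNIV. K $ i $ j * (LINT z|prod_upto t. h i (X (snd z) (fst z)) \<bullet> q (h j (X (snd z) (fst z)))))"
    unfolding DD DJ J_isometry[OF t q] by simp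
  also have "(LINT z|prod_upto t. f (snd z) (fst z) \<bullet> q (D (snd z) (fst z))) + (LINT z|prod_upto t. f (snd z) (fst z) \<bullet> q (J (snd z) (fst z)))
     = (LINT z|prod_upto t. f (snd z) (fst z) \<bullet> q (X (snd z) (fst z)))"
    unfolding fD using intX intJ by simp
  finally show "expectation (\<lambda>\<omega>. X t \<omega> \<bullet> q (X t \<omega>)) = 2 * (LINT z|prod_upto t. f (snd z) (fst z) \<bullet> q (X (snd z) (fst z)))
      + (\<Sum>i\<in>UNIV. \<Sum>j\<in>UNIV. K $ i $ j * (LINT z|prod_upto t. h i (X (snd z) (fst z)) \<bullet> q (h j (X (snd z) (fst z)))))" .
qed

end

section \<open>Dissipation inequality for the Gramian\<close>

lemma matrix_sum_vector_mult: "(\<Sum>k\<in>S. Y k) *v v = (\<Sum>k\<in>S. Y k *v (v :: real^'n))"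
  by (induction S rule: infinite_finite_induct) (auto simp: matrix_vector_mult_add_rdistrib)

lemma minus_matrix_vector_mult: "(- Y) *v v = - (Y *v (v :: real^'n))"
  using matrix_vector_mult_diff_rdistrib[of 0 Y v] by simp

text \<open>Definiteness makes \<open>P\<close> injective, hence invertible. Symmetry and
  nonnegativity of the inverse are those of \<open>P\<close> at the vectors \<open>R *v v\<close>
  and \<open>R *v w\<close>.\<close>

lemma spd_matrix_inv:
  fixes P :: "real^'n^'n"
  assumes P: "spd_matrix P"
  defines "R \<equiv> matrix_inv P"
  shows "P *v (R *v v) = v" "v \<bullet> (R *v w) = (R *v v) \<bullet> w" "0 \<le> v \<bullet> (R *v v)"
proof -
  have "\<forall>v. P *v v = 0 \<longrightarrow> v = 0"
    using P unfolding spd_matrix_def by (metis inner_zero_right less_irrefl)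
  then have "invertible P"
    using invertible_left_inverse matrix_left_invertible_ker by blast
  then have "P ** R = mat 1 \<and> R ** P = mat 1"
    unfolding invertible_def R_def matrix_inv_def by (rule someI_ex)
  then show PR: "P *v (R *v v) = v" for v by (simp add: matrix_vector_mul_assoc)
  have sym: "a \<bullet> (P *v b) = (P *v a) \<bullet> b" for a b
    using P dot_lmul_matrix[of a P b] transpose_matrix_vector[of P a]
    by (simp add: spd_matrix_def symmetric_matrix_def)
  show "v \<bullet> (R *v w) = (R *v v) \<bullet> w"
    using sym[of "R *v v" "R *v w"] by (simp add: PR)
  have "0 \<le> (R *v v) \<bullet> (P *v (R *v v))"
    using P by (cases "R *v v = 0") (auto simp: spd_matrix_def less_imp_le)
  then show "0 \<le> v \<bullet> (R *v v)" by (simp only: PR inner_commute)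
qed

text \<open>In terms of the preimage \<open>y\<close> of \<open>v\<close> under \<open>P\<close>,
  the form of the inverse is \<open>y \<bullet> v\<close>, and the component of \<open>v\<close>
  along \<open>p\<close> is \<open>l\<close> times that of \<open>y\<close>. Nonnegativity of the
  form of \<open>P\<close> then gives the bound.\<close>

lemma eigenvector_inner_le:
  fixes P :: "real^'n^'n"
  assumes P: "spd_matrix P" and e: "P *v p = l *\<^sub>R p" and p: "p \<bullet> p = 1"
  shows "0 \<le> l" "(v \<bullet> p)\<^sup>2 \<le> l * (v \<bullet> (matrix_inv P *v v))"
proof -
  note R = spd_matrix_inv[OF P]
  have psd: "0 \<le> v \<bullet> (P *v v)" for v
    using P by (cases "v = 0") (auto simp: spd_matrix_def less_imp_le)
  show l: "0 \<le> l" using psd[of p] by (simp add: e p)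
  define y where "y = matrix_inv P *v v"
  have Py: "P *v y = v" unfolding y_def by (rule R)
  have Pyp: "v \<bullet> p = l * (y \<bullet> p)"
    using P dot_lmul_matrix[of y P p] transpose_matrix_vector[of P y]
    by (simp add: spd_matrix_def symmetric_matrix_def e Py)
  \<comment> \<open>This coefficient minimizes the form of \<open>P\<close> along
    \<open>y - a *\<^sub>R p\<close>; the minimum is
    \<open>y \<bullet> v - l * a\<^sup>2\<close>.\<close>
  define a where "a = y \<bullet> p"
  have "0 \<le> (y - a *\<^sub>R p) \<bullet> (P *v (y - a *\<^sub>R p))" by (rule psd)
  also have "\<dots> = y \<bullet> v - l * a\<^sup>2"
  proof -
    have "y \<bullet> p = a" "p \<bullet> v = l * a" using Pyp by (simp_all add: a_def inner_commute[of p v])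
    then show ?thesis
      by (simp add: matrix_vector_mult_diff_distrib matrix_vector_mult_scaleR e Py
          inner_diff_left inner_diff_right p power2_eq_square)
  qed
  finally have "l * (l * a\<^sup>2) \<le> l * (y \<bullet> v)" using l by (intro mult_left_mono) auto
  then show "(v \<bullet> p)\<^sup>2 \<le> l * (v \<bullet> (matrix_inv P *v v))"
    by (simp add: Pyp flip: a_def y_def) (simp add: power2_eq_square inner_commute[of v y] mult_ac)
qed

text \<open>The Gramian inequality, tested with \<open>x\<close>, leaves the negative square of
  \<open>transpose B *v (R *v x)\<close>. It pays for the control term after completing the square,
  and the terms in \<open>N\<close> pay for the bilinear drift; the remainder is the squared control
  times the energy plus one.\<close>

lemma gramian_dissipation:
  fixes P A :: "real^'n^'n" and B :: "real^'m^'n" and N :: "'m \<Rightarrow> real^'n^'n"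
    and H :: "'v::finite \<Rightarrow> real^'n^'n" and w :: "real^'m"
  assumes gram: "reachability_gramian A B N H K P"
  defines "R \<equiv> matrix_inv P"
  shows "2 * ((A *v x + B *v w + (\<Sum>k\<in>UNIV. w $ k *\<^sub>R (N k *v x))) \<bullet> (R *v x))
      + (\<Sum>i\<in>UNIV. \<Sum>j\<in>UNIV. K $ i $ j * ((H i *v x) \<bullet> (R *v (H j *v x))))
    \<le> (norm w)\<^sup>2 * (x \<bullet> (R *v x) + 1)"
proof -
  have P: "spd_matrix P" using gram by (simp add: reachability_gramian_def)
  note Rsym = spd_matrix_inv(2)[OF P, folded R_def] and Rpsd = spd_matrix_inv(3)[OF P, folded R_def]
  let ?S = "transpose A ** R + R ** A + (\<Sum>k\<in>UNIV. transpose (N k) ** R ** N k)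
         + (\<Sum>i\<in>UNIV. \<Sum>j\<in>UNIV. K $ i $ j *\<^sub>R (transpose (H i) ** R ** H j))"
  let ?b = "transpose B *v (R *v x)"
  have tr: "x \<bullet> (transpose Y *v z) = (Y *v x) \<bullet> z" for Y :: "real^'k^'l" and x z
    using dot_lmul_matrix[of z Y x] by (simp add: inner_commute)
  have "0 \<le> x \<bullet> ((- (R ** B ** transpose B ** R) - ?S) *v x)"
    using gram by (simp add: reachability_gramian_def loewner_le_def psd_matrix_def R_def)
  also have "\<dots> = - (x \<bullet> (R *v (B *v ?b))) - x \<bullet> (?S *v x)"
    by (simp add: matrix_vector_mult_diff_rdistrib minus_matrix_vector_mult inner_diff_right
        matrix_vector_mul_assoc[symmetric] del: transpose_matrix_vector)
  also have "x \<bullet> (R *v (B *v ?b)) = (norm ?b)\<^sup>2"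
  proof -
    have "x \<bullet> (R *v (B *v ?b)) = (R *v x) \<bullet> (B *v ?b)" by (rule Rsym)
    also have "\<dots> = ?b \<bullet> ?b" using dot_lmul_matrix[of "R *v x" B ?b] by simp
    finally show ?thesis by (simp add: power2_norm_eq_inner)
  qed
  also have "x \<bullet> (?S *v x) = 2 * ((A *v x) \<bullet> (R *v x)) + (\<Sum>k\<in>UNIV. (N k *v x) \<bullet> (R *v (N k *v x)))
      + (\<Sum>i\<in>UNIV. \<Sum>j\<in>UNIV. K $ i $ j * ((H i *v x) \<bullet> (R *v (H j *v x))))"
  proof -
    have "x \<bullet> (R *v (A *v x)) = (A *v x) \<bullet> (R *v x)" using Rsym[of x "A *v x"] by (simp add: inner_commute)
    then show ?thesis
      by (simp add: matrix_vector_mult_add_rdistrib matrix_sum_vector_mult inner_add_right inner_sum_right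
        matrix_vector_mul_assoc[symmetric] scaleR_matrix_vector_assoc[symmetric] tr del: transpose_matrix_vector)
  qed
  finally have g: "2 * ((A *v x) \<bullet> (R *v x)) + (\<Sum>k\<in>UNIV. (N k *v x) \<bullet> (R *v (N k *v x)))
      + (\<Sum>i\<in>UNIV. \<Sum>j\<in>UNIV. K $ i $ j * ((H i *v x) \<bullet> (R *v (H j *v x)))) \<le> - (norm ?b)\<^sup>2" by simp
  have b: "2 * ((B *v w) \<bullet> (R *v x)) \<le> (norm w)\<^sup>2 + (norm ?b)\<^sup>2"
  proof -
    have "(B *v w) \<bullet> (R *v x) = w \<bullet> ?b" using tr[of w B "R *v x"] by simp
    moreover have "0 \<le> (w - ?b) \<bullet> (w - ?b)" by simp
    ultimately show ?thesis
      by (simp add: power2_norm_eq_inner inner_diff_left inner_diff_right inner_commute)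
  qed
  \<comment> \<open>The form of \<open>R\<close> is nonnegative at the difference of
    \<open>N k *v x\<close> and \<open>w $ k *\<^sub>R x\<close>; expanding gives the claim.\<close>
  have n: "2 * (w $ k * ((N k *v x) \<bullet> (R *v x))) \<le> (N k *v x) \<bullet> (R *v (N k *v x)) + (w $ k)\<^sup>2 * (x \<bullet> (R *v x))" for k
  proof -
    have "0 \<le> (N k *v x - w $ k *\<^sub>R x) \<bullet> (R *v (N k *v x - w $ k *\<^sub>R x))" by (rule Rpsd)
    moreover have "x \<bullet> (R *v (N k *v x)) = (N k *v x) \<bullet> (R *v x)"
      using Rsym[of x "N k *v x"] by (simp add: inner_commute)
    ultimately show ?thesis
      by (simp add: matrix_vector_mult_diff_distrib matrix_vector_mult_scaleR inner_diff_left inner_diff_right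
          power2_eq_square algebra_simps)
  qed
  have "(\<Sum>k\<in>UNIV. 2 * (w $ k * ((N k *v x) \<bullet> (R *v x))))
      \<le> (\<Sum>k\<in>UNIV. (N k *v x) \<bullet> (R *v (N k *v x)) + (w $ k)\<^sup>2 * (x \<bullet> (R *v x)))"
    by (rule sum_mono) (rule n)
  also have "\<dots> = (\<Sum>k\<in>UNIV. (N k *v x) \<bullet> (R *v (N k *v x))) + (norm w)\<^sup>2 * (x \<bullet> (R *v x))"
    by (simp add: sum.distrib sum_distrib_right[symmetric] norm_vec_def L2_set_def sum_nonneg)
  finally have "2 * (\<Sum>k\<in>UNIV. w $ k * ((N k *v x) \<bullet> (R *v x)))
      \<le> (\<Sum>k\<in>UNIV. (N k *v x) \<bullet> (R *v (N k *v x))) + (norm w)\<^sup>2 * (x \<bullet> (R *v x))"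
    by (simp add: sum_distrib_left)
  with g b show ?thesis
    by (simp add: inner_add_left inner_sum_left algebra_simps)
qed


section \<open>The bilinear system\<close>

text \<open>Provides a Borel version of the control, coordinate by coordinate, as joint
  measurability with the sample point is stated for Borel sets of times.\<close>

lemma lebesgue_measurable_AE_eq_borel:
  fixes f :: "real \<Rightarrow> 'b::euclidean_space"
  assumes f: "f \<in> borel_measurable lebesgue"
  shows "\<exists>g\<in>borel_measurable borel. AE s in lborel. f s = g s"
proof -
  have "\<exists>g\<in>borel_measurable lborel. AE s in lborel. f s \<bullet> b = g s" for b
    using f by (intro completion_ex_borel_measurable_real) auto
  then obtain g where g: "\<And>b. g b \<in> borel_measurable borel" "\<And>b. AE s in lborel. f s \<bullet> b = g b s"
    by (metis measurable_lborel2)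
  have "AE s in lborel. \<forall>b\<in>Basis. f s \<bullet> b = g b s"
    using g(2) by (intro AE_finite_allI) auto
  then have "AE s in lborel. f s = (\<Sum>b\<in>Basis. g b s *\<^sub>R b)"
  proof eventually_elim
    case (elim s)
    have "f s = (\<Sum>b\<in>Basis. (f s \<bullet> b) *\<^sub>R b)" by (simp add: euclidean_representation)
    also have "\<dots> = (\<Sum>b\<in>Basis. g b s *\<^sub>R b)" using elim by (intro sum.cong) auto
    finally show ?case .
  qed
  moreover have "(\<lambda>s. \<Sum>b\<in>Basis. g b s *\<^sub>R b) \<in> borel_measurable borel"
    by (rule borel_measurable_sum) (rule borel_measurable_scaleR[OF g(1) borel_measurable_const])
  ultimately show ?thesis by (rule bexI)
qed

text \<open>Completion does not change integrals of Borel functions, and dropping the point 0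
  removes a null set.\<close>

lemma set_integral_lebesgue_eq_upto:
  fixes f g :: "real \<Rightarrow> 'b::euclidean_space"
  assumes g[measurable]: "g \<in> borel_measurable borel" and ae: "AE s in lborel. 0 \<le> s \<longrightarrow> f s = g s"
  shows "(LINT s:{0..t}|lebesgue. f s) = (LINT s|lborel_upto t. g s)"
proof -
  let ?g = "\<lambda>s. indicator {0<..t} s *\<^sub>R g s"
  have gm: "?g \<in> borel_measurable lborel" by simp
  have "AE s in lborel. ?g s = indicator {0..t} s *\<^sub>R f s"
    using ae AE_lborel_singleton[of 0] by eventually_elim (auto simp: indicator_def)
  then have ae': "AE s in lebesgue. ?g s = indicator {0..t} s *\<^sub>R f s" by (rule AE_completion)
  have m: "?g \<in> borel_measurable lebesgue" using gm by (rule measurable_completion)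
  have "(LINT s:{0..t}|lebesgue. f s) = (LINT s|lebesgue. ?g s)"
    unfolding set_lebesgue_integral_def
    using ae' by (intro integral_cong_AE borel_measurable_AE[OF m ae'] m) (auto elim: eventually_mono)
  also have "\<dots> = (LINT s|lborel_upto t. g s)"
    using integral_completion[OF gm] by (simp add: integral_upto)
  finally show ?thesis .
qed

lemma measurable_matrix_vector_mult[measurable (raw)]:
  fixes Y :: "real^'n^'k"
  assumes "g \<in> borel_measurable N" shows "(\<lambda>w. Y *v g w) \<in> borel_measurable N"
  by (rule measurable_compose[OF assms borel_measurable_continuous_onI])
     (intro linear_continuous_on matrix_vector_mul_bounded_linear)

lemma measurable_vec_component[measurable (raw)]:
  fixes g :: "'a \<Rightarrow> real^'n"
  assumes "g \<in> borel_measurable N" shows "(\<lambda>w. g w $ k) \<in> borel_measurable N"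
  by (rule measurable_compose[OF assms borel_measurable_continuous_onI]) (intro continuous_intros)

lemma norm_bilinear_drift_le:
  fixes A :: "real^'n^'n" and B :: "real^'m^'n" and N :: "'m \<Rightarrow> real^'n^'n"
  shows "norm (A *v x + B *v w + (\<Sum>k\<in>UNIV. w $ k *\<^sub>R (N k *v x)))
    \<le> (onorm ((*v) A) + onorm ((*v) B) + (\<Sum>k\<in>UNIV. onorm ((*v) (N k)))) * (1 + norm w) * (norm x + 1)"
proof -
  have pos: "0 \<le> onorm ((*v) Y)" for Y :: "real^'k^'l"
    by (intro onorm_pos_le matrix_vector_mul_bounded_linear)
  have le: "norm (Y *v x) \<le> onorm ((*v) Y) * norm x" for Y :: "real^'k^'l" and x
    by (intro onorm matrix_vector_mul_bounded_linear)
  let ?r = "(1 + norm w) * (norm x + 1)"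
  \<comment> \<open>One product dominates the three magnitudes in the drift: state, control and
    state times control.\<close>
  have r: "norm x \<le> ?r" "norm w \<le> ?r" "norm w * norm x \<le> ?r" by (auto simp: algebra_simps add_nonneg_nonneg)
  have "norm (A *v x) \<le> onorm ((*v) A) * ?r"
    using le[of A x] mult_left_mono[OF r(1) pos[of A]] by linarith
  moreover have "norm (B *v w) \<le> onorm ((*v) B) * ?r"
    using le[of B w] mult_left_mono[OF r(2) pos[of B]] by linarith
  moreover have "norm (\<Sum>k\<in>UNIV. w $ k *\<^sub>R (N k *v x)) \<le> (\<Sum>k\<in>UNIV. onorm ((*v) (N k))) * ?r"
    unfolding sum_distrib_right
  proof (rule sum_norm_le)
    fix k
    have "norm (w $ k *\<^sub>R (N k *v x)) \<le> norm w * (onorm ((*v) (N k)) * norm x)"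
      unfolding norm_scaleR using component_le_norm_cart[of w k] le by (intro mult_mono) auto
    also have "\<dots> = onorm ((*v) (N k)) * (norm w * norm x)" by simp
    also have "\<dots> \<le> onorm ((*v) (N k)) * ?r" by (rule mult_left_mono[OF r(3) pos])
    finally show "norm (w $ k *\<^sub>R (N k *v x)) \<le> onorm ((*v) (N k)) * ?r" .
  qed
  ultimately show ?thesis
    using norm_triangle_ineq[of "A *v x + B *v w" "\<Sum>k\<in>UNIV. w $ k *\<^sub>R (N k *v x)"]
      norm_triangle_ineq[of "A *v x" "B *v w"]
    by (simp add: distrib_right mult.assoc)
qed

text \<open>The energy identity with the form of the inverse Gramian, combined with the dissipation
  inequality at every time and sample point, gives an integral inequality for the expected energy;
  Gronwall then applies with rate \<open>(norm (u' r))\<^sup>2\<close>.\<close>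

lemma bilinear_energy_bound:
  fixes M :: "'a measure" and L :: "real \<Rightarrow> 'a \<Rightarrow> real^'v" and A P :: "real^'n^'n" and B :: "real^'m^'n"
    and u :: "real \<Rightarrow> real^'m"
  assumes filtered: "filtered_prob_space M F" and levy: "centered_L2_levy_process M F L K"
    and gram: "reachability_gramian A B N H K P"
    and u: "admissible_control u" and sol: "bilinear_sde_solution M F L A B N H 0 u x"
    and t: "t \<in> {0..T}"
  shows "L2 M (x t)"
    and "(LINT \<omega>|M. x t \<omega> \<bullet> (matrix_inv P *v x t \<omega>)) \<le> (L2_norm_upto T u)\<^sup>2 * exp ((L2_norm_upto T u)\<^sup>2)"
proof -
  interpret levy_driver M F L K by standard fact+
  define R where "R = matrix_inv P"
  have P: "spd_matrix P" using gram by (simp add: reachability_gramian_def)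
  have um: "(\<lambda>t. indicator {0..} t *\<^sub>R u t) \<in> borel_measurable lebesgue"
    using u by (simp add: admissible_control_def set_borel_measurable_def)
  obtain u' where u'[measurable]: "u' \<in> borel_measurable borel"
    and "AE s in lborel. indicator {0..} s *\<^sub>R u s = u' s"
    using lebesgue_measurable_AE_eq_borel[OF um] by blast
  then have uu: "AE s in lborel. 0 \<le> s \<longrightarrow> u s = u' s" by (auto elim!: eventually_mono)
  have u2: "integrable (lborel_upto s) (\<lambda>r. (norm (u' r))\<^sup>2)" for s
  proof -
    \<comment> \<open>Admissibility speaks of positive horizons only; the maximum covers every real
      \<open>s\<close>.\<close>
    define s' where "s' = max 1 s"
    have "set_integrable lebesgue {0..s'} (\<lambda>t. (norm (u t))\<^sup>2)"
      using u by (simp add: admissible_control_def s'_def)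
    then have i: "integrable lebesgue (\<lambda>r. indicator {0..s'} r *\<^sub>R (norm (u r))\<^sup>2)"
      by (simp add: set_integrable_def)
    let ?g = "\<lambda>r. indicator {0<..s'} r *\<^sub>R (norm (u' r))\<^sup>2"
    have gm: "?g \<in> borel_measurable lborel" by simp
    have "AE r in lborel. indicator {0..s'} r *\<^sub>R (norm (u r))\<^sup>2 = ?g r"
      using uu AE_lborel_singleton[of 0] by eventually_elim (auto simp: indicator_def)
    then have ae: "AE r in lebesgue. indicator {0..s'} r *\<^sub>R (norm (u r))\<^sup>2 = ?g r" by (rule AE_completion)
    have "integrable lebesgue ?g"
      using integrable_cong_AE[OF borel_measurable_integrable[OF i] measurable_completion[OF gm] ae] i by simp
    then have "integrable (lborel_upto s') (\<lambda>r. (norm (u' r))\<^sup>2)"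
      using integrable_completion[OF gm] by (simp add: integrable_upto)
    then show ?thesis by (rule integrable_upto_mono) (simp add: s'_def)
  qed
  have U: "(L2_norm_upto T u)\<^sup>2 = (LINT r|lborel_upto T. (norm (u' r))\<^sup>2)"
  proof -
    have "(LINT r:{0..T}|lebesgue. (norm (u r))\<^sup>2) = (LINT r|lborel_upto T. (norm (u' r))\<^sup>2)"
      using uu by (intro set_integral_lebesgue_eq_upto) (auto elim!: eventually_mono)
    then show ?thesis by (simp add: L2_norm_upto_def)
  qed
  \<comment> \<open>Freezing the process at negative times makes it right continuous on the whole
    line, as the joint measurability lemma demands.\<close>
  define X where "X s \<omega> = x (max 0 s) \<omega>" for s \<omega>
  have Xx: "0 \<le> s \<Longrightarrow> X s = x s" for s by (simp add: X_def fun_eq_iff)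
  have xF: "0 \<le> s \<Longrightarrow> x s \<in> borel_measurable (F s)" for s
    using sol by (simp add: bilinear_sde_solution_def)
  have cl: "\<omega> \<in> space M \<Longrightarrow> cadlag (\<lambda>s. x s \<omega>)" for \<omega>
    using sol by (simp add: bilinear_sde_solution_def)
  have X_joint: "(\<lambda>z. X (snd z) (fst z)) \<in> borel_measurable (M \<Otimes>\<^sub>M borel)"
  proof -
    have "(\<lambda>(s, \<omega>). X s \<omega>) \<in> borel_measurable (borel \<Otimes>\<^sub>M M)"
    proof (rule right_continuous_joint_measurable)
      show "X s \<in> borel_measurable M" for s
        using measurable_F_M[OF xF[of "max 0 s"]] by (simp add: X_def[abs_def])
      fix \<omega> s assume w: "\<omega> \<in> space M"
      show "((\<lambda>r. X r \<omega>) \<longlongrightarrow> X s \<omega>) (at_right s)"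
      proof (cases "0 \<le> s")
        case True
        then have "((\<lambda>r. x r \<omega>) \<longlongrightarrow> x s \<omega>) (at_right s)" using cl[OF w] by (simp add: cadlag_def)
        moreover have "\<forall>\<^sub>F r in at_right s. x r \<omega> = X r \<omega>"
          using eventually_at_right_less[of s] by eventually_elim (use True in \<open>simp add: X_def\<close>)
        ultimately show ?thesis using True by (simp add: Xx Lim_transform_eventually)
      next
        case False
        then have "\<forall>\<^sub>F r in at_right s. r < 0"
          by (auto simp: eventually_at_right_field intro!: exI[of _ 0])
        then have "\<forall>\<^sub>F r in at_right s. x 0 \<omega> = X r \<omega>"
          by eventually_elim (simp add: X_def)
        moreover have "X s \<omega> = x 0 \<omega>" using False by (simp add: X_def)
        ultimately show ?thesis using Lim_transform_eventually[OF tendsto_const] by simp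
      qed
    qed
    from measurable_compose[OF _ this, of "\<lambda>z. (snd z, fst z)" "M \<Otimes>\<^sub>M borel"] show ?thesis by simp
  qed
  note [measurable] = X_joint
  define f where "f s \<omega> = A *v X s \<omega> + B *v u' s + (\<Sum>k\<in>UNIV. u' s $ k *\<^sub>R (N k *v X s \<omega>))" for s \<omega>
  have f_joint: "(\<lambda>z. f (snd z) (fst z)) \<in> borel_measurable (M \<Otimes>\<^sub>M borel)"
    unfolding f_def by measurable
  \<comment> \<open>Integrable over bounded intervals because a square integrable control is
    integrable there.\<close>
  define c where "c s = (onorm ((*v) A) + onorm ((*v) B) + (\<Sum>k\<in>UNIV. onorm ((*v) (N k)))) * (1 + norm (u' s))" for s
  interpret linear_noise_process M F L K X f c "\<lambda>i. (*v) (H i)"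
  proof (rule linear_noise_process.intro[OF levy_driver_axioms], rule linear_noise_process_axioms.intro)
    show "(\<lambda>z. X (snd z) (fst z)) \<in> borel_measurable (M \<Otimes>\<^sub>M borel)" by fact
    show "(\<lambda>z. f (snd z) (fst z)) \<in> borel_measurable (M \<Otimes>\<^sub>M borel)" by fact
    show "f s \<in> borel_measurable (F s)" if "0 \<le> s" for s
    proof -
      have [measurable]: "X s \<in> borel_measurable (F s)" using xF[OF that] by (simp add: Xx that)
      show ?thesis unfolding f_def[abs_def] by measurable
    qed
    show "bounded ((\<lambda>s. X s \<omega>) ` {0..t})" if "\<omega> \<in> space M" for \<omega> t
      using cadlag_bounded[OF cl[OF that], of t] by (auto simp: Xx cong: image_cong_simp)
    show "integrable (lborel_upto s) c" for s
    proof -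
      have "L2 (lborel_upto s) u'" using u2[of s] by (simp add: L2_def)
      then have "integrable (lborel_upto s) u'" by (intro L2_imp_integrable) simp
      moreover have "integrable (lborel_upto s) (\<lambda>r. 1::real)"
        by (rule finite_measure.integrable_const[OF finite_measure_upto])
      ultimately show ?thesis unfolding c_def[abs_def] by simp
    qed
    show "0 \<le> c s" for s
      unfolding c_def by (intro mult_nonneg_nonneg add_nonneg_nonneg sum_nonneg onorm_pos_le
          matrix_vector_mul_bounded_linear) auto
    show "norm (f s \<omega>) \<le> c s * (norm (X s \<omega>) + 1)" for s \<omega>
      unfolding f_def c_def by (rule norm_bilinear_drift_le)
    show "bounded_linear ((*v) (H i))" for i by (rule matrix_vector_mul_bounded_linear)
    fix t :: real assume t: "0 \<le> t"
    obtain I where I: "\<And>i. has_ito_integral M F (\<lambda>s \<omega>. L s \<omega> $ i)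
               (\<lambda>s \<omega>. H i *v left_limit (\<lambda>r. x r \<omega>) s) t (I i)"
      and ae: "AE \<omega> in M. x t \<omega> = 0 + (LINT s:{0..t}|lebesgue.
                A *v x s \<omega> + B *v u s + (\<Sum>k\<in>UNIV. u s $ k *\<^sub>R (N k *v x s \<omega>)))
           + (\<Sum>i\<in>UNIV. I i \<omega>)"
      using sol t unfolding bilinear_sde_solution_def by blast
    have "ito i (\<lambda>z. H i *v X (snd z) (fst z)) t (I i)" for i
    proof (rule has_ito_integral_imp_ito[where \<psi>="\<lambda>s \<omega>. H i *v X s \<omega>", OF I t])
      fix \<omega> assume w: "\<omega> \<in> space M"
      show "AE s in lborel_upto t. H i *v left_limit (\<lambda>r. x r \<omega>) s = H i *v X s \<omega>"
        unfolding AE_upto using cadlag_left_limit_AE[OF cl[OF w]]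
        by eventually_elim (auto simp: Xx)
    qed measurable
    moreover have "AE \<omega> in M. X t \<omega> = (LINT s|lborel_upto t. f s \<omega>) + (\<Sum>i\<in>UNIV. I i \<omega>)"
      using ae AE_space
    proof eventually_elim
      case (elim \<omega>)
      have fm: "(\<lambda>s. f s \<omega>) \<in> borel_measurable borel"
        using measurable_Pair2[OF f_joint elim(2)] by simp
      have "(LINT s:{0..t}|lebesgue. A *v x s \<omega> + B *v u s + (\<Sum>k\<in>UNIV. u s $ k *\<^sub>R (N k *v x s \<omega>)))
        = (LINT s|lborel_upto t. f s \<omega>)"
        using uu by (intro set_integral_lebesgue_eq_upto[OF fm]) (auto simp: f_def Xx elim!: eventually_mono)
      then show ?case using elim(1) t by (simp add: Xx)
    qed
    ultimately show "\<exists>I. (\<forall>i. ito i (\<lambda>z. H i *v X (snd z) (fst z)) t (I i)) \<and>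
      (AE \<omega> in M. X t \<omega> = (LINT s|lborel_upto t. f s \<omega>) + (\<Sum>i\<in>UNIV. I i \<omega>))" by blast
  qed
  have t0: "0 \<le> t" using t by simp
  show "L2 M (x t)" using X_L2[OF t0] Xx[OF t0] by simp
  define q where "q = (*v) R"
  have q: "bounded_linear q" unfolding q_def by (rule matrix_vector_mul_bounded_linear)
  interpret q: bounded_linear q by (rule q)
  have [measurable]: "q \<in> borel_measurable borel"
    by (intro borel_measurable_continuous_onI linear_continuous_on q)
  have qsym: "v \<bullet> q w = q v \<bullet> w" and qpsd: "0 \<le> v \<bullet> q v" for v w
    using spd_matrix_inv[OF P] by (simp_all add: q_def R_def)
  define V where "V s = expectation (\<lambda>\<omega>. X s \<omega> \<bullet> q (X s \<omega>))" for s
  have Vi: "integrable M (\<lambda>\<omega>. X s \<omega> \<bullet> q (X s \<omega>))" if "0 \<le> s" for s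
    by (intro L2_inner_integrable L2_linear[OF _ q] X_L2 that)
  have V0: "0 \<le> V s" for s unfolding V_def by (intro Bochner_Integration.integral_nonneg qpsd)
  have Vm: "V \<in> borel_measurable borel" unfolding V_def[abs_def] by measurable
  obtain C where C: "\<And>s. s \<in> {0..T} \<Longrightarrow> expectation (\<lambda>\<omega>. (norm (X s \<omega>))\<^sup>2) \<le> C"
    using second_moment_bound by blast
  obtain k where k: "0 \<le> k" "\<And>v. norm (q v) \<le> norm v * k" using q.nonneg_bounded by blast
  \<comment> \<open>A crude bound that supplies boundedness for Gronwall and integrability; it
    leaves no trace in the result.\<close>
  have VB: "V s \<le> k * C" if s: "s \<in> {0..T}" for s
  proof -
    have "v \<bullet> q v \<le> k * (norm v)\<^sup>2" for v
    proof -
      have "v \<bullet> q v \<le> norm v * norm (q v)" by (rule norm_cauchy_schwarz)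
      also have "\<dots> \<le> norm v * (norm v * k)" by (intro mult_left_mono k) simp
      finally show ?thesis by (simp add: power2_eq_square mult_ac)
    qed
    then have "V s \<le> expectation (\<lambda>\<omega>. k * (norm (X s \<omega>))\<^sup>2)"
      unfolding V_def using s Vi X_L2[of s] by (intro integral_mono) (auto simp: L2_def)
    also have "\<dots> \<le> k * C" using C[OF s] k(1) by (simp add: mult_left_mono)
    finally show ?thesis .
  qed
  \<comment> \<open>The first integral runs up to \<open>T\<close> and not up to \<open>s\<close>,
    so that it can serve as the additive constant in Gronwall's inequality.\<close>
  have Vle: "V s \<le> (LINT r|lborel_upto T. (norm (u' r))\<^sup>2) + (LINT r|lborel_upto s. (norm (u' r))\<^sup>2 * V r)" if s: "s \<in> {0..T}" for s
  proof -
    interpret lborel_upto: finite_measure "lborel_upto s" by simp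
    interpret P: pair_sigma_finite M "lborel_upto s" ..
    have s0: "0 \<le> s" "s \<le> T" using s by auto
    let ?f = "\<lambda>z. f (snd z) (fst z) \<bullet> q (X (snd z) (fst z))"
    let ?h = "\<lambda>i j z. (H i *v X (snd z) (fst z)) \<bullet> q (H j *v X (snd z) (fst z))"
    let ?W = "\<lambda>z. (norm (u' (snd z)))\<^sup>2 * (X (snd z) (fst z) \<bullet> q (X (snd z) (fst z)) + 1)"
    note e = energy_identity[OF s0(1) q qsym]
    have hi: "integrable (prod_upto s) (?h i j)" for i j
      by (intro L2_inner_integrable hX_L2 L2_linear[OF hX_L2 q] s0)
    have EW: "expectation (\<lambda>\<omega>. (norm (u' r))\<^sup>2 * (X r \<omega> \<bullet> q (X r \<omega>) + 1)) = (norm (u' r))\<^sup>2 * (V r + 1)" if "0 \<le> r" for r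
      using Vi[OF that] by (simp add: V_def prob_space)
    have W: "integrable (prod_upto s) ?W"
    proof (rule integrable_prod_uptoI[where d="\<lambda>r. (norm (u' r))\<^sup>2 * (k * C + 1)"
          and W="\<lambda>r \<omega>. (norm (u' r))\<^sup>2 * (X r \<omega> \<bullet> q (X r \<omega>) + 1)"])
      show "integrable (lborel_upto s) (\<lambda>r. (norm (u' r))\<^sup>2 * (k * C + 1))" using u2 by simp
      fix r assume r: "0 < r" "r \<le> s"
      show "integrable M (\<lambda>\<omega>. (norm (u' r))\<^sup>2 * (X r \<omega> \<bullet> q (X r \<omega>) + 1))" using Vi[of r] r by simp
      have "expectation (\<lambda>\<omega>. \<bar>(norm (u' r))\<^sup>2 * (X r \<omega> \<bullet> q (X r \<omega>) + 1)\<bar>) = (norm (u' r))\<^sup>2 * (V r + 1)"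
        using EW[of r] r qpsd by (simp add: abs_mult add_nonneg_nonneg)
      also have "\<dots> \<le> (norm (u' r))\<^sup>2 * (k * C + 1)"
        using VB[of r] r s0 by (intro mult_left_mono) auto
      finally show "expectation (\<lambda>\<omega>. \<bar>(norm (u' r))\<^sup>2 * (X r \<omega> \<bullet> q (X r \<omega>) + 1)\<bar>) \<le> (norm (u' r))\<^sup>2 * (k * C + 1)" .
    qed measurable
    \<comment> \<open>All terms are collected under one integral, since the dissipation inequality
      controls their sum and not each term.\<close>
    have "V s = (LINT z|prod_upto s. 2 * ?f z + (\<Sum>i\<in>UNIV. \<Sum>j\<in>UNIV. K $ i $ j * ?h i j z))"
      unfolding V_def e(2) using e(1) hi by simp
    also have "\<dots> \<le> (LINT z|prod_upto s. ?W z)"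
    proof (rule integral_mono)
      show "integrable (prod_upto s) (\<lambda>z. 2 * ?f z + (\<Sum>i\<in>UNIV. \<Sum>j\<in>UNIV. K $ i $ j * ?h i j z))"
        using e(1) hi by simp
      show "2 * ?f z + (\<Sum>i\<in>UNIV. \<Sum>j\<in>UNIV. K $ i $ j * ?h i j z) \<le> ?W z" for z
        unfolding f_def q_def R_def by (rule gramian_dissipation[OF gram])
    qed (rule W)
    also have "\<dots> = (LINT r|lborel_upto s. expectation (\<lambda>\<omega>. (norm (u' r))\<^sup>2 * (X r \<omega> \<bullet> q (X r \<omega>) + 1)))"
      using P.integral_snd[of "\<lambda>\<omega> r. (norm (u' r))\<^sup>2 * (X r \<omega> \<bullet> q (X r \<omega>) + 1)"] W by (simp add: split_beta')
    also have "\<dots> = (LINT r|lborel_upto s. (norm (u' r))\<^sup>2 + (norm (u' r))\<^sup>2 * V r)"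
    proof (rule integral_cong_AE)
      show "AE r in lborel_upto s. expectation (\<lambda>\<omega>. (norm (u' r))\<^sup>2 * (X r \<omega> \<bullet> q (X r \<omega>) + 1)) = (norm (u' r))\<^sup>2 + (norm (u' r))\<^sup>2 * V r"
        using EW by (auto simp: AE_upto distrib_left)
      show "(\<lambda>r. (norm (u' r))\<^sup>2 + (norm (u' r))\<^sup>2 * V r) \<in> borel_measurable (lborel_upto s)" using Vm by measurable
    qed measurable
    also have "\<dots> = (LINT r|lborel_upto s. (norm (u' r))\<^sup>2) + (LINT r|lborel_upto s. (norm (u' r))\<^sup>2 * V r)"
    proof (rule Bochner_Integration.integral_add[OF u2])
      show "integrable (lborel_upto s) (\<lambda>r. (norm (u' r))\<^sup>2 * V r)"
      proof (rule Bochner_Integration.integrable_bound)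
        show "integrable (lborel_upto s) (\<lambda>r. (norm (u' r))\<^sup>2 * (k * C))" using u2 by simp
        have "norm ((norm (u' r))\<^sup>2 * V r) \<le> norm ((norm (u' r))\<^sup>2 * (k * C))" if r: "0 < r" "r \<le> s" for r
          using VB[of r] V0[of r] r s0 mult_left_mono[of "V r" "k * C" "(norm (u' r))\<^sup>2"]
          by (simp add: abs_mult[of _ "V r"] order_trans[OF _ abs_ge_self])
        then show "AE r in lborel_upto s. norm ((norm (u' r))\<^sup>2 * V r) \<le> norm ((norm (u' r))\<^sup>2 * (k * C))"
          by (simp add: AE_upto)
      qed (use Vm in measurable)
    qed
    also have "(LINT r|lborel_upto s. (norm (u' r))\<^sup>2) \<le> (LINT r|lborel_upto T. (norm (u' r))\<^sup>2)"
      using integral_upto_eq_upto[of "\<lambda>r. (norm (u' r))\<^sup>2" s T] s0 u2[of T]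
        integrable_mult_indicator[of "{..s}" "lborel_upto T" "\<lambda>r. (norm (u' r))\<^sup>2"]
      by simp (intro integral_mono, auto simp: indicator_def)
    finally show ?thesis by simp
  qed
  have "V t \<le> (LINT r|lborel_upto T. (norm (u' r))\<^sup>2) * exp (LINT r|lborel_upto t. (norm (u' r))\<^sup>2)"
    by (rule gronwall[OF u2 _ Vm V0 VB Vle _ t]) auto
  also have "(LINT r|lborel_upto t. (norm (u' r))\<^sup>2) \<le> (LINT r|lborel_upto T. (norm (u' r))\<^sup>2)"
    using integral_upto_eq_upto[of "\<lambda>r. (norm (u' r))\<^sup>2" t T] t u2[of T]
      integrable_mult_indicator[of "{..t}" "lborel_upto T" "\<lambda>r. (norm (u' r))\<^sup>2"]
    by simp (intro integral_mono, auto simp: indicator_def)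
  then have "(LINT r|lborel_upto T. (norm (u' r))\<^sup>2) * exp (LINT r|lborel_upto t. (norm (u' r))\<^sup>2)
      \<le> (LINT r|lborel_upto T. (norm (u' r))\<^sup>2) * exp (LINT r|lborel_upto T. (norm (u' r))\<^sup>2)"
    by (intro mult_left_mono) auto
  finally show "(LINT \<omega>|M. x t \<omega> \<bullet> (matrix_inv P *v x t \<omega>)) \<le> (L2_norm_upto T u)\<^sup>2 * exp ((L2_norm_upto T u)\<^sup>2)"
    using t0 by (simp add: V_def Xx q_def R_def U)
qed

text \<open>Integrability and boundedness are part of the conclusion, so that neither the
  expectation nor the supremum can be a default value.\<close>

theorem mainTheorem3:
  fixes M :: "'a measure"
    and F :: "real \<Rightarrow> 'a measure"
    and L :: "real \<Rightarrow> 'a \<Rightarrow> real^'v"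
    and K :: "real^'v^'v"
    and A P :: "real^'n^'n"
    and B :: "real^'m^'n"
    and N :: "'m \<Rightarrow> real^'n^'n"
    and H :: "'v \<Rightarrow> real^'n^'n"
    and p :: "'n \<Rightarrow> real^'n"
    and ev :: "'n \<Rightarrow> real"
    and u :: "real \<Rightarrow> real^'m"
    and x :: "real \<Rightarrow> 'a \<Rightarrow> real^'n"
    and T :: real
    and k :: 'n
  assumes "filtered_prob_space M F"
    and "centered_L2_levy_process M F L K"
    and "mean_square_asymptotically_stable A N H K"
    and "reachability_gramian A B N H K P"
    and "\<And>i j. p i \<bullet> p j = (if i = j then 1 else 0)"
    and "span (range p) = UNIV"
    and "\<And>i. P *v p i = ev i *\<^sub>R p i"
    and "admissible_control u"
    and "bilinear_sde_solution M F L A B N H 0 u x"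
    and "T > 0"
  shows "(\<forall>t\<in>{0..T}. integrable M (\<lambda>\<omega>. (x t \<omega> \<bullet> p k)\<^sup>2)) \<and>
    bdd_above ((\<lambda>t. sqrt (LINT \<omega>|M. (x t \<omega> \<bullet> p k)\<^sup>2)) ` {0..T}) \<and>
    (SUP t\<in>{0..T}. sqrt (LINT \<omega>|M. (x t \<omega> \<bullet> p k)\<^sup>2))
      \<le> sqrt (ev k) * L2_norm_upto T u * exp (1/2 * (L2_norm_upto T u)\<^sup>2)"
proof -
  let ?U = "L2_norm_upto T u" and ?R = "matrix_inv P"
  have P: "spd_matrix P" using assms(4) by (simp add: reachability_gramian_def)
  have p1: "p k \<bullet> p k = 1" by (simp add: assms(5))
  note ev = eigenvector_inner_le[OF P assms(7) p1]
  note energy = bilinear_energy_bound[OF assms(1,2,4,8,9), where T=T]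
  have U0: "0 \<le> ?U"
    unfolding L2_norm_upto_def set_lebesgue_integral_def
    by (intro real_sqrt_ge_zero Bochner_Integration.integral_nonneg) auto
  have int: "integrable M (\<lambda>\<omega>. (x t \<omega> \<bullet> p k)\<^sup>2)" if t: "t \<in> {0..T}" for t
    using L2_linear[OF energy(1)[OF t] bounded_linear_inner_left, of "p k"] by (simp add: L2_def)
  have le: "sqrt (LINT \<omega>|M. (x t \<omega> \<bullet> p k)\<^sup>2) \<le> sqrt (ev k) * ?U * exp (1/2 * ?U\<^sup>2)" if t: "t \<in> {0..T}" for t
  proof -
    have "(LINT \<omega>|M. (x t \<omega> \<bullet> p k)\<^sup>2) \<le> (LINT \<omega>|M. ev k * (x t \<omega> \<bullet> (?R *v x t \<omega>)))"
      by (intro integral_mono int t ev integrable_mult_right L2_inner_integrable energy(1)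
          L2_linear[OF energy(1) matrix_vector_mul_bounded_linear] t)
    also have "\<dots> \<le> ev k * (?U\<^sup>2 * exp (?U\<^sup>2))"
      using mult_left_mono[OF energy(2)[OF t] ev(1)] by simp
    \<comment> \<open>The factor 1/2 in the exponent arises from writing the bound on the second
      moment as a square.\<close>
    also have "\<dots> = (sqrt (ev k) * ?U * exp (1/2 * ?U\<^sup>2))\<^sup>2"
      using ev(1) by (simp add: power_mult_distrib exp_double[symmetric])
    finally show ?thesis
      using ev(1) U0 by (intro real_le_lsqrt) auto
  qed
  show ?thesis
  proof (intro conjI ballI int)
    show "bdd_above ((\<lambda>t. sqrt (LINT \<omega>|M. (x t \<omega> \<bullet> p k)\<^sup>2)) ` {0..T})"
      by (rule bdd_aboveI2) (rule le)
    show "(SUP t\<in>{0..T}. sqrt (LINT \<omega>|M. (x t \<omega> \<bullet> p k)\<^sup>2)) \<le> sqrt (ev k) * ?U * exp (1/2 * ?U\<^sup>2)"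
      using \<open>T > 0\<close> by (intro cSUP_least le) auto
  qed
qed

end
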